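(* Let $h$ be a height function, $f$ the function defined by the octahedron recurrence, $\mathcal{G}$ the crosses-and-wrenches graph of $h$ with its edge labels, and for $(n,i,j)\in\mathcal{U}$ let $G_{(n,i,j)}$ be the finite subgraph with open faces described below. Then: (1) For every $(n,i,j)\in\mathcal{U}$, $$f(n,i,j)=\sum_{M}\ \prod_{e\in M\cap E_w}\lambda(e)\prod_{F}x(F)^{\epsilon_M(F)},$$ where $M$ ranges over all perfect matchings of $G_{(n,i,j)}$, $F$ ranges over all faces (closed and open) of $G_{(n,i,j)}$, $\lambda(e)$ is the label of the weighted edge $e$, and $x(F)=x(i',j')$ if $F$ is the face $(i',j')$. (2) If $(n,i,j),(n',i',j')\in\mathcal{U}$ and $n'\le n-|i'-i|-|j'-j|$, then every vertex, every edge and every face of $G_{(n',i',j')}$ is respectively a vertex, an edge and a face of $G_{(n,i,j)}$ (an open face of $G_{(n',i',j')}$ may be a closed face of $G_{(n,i,j)}$).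
   Context: Octahedron recurrence. Let $\mathcal{L}=\{(n,i,j)\in\mathbb{Z}^3 : n\equiv i+j \pmod 2\}$. A height function is $h\colon\mathbb{Z}^2\to\mathbb{Z}$ with (1) $|h(i_1,j_1)-h(i_2,j_2)|=1$ whenever $|i_1-i_2|+|j_1-j_2|=1$ ("lattice-adjacent"); (2) $h(i,j)\equiv i+j\pmod 2$; (3) $h(i,j)+|i|+|j|\to\infty$ as $|i|+|j|\to\infty$. Set $\mathcal{I}=\{(n,i,j)\in\mathcal{L}: n=h(i,j)\}$, $\mathcal{U}=\{(n,i,j)\in\mathcal{L}: n>h(i,j)\}$. With formal face variables $x(i,j)$ ($(i,j)\in\mathbb{Z}^2$) and edge variables $a(i,j),b(i,j),c(i,j),d(i,j)$ ($i+j$ odd), define $f(n,i,j)=x(i,j)$ on $\mathcal{I}$ and on $\mathcal{U}$ $$f(n,i,j)=\frac{a(i+n-1,j)c(i-n+1,j)f(n-1,i,j+1)f(n-1,i,j-1)+b(i,j+n-1)d(i,j-n+1)f(n-1,i+1,j)f(n-1,i-1,j)}{f(n-2,i,j)}.$$ Crosses-and-wrenches graph $\mathcal{G}$. $\mathcal{G}$ is an infinite planar graph whose faces are indexed by $\mathbb{Z}^2$ (face $(i,j)$ is drawn around the point $(i,j)$ and corresponds to $(h(i,j),i,j)\in\mathcal{I}$). For each $(i,j)$ consider the block $\{(i,j),(i+1,j),(i,j+1),(i+1,j+1)\}$ with its two diagonal pairs $\{(i,j),(i+1,j+1)\}$ and $\{(i+1,j),(i,j+1)\}$. Either both diagonal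 pairs have equal heights (a "cross"), in which case the block contributes one vertex incident to all four faces of the block; or exactly one diagonal pair $\{P,P'\}$ has equal heights (a "wrench"), in which case, writing $\{Q,Q'\}$ for the other pair, the block contributes two vertices $u_Q$ (incident to $P,P',Q$) and $u_{Q'}$ (incident to $P,P',Q'$) joined by a "diagonal" edge separating $P$ from $P'$. For each pair of lattice-adjacent faces $F,F'$, each of the two blocks containing both has a unique vertex incident to both $F$ and $F'$, and $\mathcal{G}$ has one edge joining these two vertices, separating $F$ from $F'$. These are all the edges. The diagonal edges form $E_u$ (unweighted edges); the others form $E_w$ (weighted edges). The boundary edges of face $(i,j)$ are the four edges separating it from $(i\pm1,j),(i,j\pm1)$ together with the diagonal edges of those wrench blocks in which $(i,j)$ belongs to the equal-height pair. Edge labels. For a weighted edge $e$ separating faces $(i_1,j_1)$ and $(i_2,j_2)$ with $(i_1-i_2)+(j_1-j_2)=1$, put $n_k=h(i_k,j_k)$. If $i_1=i_2+1$: $\lambda(e)=a(i_1+n_2,j_1)$ when $n_1>n_2$ and $\lambda(e)=c(i_1-n_2,j_1)$ when $n_1<n_2$. If $j_1=j_2+1$: $\lambda(e)=b(i_1,j_1+n_2)$ when $n_1>n_2$ and $\lambda(e)=d(i_1,j_1-n_2)$ when $n_1<n_2$. Subgraphs. For $(n_0,i_0,j_0)\in\mathcal{U}$ let $p(i,j)=n_0-|i-i_0|-|j-j_0|$. The graph with open faces $G=G_{(n_0,i_0,j_0)}$ has as closed faces the faces $(i,j)$ of $\mathcal{G}$ with $h(i,j)<p(i,j)$; its edges are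 the edges of $\mathcal{G}$ lying on the boundary of at least one closed face; its vertices are their endpoints; its open faces are the faces of $\mathcal{G}$ that are not closed but have at least one boundary edge that is an edge of $G$. A perfect matching of $G$ is a set $M$ of edges of $G$ such that every vertex of $G$ lies on exactly one edge of $M$. For a face $F$ of $G$ let $\alpha_F$ be the number of boundary edges of $F$ lying in $M$ and $\beta_F$ the number of boundary edges of $F$ that are edges of $G$ but not in $M$; set $\epsilon_M(F)=\lceil(\beta_F-\alpha_F)/2\rceil-1$ if $F$ is closed and $\epsilon_M(F)=\lceil(\beta_F-\alpha_F)/2\rceil$ if $F$ is open. *)

theory Defs
  imports
    "HOL-Library.Poly_Mapping"
    "HOL-Library.Countable"
    "HOL-Computational_Algebra.Fraction_Field"
    "HOL-Number_Theory.Cong"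
    Complex_Main
begin

section \<open>The field of rational functions in the formal variables\<close>

text \<open>
  The edge variables are used only at pairs \<open>(i, j)\<close> with \<open>i + j\<close> odd;
  the remaining ones never occur in the recurrence or among the edge labels.
\<close>

datatype var =
    Face_var int int
  | A_var int int
  | B_var int int
  | C_var int int
  | D_var int int

instance var :: countable
  by countable_datatype

text \<open>
  The linear order on the variables has no mathematical meaning: the library derives from it
  that polynomials over an integral domain form an integral domain.
\<close>

instantiation var :: linorder
begin

definition less_eq_var :: "var \<Rightarrow> var \<Rightarrow> bool" where
  "less_eq_var u v \<longleftrightarrow> to_nat u \<le> to_nat v"

definition less_var :: "var \<Rightarrow> var \<Rightarrow> bool" where
  "less_var u v \<longleftrightarrow> to_nat u < to_nat v"

instance
  by standard (auto simp: less_eq_var_def less_var_def)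

end

text \<open>Finitely supported exponent vectors \<open>var \<Rightarrow>\<^sub>0 nat\<close> are the monomials.\<close>

type_synonym polynomial = "(var \<Rightarrow>\<^sub>0 nat) \<Rightarrow>\<^sub>0 int"
type_synonym ratfun = "polynomial fract"

definition indet :: "var \<Rightarrow> ratfun" where
  "indet v = Fract (Poly_Mapping.single (Poly_Mapping.single v 1) 1) 1"

abbreviation xvar :: "int \<times> int \<Rightarrow> ratfun" where "xvar F \<equiv> indet (Face_var (fst F) (snd F))"
abbreviation avar :: "int \<Rightarrow> int \<Rightarrow> ratfun" where "avar i j \<equiv> indet (A_var i j)"
abbreviation bvar :: "int \<Rightarrow> int \<Rightarrow> ratfun" where "bvar i j \<equiv> indet (B_var i j)"
abbreviation cvar :: "int \<Rightarrow> int \<Rightarrow> ratfun" where "cvar i j \<equiv> indet (C_var i j)"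
abbreviation dvar :: "int \<Rightarrow> int \<Rightarrow> ratfun" where "dvar i j \<equiv> indet (D_var i j)"


section \<open>Height functions and the octahedron recurrence\<close>

type_synonym face = "int \<times> int"

definition lattice_adjacent :: "face \<Rightarrow> face \<Rightarrow> bool" where
  "lattice_adjacent F F' \<longleftrightarrow> \<bar>fst F - fst F'\<bar> + \<bar>snd F - snd F'\<bar> = 1"

definition lattice :: "(int \<times> int \<times> int) set" where
  "lattice = {(n, i, j). [n = i + j] (mod 2)}"

definition height_function :: "(face \<Rightarrow> int) \<Rightarrow> bool" where
  "height_function h \<longleftrightarrow>
     (\<forall>F F'. lattice_adjacent F F' \<longrightarrow> \<bar>h F - h F'\<bar> = 1) \<and>
     (\<forall>i j. [h (i, j) = i + j] (mod 2)) \<and>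
     filterlim (\<lambda>(i, j). h (i, j) + \<bar>i\<bar> + \<bar>j\<bar>) at_top
       (filtercomap (\<lambda>(i, j). \<bar>i\<bar> + \<bar>j\<bar>) at_top)"

definition initial_points :: "(face \<Rightarrow> int) \<Rightarrow> (int \<times> int \<times> int) set" where
  "initial_points h = {(n, i, j) \<in> lattice. n = h (i, j)}"

definition upper_points :: "(face \<Rightarrow> int) \<Rightarrow> (int \<times> int \<times> int) set" where
  "upper_points h = {(n, i, j) \<in> lattice. n > h (i, j)}"

definition closed_faces :: "(face \<Rightarrow> int) \<Rightarrow> int \<times> int \<times> int \<Rightarrow> face set" where
  "closed_faces h = (\<lambda>(n, i, j). {(k, l). h (k, l) < n - \<bar>k - i\<bar> - \<bar>l - j\<bar>})"

lemma finite_closed_faces: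
  assumes "height_function h"
  shows "finite (closed_faces h (n, i, j))"
proof -
  have lim: "filterlim (\<lambda>(i, j). h (i, j) + \<bar>i\<bar> + \<bar>j\<bar>) at_top
       (filtercomap (\<lambda>(i, j). \<bar>i\<bar> + \<bar>j\<bar>) at_top)"
    using assms by (simp add: height_function_def)
  have "eventually (\<lambda>(k, l). h (k, l) + \<bar>k\<bar> + \<bar>l\<bar> \<ge> n + \<bar>i\<bar> + \<bar>j\<bar>)
      (filtercomap (\<lambda>(i, j). \<bar>i\<bar> + \<bar>j\<bar>) at_top)"
    using lim unfolding filterlim_at_top by (auto simp: case_prod_unfold)
  then obtain Q where "eventually Q at_top"
    and Q: "\<And>k l. Q (\<bar>k\<bar> + \<bar>l\<bar>) \<Longrightarrow> h (k, l) + \<bar>k\<bar> + \<bar>l\<bar> \<ge> n + \<bar>i\<bar> + \<bar>j\<bar>"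
    unfolding eventually_filtercomap by auto
  then obtain B :: int where "\<And>m. m \<ge> B \<Longrightarrow> Q m"
    unfolding eventually_at_top_linorder by auto
  with Q have B: "h (k, l) + \<bar>k\<bar> + \<bar>l\<bar> \<ge> n + \<bar>i\<bar> + \<bar>j\<bar>" if "\<bar>k\<bar> + \<bar>l\<bar> \<ge> B" for k l
    using that by blast
  have "closed_faces h (n, i, j) \<subseteq> {- B..B} \<times> {- B..B}"
  proof (rule subrelI)
    fix k l
    assume "(k, l) \<in> closed_faces h (n, i, j)"
    then have "h (k, l) < n - \<bar>k - i\<bar> - \<bar>l - j\<bar>"
      by (simp add: closed_faces_def)
    then have "\<not> \<bar>k\<bar> + \<bar>l\<bar> \<ge> B"
      using B[of k l] by linarith
    then show "(k, l) \<in> {- B..B} \<times> {- B..B}"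
      by auto
  qed
  then show ?thesis
    by (rule finite_subset) auto
qed

definition lower_cone :: "(face \<Rightarrow> int) \<Rightarrow> int \<Rightarrow> int \<Rightarrow> int \<Rightarrow> (int \<times> int \<times> int) set" where
  "lower_cone h n i j = {(m, k, l) \<in> upper_points h. m \<le> n - \<bar>k - i\<bar> - \<bar>l - j\<bar>}"

lemma finite_lower_cone:
  assumes "height_function h"
  shows "finite (lower_cone h n i j)"
proof -
  have "lower_cone h n i j \<subseteq> (\<Union>(k, l)\<in>closed_faces h (n, i, j). {h (k, l)..n} \<times> {(k, l)})"
    by (auto simp: lower_cone_def upper_points_def closed_faces_def)
  then show ?thesis
    by (rule finite_subset) (auto intro: finite_closed_faces[OF assms])
qed

lemma lower_cone_decreasing:
  assumes "height_function h" "(n, i, j) \<in> upper_points h"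
    and "m + \<bar>k - i\<bar> + \<bar>l - j\<bar> \<le> n" "m < n"
  shows "card (lower_cone h m k l) < card (lower_cone h n i j)"
proof (rule psubset_card_mono)
  show "finite (lower_cone h n i j)"
    by (rule finite_lower_cone) fact
  have "lower_cone h m k l \<subseteq> lower_cone h n i j"
    using assms(3) by (auto simp: lower_cone_def)
  moreover have "(n, i, j) \<in> lower_cone h n i j - lower_cone h m k l"
    using assms by (auto simp: lower_cone_def)
  ultimately show "lower_cone h m k l \<subset> lower_cone h n i j"
    by blast
qed

text \<open>
  The recurrence is well-founded because of the third condition on height functions. Only the
  values on \<^term>\<open>initial_points h\<close> and \<^term>\<open>upper_points h\<close> for a height function \<open>h\<close> are
  meaningful; elsewhere the second branch is a dummy value.
\<close>

function octahedron :: "(face \<Rightarrow> int) \<Rightarrow> int \<Rightarrow> int \<Rightarrow> int \<Rightarrow> ratfun" where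
  "octahedron h n i j =
     (if height_function h \<and> (n, i, j) \<in> upper_points h
      then (avar (i + n - 1) j * cvar (i - n + 1) j *
              octahedron h (n - 1) i (j + 1) * octahedron h (n - 1) i (j - 1) +
            bvar i (j + n - 1) * dvar i (j - n + 1) *
              octahedron h (n - 1) (i + 1) j * octahedron h (n - 1) (i - 1) j)
           / octahedron h (n - 2) i j
      else xvar (i, j))"
  by pat_completeness auto
termination
  by (relation "measure (\<lambda>(h, n, i, j). card (lower_cone h n i j))")
     (auto intro!: lower_cone_decreasing)

declare octahedron.simps [simp del]

lemma octahedron_initial:
  assumes "(n, i, j) \<in> initial_points h"
  shows "octahedron h n i j = xvar (i, j)"
  using assms by (subst octahedron.simps) (auto simp: initial_points_def upper_points_def)

lemma octahedron_predecessors: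
  assumes "height_function h" "(n, i, j) \<in> upper_points h"
  shows "{(n - 1, i, j + 1), (n - 1, i, j - 1), (n - 1, i + 1, j), (n - 1, i - 1, j), (n - 2, i, j)}
           \<subseteq> initial_points h \<union> upper_points h"
proof -
  have adj: "\<bar>h (i, j) - h F\<bar> = 1" if "lattice_adjacent (i, j) F" for F
    using assms(1) that unfolding height_function_def by blast
  have par: "h (i, j) mod 2 = (i + j) mod 2"
    using assms(1) by (simp add: height_function_def cong_def)
  have n: "n mod 2 = (i + j) mod 2" "n > h (i, j)"
    using assms(2) by (auto simp: upper_points_def lattice_def cong_def)
  have "n \<noteq> h (i, j) + 1"
    using n(1) par by presburger
  with n(2) have n2: "n \<ge> h (i, j) + 2"
    by linarith
  have n1: "n - 1 \<ge> h F" if "lattice_adjacent (i, j) F" for F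
    using n2 adj[OF that] by linarith
  have *: "(m, k, l) \<in> initial_points h \<union> upper_points h"
    if "m \<ge> h (k, l)" "m mod 2 = (k + l) mod 2" for m k l
    using that by (auto simp: initial_points_def upper_points_def lattice_def cong_def)
  have mod: "(n - 1) mod 2 = (i + (j + 1)) mod 2" "(n - 1) mod 2 = (i + (j - 1)) mod 2"
    "(n - 1) mod 2 = (i + 1 + j) mod 2" "(n - 1) mod 2 = (i - 1 + j) mod 2"
    "(n - 2) mod 2 = (i + j) mod 2"
    using n(1) by presburger+
  have "n - 1 \<ge> h (i, j + 1)" "n - 1 \<ge> h (i, j - 1)" "n - 1 \<ge> h (i + 1, j)" "n - 1 \<ge> h (i - 1, j)"
    by (rule n1, simp add: lattice_adjacent_def)+
  moreover have "n - 2 \<ge> h (i, j)"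
    using n2 by linarith
  ultimately show ?thesis
    using mod by (intro insert_subsetI empty_subsetI *)
qed


section \<open>The crosses-and-wrenches graph\<close>

text \<open>
  A vertex is represented by the set of the faces it is incident to: the four faces of the block
  for a cross, and \<open>{P, P', Q}\<close> or \<open>{P, P', Q'}\<close> for a wrench. Three faces of a block determine
  the block, so distinct vertices have distinct representations. An edge is represented by the
  set of the two faces it separates; distinct edges separate distinct pairs of faces.
\<close>

type_synonym vertex = "face set"
type_synonym edge = "face set"

definition block_vertices :: "(face \<Rightarrow> int) \<Rightarrow> int \<Rightarrow> int \<Rightarrow> vertex set" where
  "block_vertices h i j =
     (let SW = (i, j); SE = (i + 1, j); NW = (i, j + 1); NE = (i + 1, j + 1) in
        if h SW = h NE \<and> h SE = h NW then {{SW, SE, NW, NE}}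
        else if h SW = h NE then {{SW, NE, SE}, {SW, NE, NW}}
        else {{SE, NW, SW}, {SE, NW, NE}})"

definition graph_vertices :: "(face \<Rightarrow> int) \<Rightarrow> vertex set" where
  "graph_vertices h = (\<Union>i j. block_vertices h i j)"

definition weighted_edges :: "edge set" where
  "weighted_edges = {{F, F'} | F F'. lattice_adjacent F F'}"

definition unweighted_edges :: "(face \<Rightarrow> int) \<Rightarrow> edge set" where
  "unweighted_edges h =
     {{(i, j), (i + 1, j + 1)} | i j.
        h (i, j) = h (i + 1, j + 1) \<and> h (i + 1, j) \<noteq> h (i, j + 1)} \<union>
     {{(i + 1, j), (i, j + 1)} | i j.
        h (i + 1, j) = h (i, j + 1) \<and> h (i, j) \<noteq> h (i + 1, j + 1)}"

definition graph_edges :: "(face \<Rightarrow> int) \<Rightarrow> edge set" where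
  "graph_edges h = weighted_edges \<union> unweighted_edges h"

text \<open>
  A weighted edge joins, in each of the two blocks containing both separated faces, the vertex
  incident to both; a diagonal edge joins the two vertices of its wrench block, which are the
  vertices incident to both faces of the equal-height pair.
\<close>

definition endpoints :: "(face \<Rightarrow> int) \<Rightarrow> edge \<Rightarrow> vertex set" where
  "endpoints h e = {v \<in> graph_vertices h. e \<subseteq> v}"

definition boundary_edges :: "(face \<Rightarrow> int) \<Rightarrow> face \<Rightarrow> edge set" where
  "boundary_edges h F = {e \<in> graph_edges h. F \<in> e}"

text \<open>
  For a weighted edge exactly one of the two orderings of the separated faces satisfies the
  condition below, so the label is well defined; it is meaningful for weighted edges only.
\<close>

definition edge_label :: "(face \<Rightarrow> int) \<Rightarrow> edge \<Rightarrow> ratfun" where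
  "edge_label h e =
     (let ((i1, j1), (i2, j2)) =
            (THE (F1, F2). e = {F1, F2} \<and> (fst F1 - fst F2) + (snd F1 - snd F2) = 1);
          n1 = h (i1, j1);
          n2 = h (i2, j2)
      in if i1 = i2 + 1
         then (if n1 > n2 then avar (i1 + n2) j1 else cvar (i1 - n2) j1)
         else (if n1 > n2 then bvar i1 (j1 + n2) else dvar i1 (j1 - n2)))"


section \<open>The graphs with open faces and their perfect matchings\<close>

definition sub_edges :: "(face \<Rightarrow> int) \<Rightarrow> int \<times> int \<times> int \<Rightarrow> edge set" where
  "sub_edges h p = (\<Union>F\<in>closed_faces h p. boundary_edges h F)"

definition sub_vertices :: "(face \<Rightarrow> int) \<Rightarrow> int \<times> int \<times> int \<Rightarrow> vertex set" where
  "sub_vertices h p = (\<Union>e\<in>sub_edges h p. endpoints h e)"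

definition open_faces :: "(face \<Rightarrow> int) \<Rightarrow> int \<times> int \<times> int \<Rightarrow> face set" where
  "open_faces h p = {F. F \<notin> closed_faces h p \<and> boundary_edges h F \<inter> sub_edges h p \<noteq> {}}"

definition sub_faces :: "(face \<Rightarrow> int) \<Rightarrow> int \<times> int \<times> int \<Rightarrow> face set" where
  "sub_faces h p = closed_faces h p \<union> open_faces h p"

definition perfect_matching :: "(face \<Rightarrow> int) \<Rightarrow> int \<times> int \<times> int \<Rightarrow> edge set \<Rightarrow> bool" where
  "perfect_matching h p M \<longleftrightarrow>
     M \<subseteq> sub_edges h p \<and> (\<forall>v\<in>sub_vertices h p. \<exists>!e. e \<in> M \<and> v \<in> endpoints h e)"

definition face_exponent ::
  "(face \<Rightarrow> int) \<Rightarrow> int \<times> int \<times> int \<Rightarrow> edge set \<Rightarrow> face \<Rightarrow> int" where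
  "face_exponent h p M F =
     (let \<alpha> = card (boundary_edges h F \<inter> M);
          \<beta> = card (boundary_edges h F \<inter> sub_edges h p - M);
          c = \<lceil>(real \<beta> - real \<alpha>) / 2\<rceil>
      in if F \<in> closed_faces h p then c - 1 else c)"

end

theory Submission
  imports Defs
begin

text \<open>
  Fix the apex \<open>(n\<^sub>0, i\<^sub>0, j\<^sub>0)\<close> with cone \<open>p(i, j) = n\<^sub>0 - |i - i\<^sub>0| - |j - j\<^sub>0|\<close> and replace \<open>h\<close> by
  \<open>min h p\<close>. Outside the closed faces every block of the new height function is a wrench, so
  the matchings of the finite graph become the matchings of an infinite graph that use all
  diagonals far away, and the exponents of closed and open faces are given by one formula. For
  \<open>p\<close> itself only the all-diagonal matching remains and its weight is \<open>f(n\<^sub>0, i\<^sub>0, j\<^sub>0)\<close>. Any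
  other height function below \<open>p\<close> is joined to \<open>p\<close> by raising local minima by 2. Such a move
  changes the four blocks around one square face from crosses to wrenches and vice versa
  (urban renewal), and by one instance of the octahedron recurrence it preserves the weighted
  sum over matchings.
\<close>

section \<open>Subtraction-free rational functions\<close>

text \<open>What lets the induction close is a generalized weight: in the sum for an intermediate
  height function \<open>g\<close>, a face \<open>F\<close> carries the value f(g(F), F) of the
  recurrence, not the variable x(F). Raising a local minimum from m to m + 2 then replaces f(m, F)
  by f(m + 2, F), and the relation needed between these two and the four neighbours is the
  recurrence itself. For \<open>min h p\<close> every face of the finite graph still has the height
  \<open>h F\<close>, so its value is a variable. Two obstacles shape the rest. Face values also
  occur with negative exponents, so all values of the recurrence must be nonzero;
  subtraction-freeness serves this. And cutting at the cone disturbs the boundary: a wrench with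
  only one tip closed becomes a cross, an open face acquires diagonals outside the finite graph, and
  a face that reaches the cone may lose edges. Each time the missing or extra part is forced, and
  the ceiling in the exponents of open faces absorbs the discrepancy.\<close>

definition nonneg_poly :: "polynomial \<Rightarrow> bool" where
  "nonneg_poly P \<longleftrightarrow> P \<noteq> 0 \<and> (\<forall>k. Poly_Mapping.lookup P k \<ge> 0)"

lemma nonneg_poly_mult:
  assumes "nonneg_poly P" "nonneg_poly Q"
  shows "nonneg_poly (P * Q)"
proof -
  have "Poly_Mapping.lookup (P * Q) k \<ge> 0" for k
    using assms unfolding nonneg_poly_def times_poly_mapping.rep_eq prod_fun_def
    by (auto simp: Sum_any.expand_set when_def intro!: sum_nonneg mult_nonneg_nonneg)
  then show ?thesis
    using assms by (simp add: nonneg_poly_def)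
qed

text \<open>Nonnegative coefficients cannot cancel: a positive coefficient of \<open>P\<close> stays
  positive in \<open>P + Q\<close>.\<close>

lemma nonneg_poly_add:
  assumes "nonneg_poly P" "nonneg_poly Q"
  shows "nonneg_poly (P + Q)"
proof -
  obtain k where "Poly_Mapping.lookup P k \<noteq> 0"
    using assms(1) unfolding nonneg_poly_def by (metis lookup_zero poly_mapping_eqI)
  then have "Poly_Mapping.lookup (P + Q) k > 0"
    using assms unfolding nonneg_poly_def lookup_add
    by (metis add_pos_nonneg order_le_less)
  then have "P + Q \<noteq> 0"
    by auto
  then show ?thesis
    using assms by (auto simp: nonneg_poly_def lookup_add)
qed

text \<open>Nonvanishing alone is not stable under the addition in the recurrence. This class
  contains the indeterminates, is closed under sums, products and quotients, and avoids 0.\<close>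

definition subtraction_free :: "ratfun \<Rightarrow> bool" where
  "subtraction_free q \<longleftrightarrow> (\<exists>P Q. nonneg_poly P \<and> nonneg_poly Q \<and> q = Fract P Q)"

lemma subtraction_free_nonzero: "subtraction_free q \<Longrightarrow> q \<noteq> 0"
  by (auto simp: subtraction_free_def nonneg_poly_def Zero_fract_def eq_fract)

lemma subtraction_free_mult: "subtraction_free q \<Longrightarrow> subtraction_free r \<Longrightarrow> subtraction_free (q * r)"
  unfolding subtraction_free_def by (metis mult_fract nonneg_poly_mult)

lemma subtraction_free_divide: "subtraction_free q \<Longrightarrow> subtraction_free r \<Longrightarrow> subtraction_free (q / r)"
  unfolding subtraction_free_def by (metis divide_fract nonneg_poly_mult)

lemma subtraction_free_add: "subtraction_free q \<Longrightarrow> subtraction_free r \<Longrightarrow> subtraction_free (q + r)"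
  unfolding subtraction_free_def
  by (metis add_fract nonneg_poly_mult nonneg_poly_add nonneg_poly_def)

lemma subtraction_free_indet: "subtraction_free (indet v)"
proof -
  have "nonneg_poly (Poly_Mapping.single k 1)" for k
    by (auto simp: nonneg_poly_def lookup_single when_def)
  from this[of 0] this show ?thesis
    unfolding subtraction_free_def indet_def single_one by metis
qed

text \<open>The induction follows the recursion; the dummy values are indeterminates as well, so
  every argument is covered.\<close>

lemma octahedron_nonzero: "octahedron h n i j \<noteq> 0"
proof (rule subtraction_free_nonzero)
  show "subtraction_free (octahedron h n i j)"
  proof (induction h n i j rule: octahedron.induct)
    case (1 h n i j)
    show ?case
      by (subst octahedron.simps)
        (auto intro!: subtraction_free_add subtraction_free_divide subtraction_free_mult
          subtraction_free_indet 1)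
  qed
qed

lemma octahedron_recurrence:
  assumes "height_function h" "(n, i, j) \<in> upper_points h"
  shows "octahedron h n i j * octahedron h (n - 2) i j =
    avar (i + n - 1) j * cvar (i - n + 1) j *
      octahedron h (n - 1) i (j + 1) * octahedron h (n - 1) i (j - 1) +
    bvar i (j + n - 1) * dvar i (j - n + 1) *
      octahedron h (n - 1) (i + 1) j * octahedron h (n - 1) (i - 1) j"
  using assms octahedron_nonzero[of h "n - 2" i j] by (subst octahedron.simps) simp

section \<open>Configurations of weighted edges\<close>

definition ind :: "edge set \<Rightarrow> face \<Rightarrow> face \<Rightarrow> int" where
  "ind W F F' = of_bool ({F, F'} \<in> W)"

lemma ind_commute: "ind W F F' = ind W F' F"
  by (simp add: ind_def insert_commute)

lemma ind_nonneg [simp]: "ind W F F' \<ge> 0"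
  by (simp add: ind_def)

definition step_function :: "(face \<Rightarrow> int) \<Rightarrow> bool" where
  "step_function g \<longleftrightarrow> (\<forall>F F'. lattice_adjacent F F' \<longrightarrow> \<bar>g F - g F'\<bar> = 1)"

lemma step_function_horizontal:
  "step_function g \<Longrightarrow> g (i + 1, j) = g (i, j) + 1 \<or> g (i + 1, j) = g (i, j) - 1"
  unfolding step_function_def lattice_adjacent_def
  by (drule spec[of _ "(i + 1, j)"], drule spec[of _ "(i, j)"]) (auto simp: abs_if split: if_splits)

lemma step_function_vertical:
  "step_function g \<Longrightarrow> g (i, j + 1) = g (i, j) + 1 \<or> g (i, j + 1) = g (i, j) - 1"
  unfolding step_function_def lattice_adjacent_def
  by (drule spec[of _ "(i, j + 1)"], drule spec[of _ "(i, j)"]) (auto simp: abs_if split: if_splits)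

lemma lattice_adjacent_iff:
  "lattice_adjacent (i, j) F \<longleftrightarrow> F \<in> {(i + 1, j), (i - 1, j), (i, j + 1), (i, j - 1)}"
  by (cases F) (auto simp: lattice_adjacent_def)

text \<open>The description in \<open>edge_label\<close> lists the face with the larger coordinate
  first, so \<open>(i, j)\<close> plays the role of \<open>F2\<close> and its height enters the
  index.\<close>

lemma edge_label_horizontal:
  "edge_label g {(i, j), (i + 1, j)} =
     (if g (i + 1, j) > g (i, j) then avar (i + 1 + g (i, j)) j else cvar (i + 1 - g (i, j)) j)"
proof -
  have "(THE (F1, F2). {(i, j), (i + 1, j)} = {F1, F2} \<and>
          (fst F1 - fst F2) + (snd F1 - snd F2) = 1) = ((i + 1, j), (i, j))"
    by (rule the_equality) (auto simp: doubleton_eq_iff)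
  then show ?thesis
    by (simp add: edge_label_def)
qed

lemma edge_label_vertical:
  "edge_label g {(i, j), (i, j + 1)} =
     (if g (i, j + 1) > g (i, j) then bvar i (j + 1 + g (i, j)) else dvar i (j + 1 - g (i, j)))"
proof -
  have "(THE (F1, F2). {(i, j), (i, j + 1)} = {F1, F2} \<and>
          (fst F1 - fst F2) + (snd F1 - snd F2) = 1) = ((i, j + 1), (i, j))"
    by (rule the_equality) (auto simp: doubleton_eq_iff)
  then show ?thesis
    by (simp add: edge_label_def)
qed

lemma weighted_edge_cases:
  assumes "e \<in> weighted_edges"
  obtains i j where "e = {(i, j), (i + 1, j)}" | i j where "e = {(i, j), (i, j + 1)}"
proof -
  obtain i j F where "e = {(i, j), F}" "lattice_adjacent (i, j) F"
    using assms by (auto simp: weighted_edges_def)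
  moreover have "\<exists>i j. {(k + 1, l), (k, l)} = {(i, j), (i + 1, j)}" 
    "\<exists>i j. {(k, l), (k - 1, l)} = {(i, j), (i + 1, j)}"
    "\<exists>i j. {(k, l), (k, l - 1)} = {(i, j), (i, j + 1)}" for k l :: int
    by (metis insert_commute diff_add_cancel)+
  ultimately show thesis
    using that unfolding lattice_adjacent_iff by (metis empty_iff insert_iff)
qed

lemma edge_label_cong:
  assumes "e \<in> weighted_edges" "\<And>F. F \<in> e \<Longrightarrow> g F = g' F"
  shows "edge_label g e = edge_label g' e"
  using assms(1)
proof (cases rule: weighted_edge_cases)
  case (1 i j)
  then have "g (i, j) = g' (i, j)" "g (i + 1, j) = g' (i + 1, j)"
    using assms(2) by auto
  then show ?thesis
    by (simp add: 1 edge_label_horizontal)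
next
  case (2 i j)
  then have "g (i, j) = g' (i, j)" "g (i, j + 1) = g' (i, j + 1)"
    using assms(2) by auto
  then show ?thesis
    by (simp add: 2 edge_label_vertical)
qed

text \<open>
  A matching is encoded by its weighted edges alone: the diagonal edge of a wrench is in the
  matching iff none of the four weighted edges meeting in the block is. The arguments of
  \<open>block_cond\<close> are the heights of the faces of a block and the indicators of the weighted
  edges on its bottom, left, right and top side.
\<close>

definition block_cond :: "int \<Rightarrow> int \<Rightarrow> int \<Rightarrow> int \<Rightarrow> int \<Rightarrow> int \<Rightarrow> int \<Rightarrow> int \<Rightarrow> bool" where
  "block_cond sw se nw ne b l r t \<longleftrightarrow>
     (if sw = ne \<and> se = nw then b + l + r + t = 1
      else if sw = ne then b + r = l + t \<and> b + r \<le> 1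
      else b + l = r + t \<and> b + l \<le> 1)"

text \<open>The signs \<open>s\<close>, \<open>t\<close> allow the condition to be read from any of
  the four faces of a block: it concerns the block in direction \<open>(s, t)\<close> from
  \<open>(i, j)\<close>. The four blocks around a face can then be treated uniformly.\<close>

definition corner_ok :: "(face \<Rightarrow> int) \<Rightarrow> edge set \<Rightarrow> int \<Rightarrow> int \<Rightarrow> int \<Rightarrow> int \<Rightarrow> bool" where
  "corner_ok g W i j s t \<longleftrightarrow>
     block_cond (g (i, j)) (g (i + s, j)) (g (i, j + t)) (g (i + s, j + t))
       (ind W (i, j) (i + s, j)) (ind W (i, j) (i, j + t))
       (ind W (i + s, j) (i + s, j + t)) (ind W (i, j + t) (i + s, j + t))"

text \<open>If the two neighbours of \<open>(i, j)\<close> in the block have different heights,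
  these are one above and one below \<open>g (i, j)\<close>, and the opposite face is adjacent to
  both.\<close>

lemma step_function_diagonal:
  "step_function g \<Longrightarrow> g (i, j) = g (i + 1, j + 1) \<or> g (i + 1, j) = g (i, j + 1)"
  using step_function_horizontal[of g i j] step_function_horizontal[of g i "j + 1"]
    step_function_vertical[of g i j] step_function_vertical[of g "i + 1" j]
  by linarith

text \<open>The last branch of \<open>block_cond\<close> tacitly takes \<open>se\<close> and
  \<open>nw\<close> to be equal; the assumption makes the case distinction invariant under these
  symmetries of the square.\<close>

lemma block_cond_flip:
  assumes "sw = ne \<or> se = nw"
  shows "block_cond se sw ne nw b r l t \<longleftrightarrow> block_cond sw se nw ne b l r t"
    and "block_cond nw ne sw se t l r b \<longleftrightarrow> block_cond sw se nw ne b l r t"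
    and "block_cond ne nw se sw t r l b \<longleftrightarrow> block_cond sw se nw ne b l r t"
  using assms unfolding block_cond_def by auto

lemma corner_ok_reorient:
  assumes "step_function g"
  shows "corner_ok g W i j (- 1) 1 = corner_ok g W (i - 1) j 1 1"
    and "corner_ok g W i j 1 (- 1) = corner_ok g W i (j - 1) 1 1"
    and "corner_ok g W i j (- 1) (- 1) = corner_ok g W (i - 1) (j - 1) 1 1"
proof -
  show "corner_ok g W i j (- 1) 1 = corner_ok g W (i - 1) j 1 1"
    using block_cond_flip(1)[OF step_function_diagonal[OF assms, of "i - 1" j]]
    by (simp add: corner_ok_def ind_commute[of W "(i, _)" "(i - 1, _)"])
  show "corner_ok g W i j 1 (- 1) = corner_ok g W i (j - 1) 1 1"
    using block_cond_flip(2)[OF step_function_diagonal[OF assms, of i "j - 1"]]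
    by (simp add: corner_ok_def ind_commute[of W "(_, j)" "(_, j - 1)"])
  show "corner_ok g W i j (- 1) (- 1) = corner_ok g W (i - 1) (j - 1) 1 1"
    using block_cond_flip(3)[OF step_function_diagonal[OF assms, of "i - 1" "j - 1"]]
    by (simp add: corner_ok_def ind_commute[of W "(_, j)" "(_, j - 1)"]
        ind_commute[of W "(i, _)" "(i - 1, _)"])
qed

definition valid_config :: "(face \<Rightarrow> int) \<Rightarrow> edge set \<Rightarrow> bool" where
  "valid_config g W \<longleftrightarrow> (\<forall>i j. corner_ok g W i j 1 1)"

lemma valid_config_at:
  assumes "step_function g"
  shows "valid_config g W \<longleftrightarrow>
    (\<forall>k l. (k, l) \<notin> {i - 1, i} \<times> {j - 1, j} \<longrightarrow> corner_ok g W k l 1 1) \<and>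
    (\<forall>s\<in>{1, -1}. \<forall>t\<in>{1, -1}. corner_ok g W i j s t)"
proof -
  have "(\<forall>k l. Q k l) \<longleftrightarrow> (\<forall>k l. (k, l) \<notin> {i - 1, i} \<times> {j - 1, j} \<longrightarrow> Q k l) \<and>
      Q i j \<and> Q i (j - 1) \<and> Q (i - 1) j \<and> Q (i - 1) (j - 1)" for Q
    by simp metis
  from this[of "\<lambda>k l. corner_ok g W k l 1 1"] show ?thesis
    using corner_ok_reorient[OF assms, of W i j] by (simp add: valid_config_def)
qed

text \<open>
  For a face with \<open>L\<close> boundary edges of which \<open>\<alpha>\<close> are matched, \<open>double_exp\<close> is \<open>L - 2 - 2 \<alpha>\<close>;
  \<open>corner_exp\<close> is the contribution of the diagonal edge of a block, which exists iff the two
  neighbours of the face in the block have different heights.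
\<close>

definition corner_exp :: "(face \<Rightarrow> int) \<Rightarrow> edge set \<Rightarrow> int \<Rightarrow> int \<Rightarrow> int \<Rightarrow> int \<Rightarrow> int" where
  "corner_exp g W i j s t =
     (if g (i + s, j) = g (i, j + t) then 0
      else if ind W (i, j) (i + s, j) + ind W (i, j) (i, j + t) +
         (ind W (i + s, j) (i + s, j + t) + ind W (i, j + t) (i + s, j + t)) = 0 then - 1 else 1)"

definition double_exp :: "(face \<Rightarrow> int) \<Rightarrow> edge set \<Rightarrow> face \<Rightarrow> int" where
  "double_exp g W = (\<lambda>(i, j).
     2 - 2 * (ind W (i, j) (i + 1, j) + ind W (i, j) (i - 1, j) +
              ind W (i, j) (i, j + 1) + ind W (i, j) (i, j - 1)) +
     corner_exp g W i j 1 1 + corner_exp g W i j (- 1) 1 +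
     corner_exp g W i j (- 1) (- 1) + corner_exp g W i j 1 (- 1))"

definition config_exp :: "(face \<Rightarrow> int) \<Rightarrow> edge set \<Rightarrow> face \<Rightarrow> int" where
  "config_exp g W F = double_exp g W F div 2"

text \<open>A corner contributes an odd number iff the two neighbours in it have different heights.
  On a walk round the four neighbours, whose heights take at most two values, the height changes an
  even number of times.\<close>

lemma even_double_exp:
  assumes "step_function g"
  shows "even (double_exp g W F)"
proof (cases F)
  case (Pair i j)
  have *: "even (corner_exp g W i j s t) \<longleftrightarrow> g (i + s, j) = g (i, j + t)" for s t
    by (simp add: corner_exp_def)
  have "g (i + 1, j) = g (i, j) + 1 \<or> g (i + 1, j) = g (i, j) - 1"
    "g (i - 1, j) = g (i, j) + 1 \<or> g (i - 1, j) = g (i, j) - 1"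
    "g (i, j + 1) = g (i, j) + 1 \<or> g (i, j + 1) = g (i, j) - 1"
    "g (i, j - 1) = g (i, j) + 1 \<or> g (i, j - 1) = g (i, j) - 1"
    using step_function_horizontal[OF assms, of i j] step_function_horizontal[OF assms, of "i - 1" j]
      step_function_vertical[OF assms, of i j] step_function_vertical[OF assms, of i "j - 1"]
    by (auto simp del: diff_eq_eq eq_diff_eq)
  then show ?thesis
    unfolding Pair double_exp_def by (elim disjE) (simp_all add: *)
qed

text \<open>Seen from a face with two higher neighbours, a block is a cross if the opposite face is
  level with it, and otherwise a wrench whose diagonal separates the two neighbours. In both cases
  the number of edges at the low face is determined by the two outer edges.\<close>

lemma corner_ok_low:
  assumes "g (i + s, j) = g (i, j) + 1" "g (i, j + t) = g (i, j) + 1"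
  shows "corner_ok g W i j s t \<longleftrightarrow>
    ind W (i + s, j) (i + s, j + t) + ind W (i, j + t) (i + s, j + t) \<le> 1 \<and>
    ind W (i, j) (i + s, j) + ind W (i, j) (i, j + t) =
      (if g (i + s, j + t) = g (i, j)
       then 1 - (ind W (i + s, j) (i + s, j + t) + ind W (i, j + t) (i + s, j + t))
       else ind W (i + s, j) (i + s, j + t) + ind W (i, j + t) (i + s, j + t))"
  using assms unfolding corner_ok_def block_cond_def by auto (smt (verit) ind_nonneg)+

text \<open>The right-hand side is that of \<open>corner_ok_low\<close>; raising a face only
  exchanges which of the two cases applies.\<close>

lemma corner_ok_high:
  assumes "g (i + s, j) = g (i, j) - 1" "g (i, j + t) = g (i, j) - 1"
  shows "corner_ok g W i j s t \<longleftrightarrow>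
    ind W (i + s, j) (i + s, j + t) + ind W (i, j + t) (i + s, j + t) \<le> 1 \<and>
    ind W (i, j) (i + s, j) + ind W (i, j) (i, j + t) =
      (if g (i + s, j + t) = g (i, j)
       then 1 - (ind W (i + s, j) (i + s, j + t) + ind W (i, j + t) (i + s, j + t))
       else ind W (i + s, j) (i + s, j + t) + ind W (i, j + t) (i + s, j + t))"
  using assms unfolding corner_ok_def block_cond_def by auto (smt (verit) ind_nonneg)+

section \<open>Urban renewal\<close>

lemma sum_Pow_remove:
  fixes f :: "'a set \<Rightarrow> 'b::comm_monoid_add"
  assumes "finite S" "a \<in> S"
  shows "sum f (Pow S) = (\<Sum>T\<in>Pow (S - {a}). f T + f (insert a T))"
proof -
  define A where "A = S - {a}"
  have A: "S = insert a A" "a \<notin> A" "finite A"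
    using assms by (auto simp: A_def)
  have "inj_on (insert a) (Pow A)"
    using A(2) by (auto simp: inj_on_def)
  moreover have "Pow A \<inter> insert a ` Pow A = {}"
    using A(2) by auto
  ultimately have "sum f (Pow S) = (\<Sum>T\<in>Pow A. f T + f (insert a T))"
    using A by (simp add: Pow_insert sum.union_disjoint sum.reindex sum.distrib)
  then show ?thesis
    by (simp add: A_def)
qed

lemma sum_Pow_remove_bool:
  fixes f :: "'a set \<Rightarrow> 'b::comm_monoid_add"
  assumes "finite S" "a \<in> S"
  shows "sum f (Pow S) = (\<Sum>T\<in>Pow (S - {a}). \<Sum>b\<in>UNIV. f (if b then insert a T else T))"
  using sum_Pow_remove[OF assms, of f] by (simp add: UNIV_bool add.commute)

text \<open>The local identity of urban renewal. \<open>s1\<close>, \<open>s2\<close>,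
  \<open>s3\<close>, \<open>s4\<close> are the numbers of square edges required at the corners NE,
  NW, SW, SE before the move; afterwards they are complemented and opposite edges have exchanged
  labels. If all four are equal, one side has a single term and the other the two opposite pairs of
  edges, and the claim is the recurrence. If exactly two adjacent corners need an edge, each side
  has one term, with equal labels. In all other cases both sums are empty.\<close>

lemma renewal_identity:
  fixes a b c d :: "'a::field" and s1 s2 s3 s4 :: int
  assumes nz: "xC \<noteq> 0" "xC' \<noteq> 0" "xE \<noteq> 0" "xW \<noteq> 0" "xN \<noteq> 0" "xS \<noteq> 0"
    and rec: "xC' * xC = a * c * xN * xS + b * d * xE * xW"
    and s: "s1 = 0 \<or> s1 = 1" "s2 = 0 \<or> s2 = 1" "s3 = 0 \<or> s3 = 1" "s4 = 0 \<or> s4 = 1"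
  shows
    "(\<Sum>s\<in>UNIV. \<Sum>n\<in>UNIV. \<Sum>w\<in>UNIV. \<Sum>e\<in>UNIV.
        if of_bool e + of_bool n = s1 \<and> of_bool w + of_bool n = s2 \<and>
           of_bool w + of_bool s = s3 \<and> of_bool e + of_bool s = s4
        then (if e then a else 1) * (if w then c else 1) * (if n then b else 1) * (if s then d else 1) *
          (xC powi (1 - (of_bool e + of_bool w + of_bool n + of_bool s)) *
           xE powi (kE - of_bool e) * xW powi (kW - of_bool w) *
           xN powi (kN - of_bool n) * xS powi (kS - of_bool s)) else 0) =
     (\<Sum>s\<in>UNIV. \<Sum>n\<in>UNIV. \<Sum>w\<in>UNIV. \<Sum>e\<in>UNIV.
        if of_bool e + of_bool n = 1 - s1 \<and> of_bool w + of_bool n = 1 - s2 \<and>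
           of_bool w + of_bool s = 1 - s3 \<and> of_bool e + of_bool s = 1 - s4
        then (if e then c else 1) * (if w then a else 1) * (if n then d else 1) * (if s then b else 1) *
          (xC' powi (1 - (of_bool e + of_bool w + of_bool n + of_bool s)) *
           xE powi (kE + 1 - s1 - s4 - of_bool e) * xW powi (kW + 1 - s2 - s3 - of_bool w) *
           xN powi (kN + 1 - s1 - s2 - of_bool n) * xS powi (kS + 1 - s3 - s4 - of_bool s)) else 0)"
proof -
  \<comment> \<open>The exponents of \<open>xE\<close> that occur are \<open>kE - 1\<close>,
    \<open>kE\<close> and \<open>kE + 1\<close>; with the lowest power split off, only nonnegative
    powers of the neighbours remain.\<close>
  define yE where "yE = xE powi (kE - 1)"
  define yW where "yW = xW powi (kW - 1)"
  define yN where "yN = xN powi (kN - 1)"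
  define yS where "yS = xS powi (kS - 1)"
  have y: "xE powi kE = yE * xE" "xW powi kW = yW * xW" "xN powi kN = yN * xN" "xS powi kS = yS * xS"
    "xE powi (kE + 1) = yE * xE * xE" "xW powi (kW + 1) = yW * xW * xW"
    "xN powi (kN + 1) = yN * xN * xN" "xS powi (kS + 1) = yS * xS * xS"
    using nz by (simp_all add: yE_def yW_def yN_def yS_def power_int_diff power_int_add)
  \<comment> \<open>Every corner needs an edge before the move and none after it.\<close>
  have 1: "a * c * (inverse xC * yE * yW * (yN * xN) * (yS * xS)) +
      b * d * (inverse xC * (yE * xE) * (yW * xW) * yN * yS) = xC' * yE * yW * yN * yS"
  proof -
    have "a * c * (inverse xC * yE * yW * (yN * xN) * (yS * xS)) +
      b * d * (inverse xC * (yE * xE) * (yW * xW) * yN * yS) =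
      (a * c * xN * xS + b * d * xE * xW) * inverse xC * yE * yW * yN * yS"
      by (simp add: algebra_simps)
    also have "\<dots> = xC' * (xC * inverse xC) * yE * yW * yN * yS"
      unfolding rec[symmetric] by (simp add: mult.assoc)
    finally show ?thesis
      using nz by simp
  qed
  \<comment> \<open>No corner needs an edge before the move and every corner after it.\<close>
  have 2: "c * a * (inverse xC' * (yE * xE) * (yW * xW) * (yN * xN * xN) * (yS * xS * xS)) +
      d * b * (inverse xC' * (yE * xE * xE) * (yW * xW * xW) * (yN * xN) * (yS * xS)) =
      xC * (yE * xE) * (yW * xW) * (yN * xN) * (yS * xS)"
  proof -
    have "c * a * (inverse xC' * (yE * xE) * (yW * xW) * (yN * xN * xN) * (yS * xS * xS)) +
      d * b * (inverse xC' * (yE * xE * xE) * (yW * xW * xW) * (yN * xN) * (yS * xS)) =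
      (a * c * xN * xS + b * d * xE * xW) * inverse xC' * (yE * xE) * (yW * xW) * (yN * xN) * (yS * xS)"
      by (simp add: algebra_simps)
    also have "\<dots> = xC * (xC' * inverse xC') * (yE * xE) * (yW * xW) * (yN * xN) * (yS * xS)"
      unfolding rec[symmetric] by (simp add: mult_ac)
    finally show ?thesis
      using nz by simp
  qed
  show ?thesis
    using s 1 2 nz
    by (elim disjE) (simp_all add: UNIV_bool y yE_def[symmetric] yW_def[symmetric]
        yN_def[symmetric] yS_def[symmetric])
qed

section \<open>The four blocks around a local minimum\<close>

locale urban_renewal =
  fixes g :: "face \<Rightarrow> int" and i j :: int
  assumes step: "step_function g"
    and E: "g (i + 1, j) = g (i, j) + 1" and W: "g (i - 1, j) = g (i, j) + 1"
    and N: "g (i, j + 1) = g (i, j) + 1" and S: "g (i, j - 1) = g (i, j) + 1"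
begin

definition raised :: "face \<Rightarrow> int" where
  "raised = g((i, j) := g (i, j) + 2)"

lemma raised_center [simp]: "raised (i, j) = g (i, j) + 2"
  by (simp add: raised_def)

lemma raised_other [simp]: "F \<noteq> (i, j) \<Longrightarrow> raised F = g F"
  by (simp add: raised_def)

lemma neighbour_horizontal: "s \<in> {1, -1} \<Longrightarrow> g (i + s, j) = g (i, j) + 1"
  using E W by auto

lemma neighbour_vertical: "t \<in> {1, -1} \<Longrightarrow> g (i, j + t) = g (i, j) + 1"
  using N S by auto

lemma step_raised: "step_function raised"
  unfolding step_function_def
proof (intro allI impI)
  fix F F'
  assume adj: "lattice_adjacent F F'"
  have c: "\<bar>raised (i, j) - raised F'\<bar> = 1" if "lattice_adjacent (i, j) F'" for F'
    using that E W N S unfolding lattice_adjacent_iff by auto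
  show "\<bar>raised F - raised F'\<bar> = 1"
  proof (cases "F = (i, j) \<or> F' = (i, j)")
    case True
    have "lattice_adjacent F' F"
      using adj by (simp add: lattice_adjacent_def abs_minus_commute)
    then show ?thesis
      using True c adj by (metis abs_minus_commute)
  next
    case False
    moreover have "\<bar>g F - g F'\<bar> = 1"
      using adj step unfolding step_function_def by blast
    ultimately show ?thesis
      by simp
  qed
qed

definition outer :: "edge set \<Rightarrow> int \<Rightarrow> int \<Rightarrow> int" where
  "outer A s t = ind A (i + s, j) (i + s, j + t) + ind A (i, j + t) (i + s, j + t)"

text \<open>
  The number of edges of the square face \<open>(i, j)\<close> which must meet in its corner \<open>(s, t)\<close>;
  raising the height of the face replaces it by \<open>1 - needed\<close>.
\<close>

definition needed :: "edge set \<Rightarrow> int \<Rightarrow> int \<Rightarrow> int" where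
  "needed A s t = (if g (i + s, j + t) = g (i, j) then 1 - outer A s t else outer A s t)"

text \<open>The part of validity on which neither the four edges of the square nor the height of its
  centre has any influence; it is common to \<open>g\<close> and \<open>raised\<close>.\<close>

definition outer_ok :: "edge set \<Rightarrow> bool" where
  "outer_ok A \<longleftrightarrow>
     (\<forall>k l. (k, l) \<notin> {i - 1, i} \<times> {j - 1, j} \<longrightarrow> corner_ok g A k l 1 1) \<and>
     (\<forall>s\<in>{1, -1}. \<forall>t\<in>{1, -1}. outer A s t \<le> 1)"

lemma valid_config_iff:
  "valid_config g A \<longleftrightarrow> outer_ok A \<and> (\<forall>s\<in>{1, -1}. \<forall>t\<in>{1, -1}.
     ind A (i, j) (i + s, j) + ind A (i, j) (i, j + t) = needed A s t)"
proof -
  have "corner_ok g A i j s t \<longleftrightarrow> outer A s t \<le> 1 \<and>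
      ind A (i, j) (i + s, j) + ind A (i, j) (i, j + t) = needed A s t"
    if "s \<in> {1, -1}" "t \<in> {1, -1}" for s t
    unfolding needed_def outer_def
    by (rule corner_ok_low) (use that neighbour_horizontal neighbour_vertical in blast)+
  then show ?thesis
    unfolding valid_config_at[OF step, of A i j] outer_ok_def by auto
qed

text \<open>A corner face is one step away from a neighbour of height \<open>g (i, j) + 1\<close>.
  Before the move the lower value gives a cross and the higher one a wrench; after the move it is
  the other way round.\<close>

lemma corner_dichotomy:
  assumes "s \<in> {1, -1}" "t \<in> {1, -1}"
  shows "g (i + s, j + t) = g (i, j) \<or> g (i + s, j + t) = g (i, j) + 2"
  using step_function_vertical[OF step, of "i + s" j] step_function_vertical[OF step, of "i + s" "j - 1"]
    neighbour_horizontal[of s] assms by auto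

lemma valid_config_raised_iff:
  "valid_config raised A \<longleftrightarrow> outer_ok A \<and> (\<forall>s\<in>{1, -1}. \<forall>t\<in>{1, -1}.
     ind A (i, j) (i + s, j) + ind A (i, j) (i, j + t) = 1 - needed A s t)"
proof -
  have "corner_ok raised A i j s t \<longleftrightarrow> outer A s t \<le> 1 \<and>
      ind A (i, j) (i + s, j) + ind A (i, j) (i, j + t) = 1 - needed A s t"
    if st: "s \<in> {1, -1}" "t \<in> {1, -1}" for s t
  proof -
    have "raised (i + s, j) = raised (i, j) - 1" "raised (i, j + t) = raised (i, j) - 1"
      using st neighbour_horizontal[of s] neighbour_vertical[of t] by auto
    from corner_ok_high[of raised, OF this, of A] show ?thesis
      using corner_dichotomy[OF st] st unfolding needed_def outer_def by auto
  qed
  moreover have "corner_ok raised A k l 1 1 = corner_ok g A k l 1 1"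
    if "(k, l) \<notin> {i - 1, i} \<times> {j - 1, j}" for k l
    using that unfolding corner_ok_def by auto
  ultimately show ?thesis
    unfolding valid_config_at[OF step_raised, of A i j] outer_ok_def by auto
qed

definition agree :: "edge set \<Rightarrow> edge set \<Rightarrow> bool" where
  "agree A B \<longleftrightarrow> (\<forall>F F'. F \<noteq> (i, j) \<longrightarrow> F' \<noteq> (i, j) \<longrightarrow> ind A F F' = ind B F F')"

lemma agree_outer:
  assumes "agree A B" "s \<in> {1, -1}" "t \<in> {1, -1}"
  shows "outer A s t = outer B s t"
proof -
  have "ind A F F' = ind B F F'" if "F \<noteq> (i, j)" "F' \<noteq> (i, j)" for F F'
    using assms(1) that unfolding agree_def by blast
  then show ?thesis
    using assms(2,3) by (auto simp: outer_def)
qed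

lemma agree_needed:
  "agree A B \<Longrightarrow> s \<in> {1, -1} \<Longrightarrow> t \<in> {1, -1} \<Longrightarrow> needed A s t = needed B s t"
  using agree_outer by (simp add: needed_def)

lemma agree_outer_ok:
  assumes "agree A B"
  shows "outer_ok A \<longleftrightarrow> outer_ok B"
proof -
  have "corner_ok g A k l 1 1 = corner_ok g B k l 1 1"
    if "(k, l) \<notin> {i - 1, i} \<times> {j - 1, j}" for k l
  proof -
    have "ind A F F' = ind B F F'" if "F \<noteq> (i, j)" "F' \<noteq> (i, j)" for F F'
      using assms(1) that unfolding agree_def by blast
    then show ?thesis
      using that unfolding corner_ok_def by auto
  qed
  then show ?thesis
    unfolding outer_ok_def using agree_outer[OF assms] by auto
qed

lemma needed_cases:
  assumes "outer_ok A" "s \<in> {1, -1}" "t \<in> {1, -1}"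
  shows "needed A s t = 0 \<or> needed A s t = 1"
proof -
  have "outer A s t \<le> 1" "outer A s t \<ge> 0"
    using assms by (auto simp: outer_ok_def outer_def)
  then show ?thesis
    unfolding needed_def by auto
qed

text \<open>All four neighbours have the same height, so the boundary of the face contains no
  diagonals: it is a square before and after the move.\<close>

lemma double_exp_center:
  assumes "g' = g \<or> g' = raised"
  shows "double_exp g' A (i, j) = 2 - 2 * (ind A (i, j) (i + 1, j) + ind A (i, j) (i - 1, j) +
    ind A (i, j) (i, j + 1) + ind A (i, j) (i, j - 1))"
proof -
  have "corner_exp g' A i j s t = 0" if "s \<in> {1, -1}" "t \<in> {1, -1}" for s t
    using assms neighbour_horizontal[of s] neighbour_vertical[of t] that
    by (auto simp: corner_exp_def)
  then show ?thesis
    by (simp add: double_exp_def)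
qed

lemma double_exp_far:
  assumes "agree A B" "F \<noteq> (i, j)" "\<not> lattice_adjacent (i, j) F"
  shows "double_exp raised A F = double_exp g A F" "double_exp g A F = double_exp g B F"
proof -
  obtain k l where F: "F = (k, l)"
    by fastforce
  have ind: "ind A F F' = ind B F F'" if "F \<noteq> (i, j)" "F' \<noteq> (i, j)" for F F'
    using assms(1) that unfolding agree_def by blast
  have kl: "(k, l) \<noteq> (i, j)" "(k + 1, l) \<noteq> (i, j)" "(k - 1, l) \<noteq> (i, j)"
    "(k, l + 1) \<noteq> (i, j)" "(k, l - 1) \<noteq> (i, j)"
    using assms(2,3) unfolding F lattice_adjacent_iff by auto
  have "corner_exp raised A k l s t = corner_exp g A k l s t \<and>
    corner_exp g A k l s t = corner_exp g B k l s t" if "s \<in> {1, -1}" "t \<in> {1, -1}" for s t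
  proof (cases "(k + s, l + t) = (i, j)")
    case True
    \<comment> \<open>\<open>F\<close> lies diagonally opposite to \<open>(i, j)\<close>. In the
      shared block its two neighbours are neighbours of the minimum and equally high, so this corner
      contributes nothing before or after the move.\<close>
    then have "(k + s, l) = (i, j - t)" "(k, l + t) = (i - s, j)"
      by auto
    then have "g (k + s, l) = g (k, l + t)"
      using that E W N S by auto
    moreover have "(k + s, l) \<noteq> (i, j)" "(k, l + t) \<noteq> (i, j)"
      using that kl by auto
    ultimately show ?thesis
      by (simp add: corner_exp_def)
  next
    case False
    moreover have "(k + s, l) \<noteq> (i, j)" "(k, l + t) \<noteq> (i, j)"
      using that kl by auto
    ultimately show ?thesis
      unfolding corner_exp_def using ind kl(1) by (simp del: prod.inject)
  qed
  then show "double_exp raised A F = double_exp g A F" "double_exp g A F = double_exp g B F"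
    unfolding double_exp_def F prod.case using ind kl by (simp_all del: prod.inject)
qed

text \<open>This is \<open>corner_exp\<close>, taken at a neighbour of the square, for the block
  \<open>(s, t)\<close>: if the block is a wrench, a valid configuration has twice
  \<open>needed\<close> weighted edges in it, so the diagonal is matched iff \<open>needed\<close>
  is 0.\<close>

definition turn :: "edge set \<Rightarrow> int \<Rightarrow> int \<Rightarrow> int" where
  "turn A s t = (if g (i + s, j + t) = g (i, j) then 0 else 2 * needed A s t - 1)"

text \<open>Doubled exponent of a horizontal neighbour before the move, without the edge shared with
  the square. Written through \<open>turn\<close>, it depends only on edges outside the
  square.\<close>

definition horizontal_rest :: "edge set \<Rightarrow> int \<Rightarrow> int" where
  "horizontal_rest A s =
     2 - 2 * (ind A (i + s, j) (i + s + s, j) + ind A (i + s, j) (i + s, j + 1) +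
              ind A (i + s, j) (i + s, j - 1)) +
     corner_exp g A (i + s) j s 1 + corner_exp g A (i + s) j s (- 1) + turn A s 1 + turn A s (- 1)"

definition vertical_rest :: "edge set \<Rightarrow> int \<Rightarrow> int" where
  "vertical_rest A t =
     2 - 2 * (ind A (i, j + t) (i, j + t + t) + ind A (i, j + t) (i + 1, j + t) +
              ind A (i, j + t) (i - 1, j + t)) +
     corner_exp g A i (j + t) 1 t + corner_exp g A i (j + t) (- 1) t + turn A 1 t + turn A (- 1) t"

lemma agree_rest:
  assumes "agree A B" "s \<in> {1, -1}"
  shows "horizontal_rest A s = horizontal_rest B s" "vertical_rest A s = vertical_rest B s"
proof -
  have ind: "ind A F F' = ind B F F'" if "F \<noteq> (i, j)" "F' \<noteq> (i, j)" for F F'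
    using assms(1) that unfolding agree_def by blast
  have t: "turn A s t = turn B s t" "turn A t s = turn B t s" if "t \<in> {1, -1}" for t
    using assms that by (auto simp: turn_def agree_needed[of A B])
  have c: "corner_exp g A k l a b = corner_exp g B k l a b"
    if "(k, l) \<noteq> (i, j)" "(k + a, l) \<noteq> (i, j)" "(k, l + b) \<noteq> (i, j)" "(k + a, l + b) \<noteq> (i, j)"
    for k l a b
    unfolding corner_exp_def ind[OF that(1,2)] ind[OF that(1,3)] ind[OF that(2,4)] ind[OF that(3,4)] ..
  have s: "s \<noteq> 0" "s + s \<noteq> 0"
    using assms(2) by auto
  have "corner_exp g A (i + s) j s t = corner_exp g B (i + s) j s t"
    "corner_exp g A i (j + s) t s = corner_exp g B i (j + s) t s" for t
    by (rule c; use s in \<open>simp add: add.assoc\<close>)+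
  moreover have
    "ind A (i + s, j) (i + s + s, j) = ind B (i + s, j) (i + s + s, j)"
    "ind A (i + s, j) (i + s, j + t) = ind B (i + s, j) (i + s, j + t)"
    "ind A (i + s, j) (i + s, j - t) = ind B (i + s, j) (i + s, j - t)"
    "ind A (i, j + s) (i, j + s + s) = ind B (i, j + s) (i, j + s + s)"
    "ind A (i, j + s) (i + t, j + s) = ind B (i, j + s) (i + t, j + s)"
    "ind A (i, j + s) (i - t, j + s) = ind B (i, j + s) (i - t, j + s)" for t
    by (rule ind; use s in \<open>simp add: add.assoc\<close>)+
  ultimately show "horizontal_rest A s = horizontal_rest B s" "vertical_rest A s = vertical_rest B s"
    unfolding horizontal_rest_def vertical_rest_def by (simp_all add: t)
qed

text \<open>The move turns a cross into a wrench with \<open>2 * (1 - needed)\<close> weighted edges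
  and a wrench into a cross. In both shapes the contribution therefore changes by
  \<open>1 - 2 * needed\<close>.\<close>

lemma corner_exp_inner:
  assumes "s \<in> {1, -1}" "t \<in> {1, -1}"
  shows
    "valid_config g A \<Longrightarrow> corner_exp g A (i + s) j (- s) t = turn A s t"
    "valid_config g A \<Longrightarrow> corner_exp g A i (j + t) s (- t) = turn A s t"
    "valid_config raised A \<Longrightarrow> corner_exp raised A (i + s) j (- s) t = turn A s t + 1 - 2 * needed A s t"
    "valid_config raised A \<Longrightarrow> corner_exp raised A i (j + t) s (- t) = turn A s t + 1 - 2 * needed A s t"
proof -
  note c = ind_commute[of A "(i + s, j)" "(i, j)"] ind_commute[of A "(i, j + t)" "(i, j)"]
    ind_commute[of A "(i + s, j + t)" "(i + s, j)"] ind_commute[of A "(i + s, j + t)" "(i, j + t)"]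
  have o: "outer A s t = ind A (i + s, j) (i + s, j + t) + ind A (i, j + t) (i + s, j + t)"
    by (simp add: outer_def)
  have D: "g (i + s, j + t) = g (i, j) \<or> g (i + s, j + t) = g (i, j) + 2"
    using corner_dichotomy assms by blast
  have ne: "(i + s, j + t) \<noteq> (i, j)" "(i + s, j) \<noteq> (i, j)" "(i, j + t) \<noteq> (i, j)"
    using assms by auto
  {
    assume v: "valid_config g A"
    have nd: "needed A s t = 0 \<or> needed A s t = 1"
      using needed_cases v assms valid_config_iff by blast
    have inn: "ind A (i, j) (i + s, j) + ind A (i, j) (i, j + t) = needed A s t"
      using v assms valid_config_iff by blast
    show "corner_exp g A (i + s) j (- s) t = turn A s t" "corner_exp g A i (j + t) s (- t) = turn A s t"
      using D nd inn o c unfolding corner_exp_def turn_def needed_def by auto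
  }
  {
    assume v: "valid_config raised A"
    have nd: "needed A s t = 0 \<or> needed A s t = 1"
      using needed_cases v assms valid_config_raised_iff by blast
    have inn: "ind A (i, j) (i + s, j) + ind A (i, j) (i, j + t) = 1 - needed A s t"
      using v assms valid_config_raised_iff by blast
    show "corner_exp raised A (i + s) j (- s) t = turn A s t + 1 - 2 * needed A s t"
      "corner_exp raised A i (j + t) s (- t) = turn A s t + 1 - 2 * needed A s t"
      using D nd inn o c ne unfolding corner_exp_def turn_def needed_def by auto
  }
qed

end

text \<open>\<open>val\<close> will be the recurrence, evaluated at the current height of each face.
  \<open>R\<close> keeps the product over faces finite.\<close>

definition config_weight ::
  "(face \<Rightarrow> int \<Rightarrow> ratfun) \<Rightarrow> (face \<Rightarrow> int) \<Rightarrow> face set \<Rightarrow> edge set \<Rightarrow> ratfun" where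
  "config_weight val g R A =
     (\<Prod>e\<in>A. edge_label g e) * (\<Prod>F\<in>R. val F (g F) powi config_exp g A F)"

context urban_renewal
begin

lemma corner_exp_raised_eq:
  assumes "(k, l) \<noteq> (i, j)" "(k + s, l) \<noteq> (i, j)" "(k, l + t) \<noteq> (i, j)"
  shows "corner_exp raised A k l s t = corner_exp g A k l s t"
  unfolding corner_exp_def using assms by (simp del: prod.inject)

text \<open>Half the difference of the two formulas is
  \<open>1 - needed A s 1 - needed A s (- 1)\<close>, which is the shift of this neighbour's
  exponent in \<open>renewal_identity\<close>.\<close>

lemma double_exp_horizontal:
  assumes s: "s \<in> {1, -1}"
  shows "valid_config g A \<Longrightarrow>
      double_exp g A (i + s, j) = horizontal_rest A s - 2 * ind A (i, j) (i + s, j)"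
    and "valid_config raised A \<Longrightarrow>
      double_exp raised A (i + s, j) = horizontal_rest A s + 2 - 2 * needed A s 1 - 2 * needed A s (- 1)
        - 2 * ind A (i, j) (i + s, j)"
proof -
  have d: "double_exp g' A (i + s, j) = 2 - 2 * (ind A (i + s, j) (i + s + s, j) +
      ind A (i + s, j) (i + s, j + 1) + ind A (i + s, j) (i + s, j - 1)) +
      corner_exp g' A (i + s) j s 1 + corner_exp g' A (i + s) j s (- 1) +
      corner_exp g' A (i + s) j (- s) 1 + corner_exp g' A (i + s) j (- s) (- 1)
      - 2 * ind A (i, j) (i + s, j)" for g'
    using s by (auto simp: double_exp_def ind_commute[of A "(i, j)"])
  have r: "corner_exp raised A (i + s) j s t = corner_exp g A (i + s) j s t" for t
    by (rule corner_exp_raised_eq) (use s in auto)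
  show "double_exp g A (i + s, j) = horizontal_rest A s - 2 * ind A (i, j) (i + s, j)"
    if "valid_config g A"
    unfolding d horizontal_rest_def using corner_exp_inner(1)[OF s _ that] by simp
  show "double_exp raised A (i + s, j) = horizontal_rest A s + 2 - 2 * needed A s 1
      - 2 * needed A s (- 1) - 2 * ind A (i, j) (i + s, j)"
    if "valid_config raised A"
    unfolding d horizontal_rest_def r using corner_exp_inner(3)[OF s _ that] by simp
qed

lemma double_exp_vertical:
  assumes t: "t \<in> {1, -1}"
  shows "valid_config g A \<Longrightarrow>
      double_exp g A (i, j + t) = vertical_rest A t - 2 * ind A (i, j) (i, j + t)"
    and "valid_config raised A \<Longrightarrow>
      double_exp raised A (i, j + t) = vertical_rest A t + 2 - 2 * needed A 1 t - 2 * needed A (- 1) t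
        - 2 * ind A (i, j) (i, j + t)"
proof -
  have d: "double_exp g' A (i, j + t) = 2 - 2 * (ind A (i, j + t) (i, j + t + t) +
      ind A (i, j + t) (i + 1, j + t) + ind A (i, j + t) (i - 1, j + t)) +
      corner_exp g' A i (j + t) 1 t + corner_exp g' A i (j + t) (- 1) t +
      corner_exp g' A i (j + t) 1 (- t) + corner_exp g' A i (j + t) (- 1) (- t)
      - 2 * ind A (i, j) (i, j + t)" for g'
    using t by (auto simp: double_exp_def ind_commute[of A "(i, j)"])
  have r: "corner_exp raised A i (j + t) s t = corner_exp g A i (j + t) s t" for s
    by (rule corner_exp_raised_eq) (use t in auto)
  show "double_exp g A (i, j + t) = vertical_rest A t - 2 * ind A (i, j) (i, j + t)"
    if "valid_config g A"
    unfolding d vertical_rest_def using corner_exp_inner(2)[OF _ t that] by simp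
  show "double_exp raised A (i, j + t) = vertical_rest A t + 2 - 2 * needed A 1 t
      - 2 * needed A (- 1) t - 2 * ind A (i, j) (i, j + t)"
    if "valid_config raised A"
    unfolding d vertical_rest_def r using corner_exp_inner(4)[OF _ t that] by simp
qed

section \<open>Summation over the four edges of the square\<close>

abbreviation "east_edge \<equiv> {(i, j), (i + 1, j)}"
abbreviation "west_edge \<equiv> {(i, j), (i - 1, j)}"
abbreviation "north_edge \<equiv> {(i, j), (i, j + 1)}"
abbreviation "south_edge \<equiv> {(i, j), (i, j - 1)}"

definition fill :: "bool \<Rightarrow> bool \<Rightarrow> bool \<Rightarrow> bool \<Rightarrow> edge set \<Rightarrow> edge set" where
  "fill e w n s A = (let A = if s then insert south_edge A else A;
     A = if n then insert north_edge A else A;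
     A = if w then insert west_edge A else A
     in if e then insert east_edge A else A)"

lemma distinct_star:
  "east_edge \<noteq> west_edge" "east_edge \<noteq> north_edge" "east_edge \<noteq> south_edge"
  "west_edge \<noteq> north_edge" "west_edge \<noteq> south_edge" "north_edge \<noteq> south_edge"
  by (auto simp: doubleton_eq_iff)

lemma sum_Pow_star:
  fixes f :: "edge set \<Rightarrow> 'b::comm_monoid_add"
  assumes "finite S" "{east_edge, west_edge, north_edge, south_edge} \<subseteq> S"
  shows "sum f (Pow S) = (\<Sum>A\<in>Pow (S - {east_edge, west_edge, north_edge, south_edge}).
    \<Sum>s\<in>UNIV. \<Sum>n\<in>UNIV. \<Sum>w\<in>UNIV. \<Sum>e\<in>UNIV. f (fill e w n s A))"
proof -
  have "sum f (Pow S) = (\<Sum>A\<in>Pow (S - {east_edge} - {west_edge} - {north_edge} - {south_edge}).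
    \<Sum>s\<in>UNIV. \<Sum>n\<in>UNIV. \<Sum>w\<in>UNIV. \<Sum>e\<in>UNIV. f (fill e w n s A))"
    unfolding fill_def Let_def
    apply (subst sum_Pow_remove_bool[of S east_edge])
      apply (use assms distinct_star in auto)[2]
    apply (subst sum_Pow_remove_bool[of "S - {east_edge}" west_edge])
      apply (use assms distinct_star in auto)[2]
    apply (subst sum_Pow_remove_bool[of "S - {east_edge} - {west_edge}" north_edge])
      apply (use assms distinct_star in auto)[2]
    apply (subst sum_Pow_remove_bool[of "S - {east_edge} - {west_edge} - {north_edge}" south_edge])
      apply (use assms distinct_star in auto)[2]
    apply (rule refl)
    done
  moreover have "S - {east_edge, west_edge, north_edge, south_edge} =
    S - {east_edge} - {west_edge} - {north_edge} - {south_edge}"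
    by auto
  ultimately show ?thesis
    by simp
qed

text \<open>Raising the face reverses the slope across its four edges, and the index shifts in the
  labels are such that opposite edges exchange their labels.\<close>

lemma edge_labels_star:
  "edge_label g east_edge = avar (i + g (i, j) + 1) j"
  "edge_label g west_edge = cvar (i - g (i, j) - 1) j"
  "edge_label g north_edge = bvar i (j + g (i, j) + 1)"
  "edge_label g south_edge = dvar i (j - g (i, j) - 1)"
  "edge_label raised east_edge = cvar (i - g (i, j) - 1) j"
  "edge_label raised west_edge = avar (i + g (i, j) + 1) j"
  "edge_label raised north_edge = dvar i (j - g (i, j) - 1)"
  "edge_label raised south_edge = bvar i (j + g (i, j) + 1)"
  using edge_label_horizontal[of g i j] edge_label_horizontal[of g "i - 1" j]
    edge_label_vertical[of g i j] edge_label_vertical[of g i "j - 1"]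
    edge_label_horizontal[of raised i j] edge_label_horizontal[of raised "i - 1" j]
    edge_label_vertical[of raised i j] edge_label_vertical[of raised i "j - 1"] E W N S
  by (simp_all add: insert_commute algebra_simps)

lemma fill_ind:
  assumes "A \<inter> {east_edge, west_edge, north_edge, south_edge} = {}"
  shows "ind (fill e w n s A) (i, j) (i + 1, j) = of_bool e"
    "ind (fill e w n s A) (i, j) (i - 1, j) = of_bool w"
    "ind (fill e w n s A) (i, j) (i, j + 1) = of_bool n"
    "ind (fill e w n s A) (i, j) (i, j - 1) = of_bool s"
  using assms distinct_star unfolding ind_def fill_def Let_def by auto

lemma fill_agree: "agree (fill e w n s A) A"
proof -
  have "{F, F'} \<in> fill e w n s A \<longleftrightarrow> {F, F'} \<in> A" if "F \<noteq> (i, j)" "F' \<noteq> (i, j)" for F F'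
  proof -
    have "{F, F'} \<notin> {east_edge, west_edge, north_edge, south_edge}"
      using that by (metis doubleton_eq_iff insertE empty_iff)
    then show ?thesis
      unfolding fill_def Let_def by auto
  qed
  then show ?thesis
    by (simp add: agree_def ind_def)
qed

lemma prod_fill:
  fixes f :: "edge \<Rightarrow> 'b::comm_monoid_mult"
  assumes "finite A" "A \<inter> {east_edge, west_edge, north_edge, south_edge} = {}"
  shows "prod f (fill e w n s A) = (if e then f east_edge else 1) * (if w then f west_edge else 1) *
    (if n then f north_edge else 1) * (if s then f south_edge else 1) * prod f A"
  using assms distinct_star unfolding fill_def Let_def by (simp add: mult_ac)

definition far_product :: "(face \<Rightarrow> int \<Rightarrow> ratfun) \<Rightarrow> face set \<Rightarrow> edge set \<Rightarrow> ratfun" where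
  "far_product val R A = (\<Prod>e\<in>A. edge_label g e) *
     (\<Prod>F\<in>R - {(i, j), (i + 1, j), (i - 1, j), (i, j + 1), (i, j - 1)}.
        val F (g F) powi config_exp g A F)"

lemma config_weight_fill:
  fixes val :: "face \<Rightarrow> int \<Rightarrow> ratfun"
  assumes A: "finite A" "A \<subseteq> weighted_edges" "A \<inter> {east_edge, west_edge, north_edge, south_edge} = {}"
    and R: "finite R" "{(i, j), (i + 1, j), (i - 1, j), (i, j + 1), (i, j - 1)} \<subseteq> R"
    and g': "g' = g \<or> g' = raised"
  shows "config_weight val g' R (fill e w n s A) =
    far_product val R A *
    ((if e then edge_label g' east_edge else 1) * (if w then edge_label g' west_edge else 1) *
     (if n then edge_label g' north_edge else 1) * (if s then edge_label g' south_edge else 1) *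
     (val (i, j) (g' (i, j)) powi config_exp g' (fill e w n s A) (i, j) *
      val (i + 1, j) (g (i, j) + 1) powi config_exp g' (fill e w n s A) (i + 1, j) *
      val (i - 1, j) (g (i, j) + 1) powi config_exp g' (fill e w n s A) (i - 1, j) *
      val (i, j + 1) (g (i, j) + 1) powi config_exp g' (fill e w n s A) (i, j + 1) *
      val (i, j - 1) (g (i, j) + 1) powi config_exp g' (fill e w n s A) (i, j - 1)))"
proof -
  define B where "B = fill e w n s A"
  define K where "K = {(i, j), (i + 1, j), (i - 1, j), (i, j + 1), (i, j - 1)}"
  have "(\<Prod>F\<in>R. val F (g' F) powi config_exp g' B F) =
    (\<Prod>F\<in>R - K. val F (g' F) powi config_exp g' B F) * (\<Prod>F\<in>K. val F (g' F) powi config_exp g' B F)"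
    using R by (intro prod.subset_diff) (auto simp: K_def)
  moreover have "(\<Prod>F\<in>R - K. val F (g' F) powi config_exp g' B F) =
    (\<Prod>F\<in>R - K. val F (g F) powi config_exp g A F)"
  proof (rule prod.cong)
    fix F
    assume F: "F \<in> R - K"
    then have "F \<noteq> (i, j)" "\<not> lattice_adjacent (i, j) F"
      unfolding lattice_adjacent_iff by (auto simp: K_def)
    from double_exp_far[OF fill_agree this, of e w n s A] \<open>F \<noteq> (i, j)\<close>
    show "val F (g' F) powi config_exp g' B F = val F (g F) powi config_exp g A F"
      using g' unfolding config_exp_def B_def by auto
  qed simp
  moreover have "(\<Prod>F\<in>K. val F (g' F) powi config_exp g' B F) =
     val (i, j) (g' (i, j)) powi config_exp g' B (i, j) *
      val (i + 1, j) (g (i, j) + 1) powi config_exp g' B (i + 1, j) *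
      val (i - 1, j) (g (i, j) + 1) powi config_exp g' B (i - 1, j) *
      val (i, j + 1) (g (i, j) + 1) powi config_exp g' B (i, j + 1) *
      val (i, j - 1) (g (i, j) + 1) powi config_exp g' B (i, j - 1)"
  proof -
    have "g' (i + 1, j) = g (i, j) + 1" "g' (i - 1, j) = g (i, j) + 1"
      "g' (i, j + 1) = g (i, j) + 1" "g' (i, j - 1) = g (i, j) + 1"
      using g' E W N S by auto
    then show ?thesis
      by (simp add: K_def mult_ac)
  qed
  moreover have "(\<Prod>e\<in>A. edge_label g' e) = (\<Prod>e\<in>A. edge_label g e)"
  proof (rule prod.cong)
    fix e
    assume e: "e \<in> A"
    \<comment> \<open>Every weighted edge at \<open>(i, j)\<close> is one of the four edges of the
      square, so the labels of the edges in \<open>A\<close> do not see the raised height.\<close>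
    have "(i, j) \<notin> e"
    proof
      assume "(i, j) \<in> e"
      moreover obtain F F' where F: "e = {F, F'}" "lattice_adjacent F F'"
        using A(2) e by (auto simp: weighted_edges_def)
      moreover have "lattice_adjacent F' F"
        using F(2) by (simp add: lattice_adjacent_def abs_minus_commute)
      ultimately have "\<exists>F. e = {(i, j), F} \<and> lattice_adjacent (i, j) F"
        by (metis insertE insert_commute singletonD)
      then have "e \<in> {east_edge, west_edge, north_edge, south_edge}"
        unfolding lattice_adjacent_iff by auto
      then show False
        using A(3) e by blast
    qed
    then show "edge_label g' e = edge_label g e"
      using g' A(2) e by (intro edge_label_cong) (auto simp: raised_def)
  qed simp
  ultimately show ?thesis
    unfolding config_weight_def far_product_def B_def[symmetric] K_def[symmetric]
    by (simp add: B_def prod_fill[OF A(1,3)] mult_ac)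
qed

text \<open>For each fixed part \<open>A\<close> outside the square there are sixteen fillings. If
  \<open>A\<close> passes \<open>outer_ok\<close>, their total weight is a common factor times one
  side of \<open>renewal_identity\<close>; otherwise it is 0 on both sides. The edge set
  \<open>S\<close> stays the same; edges that leave the graph are a separate matter.\<close>

lemma sum_config_weight_raised:
  fixes val :: "face \<Rightarrow> int \<Rightarrow> ratfun"
  assumes S: "finite S" "S \<subseteq> weighted_edges" "{east_edge, west_edge, north_edge, south_edge} \<subseteq> S"
    and R: "finite R" "{(i, j), (i + 1, j), (i - 1, j), (i, j + 1), (i, j - 1)} \<subseteq> R"
    and nz: "\<And>F m. val F m \<noteq> 0"
    and rec: "val (i, j) (g (i, j) + 2) * val (i, j) (g (i, j)) =
      avar (i + g (i, j) + 1) j * cvar (i - g (i, j) - 1) j *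
        val (i, j + 1) (g (i, j) + 1) * val (i, j - 1) (g (i, j) + 1) +
      bvar i (j + g (i, j) + 1) * dvar i (j - g (i, j) - 1) *
        val (i + 1, j) (g (i, j) + 1) * val (i - 1, j) (g (i, j) + 1)"
  shows "(\<Sum>A\<in>Pow S. if valid_config g A then config_weight val g R A else 0) =
    (\<Sum>A\<in>Pow S. if valid_config raised A then config_weight val raised R A else 0)"
proof -
  have "(\<Sum>s\<in>UNIV. \<Sum>n\<in>UNIV. \<Sum>w\<in>UNIV. \<Sum>e\<in>UNIV.
      if valid_config g (fill e w n s A) then config_weight val g R (fill e w n s A) else 0) =
    (\<Sum>s\<in>UNIV. \<Sum>n\<in>UNIV. \<Sum>w\<in>UNIV. \<Sum>e\<in>UNIV.
      if valid_config raised (fill e w n s A) then config_weight val raised R (fill e w n s A) else 0)"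
    if A: "A \<in> Pow (S - {east_edge, west_edge, north_edge, south_edge})" for A
  proof (cases "outer_ok A")
    case False
    then show ?thesis
      using agree_outer_ok[OF fill_agree] by (simp add: valid_config_iff valid_config_raised_iff)
  next
    case True
    have A': "finite A" "A \<subseteq> weighted_edges" "A \<inter> {east_edge, west_edge, north_edge, south_edge} = {}"
      using A S by (auto intro: finite_subset)
    define s1 s2 s3 s4 where "s1 = needed A 1 1" and "s2 = needed A (- 1) 1"
      and "s3 = needed A (- 1) (- 1)" and "s4 = needed A 1 (- 1)"
    define kE kW kN kS where "kE = horizontal_rest A 1 div 2" and "kW = horizontal_rest A (- 1) div 2"
      and "kN = vertical_rest A 1 div 2" and "kS = vertical_rest A (- 1) div 2"
    define P where "P = far_product val R A"
    have s01: "s1 = 0 \<or> s1 = 1" "s2 = 0 \<or> s2 = 1" "s3 = 0 \<or> s3 = 1" "s4 = 0 \<or> s4 = 1"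
      unfolding s1_def s2_def s3_def s4_def using needed_cases[OF True] by simp_all
    have needed: "needed (fill e w n s A) a b = needed A a b"
      if "a \<in> {1, -1}" "b \<in> {1, -1}" for e w n s a b
      by (rule agree_needed[OF fill_agree that])
    have rest: "horizontal_rest (fill e w n s A) a = horizontal_rest A a"
      "vertical_rest (fill e w n s A) a = vertical_rest A a" if "a \<in> {1, -1}" for e w n s a
      by (rule agree_rest[OF fill_agree that])+
    note ind = fill_ind[OF A'(3)]
    have outer: "outer_ok (fill e w n s A)" for e w n s
      using agree_outer_ok[OF fill_agree] True by blast
    have corners: "(\<forall>a\<in>{1, -1}. \<forall>b\<in>{1, -1}. Q a b) \<longleftrightarrow>
        Q 1 1 \<and> Q (- 1) 1 \<and> Q (- 1) (- 1) \<and> Q 1 (- 1)" for Q :: "int \<Rightarrow> int \<Rightarrow> bool"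
      by auto
    have needed': "needed (fill e w n s A) 1 1 = needed A 1 1"
      "needed (fill e w n s A) (- 1) 1 = needed A (- 1) 1"
      "needed (fill e w n s A) (- 1) (- 1) = needed A (- 1) (- 1)"
      "needed (fill e w n s A) 1 (- 1) = needed A 1 (- 1)" for e w n s
      by (simp_all add: needed)
    have v: "valid_config g (fill e w n s A) \<longleftrightarrow> of_bool e + of_bool n = s1 \<and> of_bool w + of_bool n = s2 \<and>
           of_bool w + of_bool s = s3 \<and> of_bool e + of_bool s = s4"
      and v': "valid_config raised (fill e w n s A) \<longleftrightarrow> of_bool e + of_bool n = 1 - s1 \<and>
           of_bool w + of_bool n = 1 - s2 \<and> of_bool w + of_bool s = 1 - s3 \<and> of_bool e + of_bool s = 1 - s4"
      for e w n s
      unfolding valid_config_iff valid_config_raised_iff s1_def s2_def s3_def s4_def corners needed'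
      by (simp_all only: outer ind add_uminus_conv_diff simp_thms)
    have half: "(r - 2 * x) div 2 = r div 2 - x" "(r + 2 - 2 * y - 2 * z - 2 * x) div 2 = r div 2 + 1 - y - z - x"
      for r x y z :: int
    proof -
      have "r - 2 * x = r + (- x) * 2" "r + 2 - 2 * y - 2 * z - 2 * x = r + (1 - y - z - x) * 2"
        by simp_all
      then show "(r - 2 * x) div 2 = r div 2 - x"
        "(r + 2 - 2 * y - 2 * z - 2 * x) div 2 = r div 2 + 1 - y - z - x"
        by simp_all
    qed
    \<comment> \<open>Closed forms of the two weights. They are established for valid fillings only,
      because the exponents of the neighbours were computed under validity; the guards in the sums
      make this enough.\<close>
    define f f' where
      "f e w n s = P *
        ((if e then edge_label g east_edge else 1) * (if w then edge_label g west_edge else 1) *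
         (if n then edge_label g north_edge else 1) * (if s then edge_label g south_edge else 1) *
         (val (i, j) (g (i, j)) powi (1 - (of_bool e + of_bool w + of_bool n + of_bool s)) *
          val (i + 1, j) (g (i, j) + 1) powi (kE - of_bool e) *
          val (i - 1, j) (g (i, j) + 1) powi (kW - of_bool w) *
          val (i, j + 1) (g (i, j) + 1) powi (kN - of_bool n) *
          val (i, j - 1) (g (i, j) + 1) powi (kS - of_bool s)))"
      and "f' e w n s = P *
        ((if e then edge_label raised east_edge else 1) * (if w then edge_label raised west_edge else 1) *
         (if n then edge_label raised north_edge else 1) * (if s then edge_label raised south_edge else 1) *
         (val (i, j) (g (i, j) + 2) powi (1 - (of_bool e + of_bool w + of_bool n + of_bool s)) *
          val (i + 1, j) (g (i, j) + 1) powi (kE + 1 - s1 - s4 - of_bool e) *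
          val (i - 1, j) (g (i, j) + 1) powi (kW + 1 - s2 - s3 - of_bool w) *
          val (i, j + 1) (g (i, j) + 1) powi (kN + 1 - s1 - s2 - of_bool n) *
          val (i, j - 1) (g (i, j) + 1) powi (kS + 1 - s3 - s4 - of_bool s)))" for e w n s
    have wt: "config_weight val g R (fill e w n s A) = f e w n s"
      if "valid_config g (fill e w n s A)" for e w n s
    proof -
      have "config_exp g (fill e w n s A) (i, j) = 1 - (of_bool e + of_bool w + of_bool n + of_bool s)"
        unfolding config_exp_def double_exp_center[OF disjI1[OF refl]] ind half by simp
      moreover have "config_exp g (fill e w n s A) (i + 1, j) = kE - of_bool e"
        "config_exp g (fill e w n s A) (i - 1, j) = kW - of_bool w"
        "config_exp g (fill e w n s A) (i, j + 1) = kN - of_bool n"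
        "config_exp g (fill e w n s A) (i, j - 1) = kS - of_bool s"
        using double_exp_horizontal(1)[OF _ that, of 1] double_exp_horizontal(1)[OF _ that, of "-1"]
          double_exp_vertical(1)[OF _ that, of 1] double_exp_vertical(1)[OF _ that, of "-1"]
        unfolding config_exp_def kE_def kW_def kN_def kS_def by (simp_all add: ind rest half)
      ultimately show ?thesis
        unfolding config_weight_fill[OF A' R disjI1[OF refl]] P_def f_def by simp
    qed
    have wt': "config_weight val raised R (fill e w n s A) = f' e w n s"
      if "valid_config raised (fill e w n s A)" for e w n s
    proof -
      have "config_exp raised (fill e w n s A) (i, j) = 1 - (of_bool e + of_bool w + of_bool n + of_bool s)"
        unfolding config_exp_def double_exp_center[OF disjI2[OF refl]] ind half by simp
      moreover have "config_exp raised (fill e w n s A) (i + 1, j) = kE + 1 - s1 - s4 - of_bool e"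
        "config_exp raised (fill e w n s A) (i - 1, j) = kW + 1 - s2 - s3 - of_bool w"
        "config_exp raised (fill e w n s A) (i, j + 1) = kN + 1 - s1 - s2 - of_bool n"
        "config_exp raised (fill e w n s A) (i, j - 1) = kS + 1 - s3 - s4 - of_bool s"
        using double_exp_horizontal(2)[OF _ that, of 1] double_exp_horizontal(2)[OF _ that, of "-1"]
          double_exp_vertical(2)[OF _ that, of 1] double_exp_vertical(2)[OF _ that, of "-1"]
        unfolding config_exp_def kE_def kW_def kN_def kS_def s1_def s2_def s3_def s4_def
        by (simp_all add: ind rest needed half)
      ultimately show ?thesis
        unfolding config_weight_fill[OF A' R disjI2[OF refl]] P_def f'_def by simp
    qed
    have "(if valid_config g (fill e w n s A) then config_weight val g R (fill e w n s A) else 0) =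
      (if valid_config g (fill e w n s A) then f e w n s else 0)"
      "(if valid_config raised (fill e w n s A) then config_weight val raised R (fill e w n s A) else 0) =
      (if valid_config raised (fill e w n s A) then f' e w n s else 0)" for e w n s
      using wt wt' by auto
    moreover have "(if Q then P * x else 0) = P * (if Q then x else 0)" for Q x
      by simp
    ultimately show ?thesis
      using renewal_identity[OF nz nz nz nz nz nz rec s01, of kE kW kN kS]
      by (simp only: v v' f_def f'_def edge_labels_star sum_distrib_left[symmetric])
  qed
  then show ?thesis
    unfolding sum_Pow_star[OF S(1,3)] by (rule sum.cong[OF refl])
qed

end

section \<open>Descent from the cone of a point\<close>

lemma doubleton_weighted_edges: "{F, F'} \<in> weighted_edges \<longleftrightarrow> lattice_adjacent F F'"
proof
  assume "{F, F'} \<in> weighted_edges"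
  then show "lattice_adjacent F F'"
    by (auto simp: weighted_edges_def doubleton_eq_iff lattice_adjacent_def abs_minus_commute)
qed (unfold weighted_edges_def, blast)

lemma step_functionD: "step_function g \<Longrightarrow> lattice_adjacent F F' \<Longrightarrow> \<bar>g F - g F'\<bar> = 1"
  unfolding step_function_def by blast

locale cone =
  fixes h :: "face \<Rightarrow> int" and n0 i0 j0 :: int
  assumes height: "height_function h" and apex: "(n0, i0, j0) \<in> upper_points h"
begin

definition p :: "face \<Rightarrow> int" where
  "p F = n0 - \<bar>fst F - i0\<bar> - \<bar>snd F - j0\<bar>"

definition cut :: "face \<Rightarrow> int" where
  "cut F = min (h F) (p F)"

lemma step_p: "step_function p"
  unfolding step_function_def
proof (intro allI impI)
  fix F F'
  assume "lattice_adjacent F F'"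
  then have "F' \<in> {(fst F + 1, snd F), (fst F - 1, snd F), (fst F, snd F + 1), (fst F, snd F - 1)}"
    using lattice_adjacent_iff[of "fst F" "snd F" F'] by simp
  then show "\<bar>p F - p F'\<bar> = 1"
    by (auto simp: p_def)
qed

lemma step_h: "step_function h"
  using height by (simp add: height_function_def step_function_def)

lemma even_p: "even (p (i, j) - i - j)"
proof -
  have "even (n0 - i0 - j0)"
    using apex by (auto simp: upper_points_def lattice_def cong_iff_dvd_diff diff_diff_eq)
  then show ?thesis
    unfolding p_def by (auto simp: abs_if)
qed

lemma even_h: "even (h (i, j) - i - j)"
  using height by (auto simp: height_function_def cong_iff_dvd_diff diff_diff_eq)

text \<open>Parity prevents \<open>h\<close> and \<open>p\<close> from crossing between adjacent
  faces: where \<open>h\<close> is below \<open>p\<close>, it is at least 2 below, hence still at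
  most \<open>p\<close> at every neighbour.\<close>

lemma step_cut: "step_function cut"
  unfolding step_function_def
proof (intro allI impI)
  fix F F' :: face
  obtain i j k l where F: "F = (i, j)" "F' = (k, l)"
    by fastforce
  assume adj: "lattice_adjacent F F'"
  then have 1: "\<bar>h F - h F'\<bar> = 1" "\<bar>p F - p F'\<bar> = 1"
    using step_functionD[OF step_h] step_functionD[OF step_p] by blast+
  have "even (h F - i - j)" "even (p F - i - j)" "even (h F' - k - l)" "even (p F' - k - l)"
    unfolding F by (rule even_h even_p)+
  then have "even (h F - p F)" "even (h F' - p F')"
    by presburger+
  with 1 show "\<bar>cut F - cut F'\<bar> = 1"
    unfolding cut_def by presburger
qed

lemma even_cut: "even (cut (i, j) - i - j)"
  using even_h[of i j] even_p[of i j] by (simp add: cut_def min_def)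

lemma closed_faces_iff: "F \<in> closed_faces h (n0, i0, j0) \<longleftrightarrow> h F < p F"
  by (cases F) (simp add: closed_faces_def p_def)

lemma cut_closed: "cut F < p F \<longleftrightarrow> h F < p F"
  by (auto simp: cut_def)

text \<open>Closed faces together with their eight surrounding faces: diagonal neighbours are
  included because a diagonal edge may separate them from a closed face.\<close>

definition nearby :: "face set" where
  "nearby = (\<lambda>((i, j), (s, t)). (i + s, j + t)) ` (closed_faces h (n0, i0, j0) \<times> ({-1..1} \<times> {-1..1}))"

lemma finite_nearby: "finite nearby"
  unfolding nearby_def using finite_closed_faces[OF height] by (intro finite_imageI finite_cartesian_product) auto

lemma nearbyI:
  assumes "h (i, j) < p (i, j)" "s \<in> {-1..1}" "t \<in> {-1..1}"
  shows "(i + s, j + t) \<in> nearby"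
  unfolding nearby_def
  by (rule image_eqI[of _ _ "((i, j), (s, t))"]) (use assms in \<open>auto simp: closed_faces_iff\<close>)

section \<open>Height functions between the cut and the cone\<close>

definition height_edges :: "(face \<Rightarrow> int) \<Rightarrow> edge set" where
  "height_edges g = {e \<in> weighted_edges. \<exists>F\<in>e. g F < p F}"

text \<open>The parity clause keeps a face below the cone at least 2 below it, so a raise by 2 does
  not overshoot.\<close>

definition admissible :: "(face \<Rightarrow> int) \<Rightarrow> bool" where
  "admissible g \<longleftrightarrow> step_function g \<and> (\<forall>F. cut F \<le> g F \<and> g F \<le> p F) \<and> (\<forall>i j. even (g (i, j) - i - j))"

lemma admissible_closed:
  assumes "admissible g" "g F < p F"
  shows "h F \<le> g F" "h F < p F"
proof -
  have "cut F \<le> g F"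
    using assms(1) unfolding admissible_def by blast
  then show "h F \<le> g F" "h F < p F"
    using assms(2) by (auto simp: cut_def)
qed

lemma finite_height_edges:
  assumes "admissible g"
  shows "finite (height_edges g)"
proof -
  have "height_edges g \<subseteq> Pow nearby"
  proof
    fix e
    assume "e \<in> height_edges g"
    then obtain F F' where e: "e = {F, F'}" "lattice_adjacent F F'" "g F < p F \<or> g F' < p F'"
      by (auto simp: height_edges_def weighted_edges_def)
    have *: "G \<in> nearby" "G' \<in> nearby" if "lattice_adjacent G G'" "g G < p G" for G G'
    proof -
      have G: "h (fst G, snd G) < p (fst G, snd G)"
        using admissible_closed[OF assms that(2)] by simp
      show "G \<in> nearby"
        using nearbyI[OF G, of 0 0] by simp
      have "\<bar>fst G' - fst G\<bar> \<le> 1" "\<bar>snd G' - snd G\<bar> \<le> 1"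
        using that(1) by (auto simp: lattice_adjacent_def)
      then show "G' \<in> nearby"
        using nearbyI[OF G, of "fst G' - fst G" "snd G' - snd G"] by (simp add: abs_le_iff)
    qed
    have "lattice_adjacent F' F"
      using e(2) by (simp add: lattice_adjacent_def abs_minus_commute)
    then show "e \<in> Pow nearby"
      using e * by blast
  qed
  then show ?thesis
    using finite_nearby by (auto intro: finite_subset)
qed

abbreviation val :: "face \<Rightarrow> int \<Rightarrow> ratfun" where
  "val \<equiv> \<lambda>F m. octahedron h m (fst F) (snd F)"

definition config_sum :: "(face \<Rightarrow> int) \<Rightarrow> ratfun" where
  "config_sum g =
     (\<Sum>A\<in>Pow (height_edges g). if valid_config g A then config_weight val g nearby A else 0)"

text \<open>\<open>p\<close> is a function of the first coordinate plus one of the second. If a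
  block has steps u and v in the two directions, one diagonal pair is level iff u = -v and the other
  iff u = v, so no block is a cross, and a wrench admits zero weighted edges.\<close>

lemma valid_config_p: "valid_config p {}"
  unfolding valid_config_def corner_ok_def
proof (intro allI)
  fix i j
  have "\<not> (p (i, j) = p (i + 1, j + 1) \<and> p (i + 1, j) = p (i, j + 1))"
    unfolding p_def by simp arith
  then show "block_cond (p (i, j)) (p (i + 1, j)) (p (i, j + 1)) (p (i + 1, j + 1))
      (ind {} (i, j) (i + 1, j)) (ind {} (i, j) (i, j + 1))
      (ind {} (i + 1, j) (i + 1, j + 1)) (ind {} (i, j + 1) (i + 1, j + 1))"
    by (simp add: block_cond_def ind_def)
qed

text \<open>Every face except the apex has exactly two diagonals, both matched, so its doubled
  exponent is 2 - 2. The apex has four equal neighbours and no diagonal.\<close>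

lemma config_exp_p: "config_exp p {} F = of_bool (F = (i0, j0))"
proof (cases F)
  case (Pair i j)
  have c: "corner_exp p {} i j s t = (if p (i + s, j) = p (i, j + t) then 0 else - 1)" for s t
    by (simp add: corner_exp_def ind_def)
  have "p (i + 1, j) = p (i, j) + (if i < i0 then 1 else - 1)"
    "p (i - 1, j) = p (i, j) + (if i > i0 then 1 else - 1)"
    "p (i, j + 1) = p (i, j) + (if j < j0 then 1 else - 1)"
    "p (i, j - 1) = p (i, j) + (if j > j0 then 1 else - 1)"
    by (auto simp: p_def)
  then have "double_exp p {} (i, j) = 2 * of_bool ((i, j) = (i0, j0))"
    unfolding double_exp_def prod.case c by (simp add: ind_def)
  then show ?thesis
    unfolding config_exp_def Pair by simp
qed

lemma config_sum_p: "config_sum p = octahedron h n0 i0 j0"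
proof -
  have "h (i0, j0) < p (i0, j0)"
    using apex by (auto simp: upper_points_def p_def)
  from nearbyI[OF this, of 0 0] have mem: "(i0, j0) \<in> nearby"
    by simp
  have "(\<Prod>F\<in>nearby. val F (p F) powi config_exp p {} F) =
    (\<Prod>F\<in>nearby. if F = (i0, j0) then octahedron h n0 i0 j0 else 1)"
    by (rule prod.cong) (auto simp: config_exp_p p_def)
  also have "\<dots> = octahedron h n0 i0 j0"
    using mem finite_nearby by simp
  finally show ?thesis
    using valid_config_p by (simp add: config_sum_def height_edges_def config_weight_def)
qed

text \<open>Take a lowest face among the finitely many strictly below the cone. A neighbour below
  the cone is not lower by choice; a neighbour on the cone is not lower because the cone drops by
  only 1 per step.\<close>

lemma admissible_local_min:
  assumes g: "admissible g" and "g \<noteq> p"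
  obtains i j where "g (i, j) < p (i, j)" "urban_renewal g i j"
proof -
  have step: "step_function g" and le: "g F \<le> p F" for F
    using g unfolding admissible_def by blast+
  have adj: "\<bar>g F - g F'\<bar> = 1" "\<bar>p F - p F'\<bar> = 1" if "lattice_adjacent F F'" for F F'
    using step_functionD[OF step that] step_functionD[OF step_p that] by blast+
  define K where "K = {F. g F < p F}"
  have "K \<subseteq> closed_faces h (n0, i0, j0)"
    using admissible_closed[OF g] by (auto simp: K_def closed_faces_iff)
  then have "finite K"
    using finite_closed_faces[OF height] finite_subset by blast
  moreover have "K \<noteq> {}"
  proof
    assume "K = {}"
    then have "g F = p F" for F
      using le[of F] unfolding K_def by (metis empty_Collect_eq order_le_less)
    then show False
      using assms(2) by blast
  qed
  ultimately obtain C where C: "C \<in> K" "\<And>F. F \<in> K \<Longrightarrow> g C \<le> g F"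
    by (metis (no_types, lifting) arg_min_if_finite(1) arg_min_least)
  have nb: "g F = g C + 1" if "lattice_adjacent C F" for F
    using adj[OF that] C(1) C(2)[of F] unfolding K_def by fastforce
  obtain i j where ij: "C = (i, j)"
    by fastforce
  have "urban_renewal g i j"
    by unfold_locales (use step nb ij in \<open>auto simp: lattice_adjacent_iff\<close>)
  then show thesis
    using that C(1) ij by (auto simp: K_def)
qed

end

section \<open>One raising move under the cone\<close>

locale cone_renewal = cone h n0 i0 j0 + urban_renewal g i j
  for h n0 i0 j0 g i j +
  assumes adm: "admissible g" and below: "g (i, j) < p (i, j)"
begin

lemma g_bounds: "cut F \<le> g F" "g F \<le> p F"
  using adm unfolding admissible_def by blast+

lemma below_two: "g (i, j) + 2 \<le> p (i, j)"
proof -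
  have "even (g (i, j) - i - j)" "even (p (i, j) - i - j)"
    using adm even_p by (auto simp: admissible_def)
  then show ?thesis
    using below by presburger
qed

lemma admissible_raised: "admissible raised"
  unfolding admissible_def
proof (intro conjI allI)
  show "step_function raised"
    by (rule step_raised)
  show "cut F \<le> raised F" "raised F \<le> p F" for F
    using g_bounds[of F] below_two by (auto simp: raised_def)
  have "even (g (k, l) - k - l)" for k l
    using adm by (auto simp: admissible_def)
  then show "even (raised (k, l) - k - l)" for k l
    unfolding raised_def by (simp add: diff_diff_eq)
qed

lemma height_edges_raised: "height_edges raised \<subseteq> height_edges g"
proof
  fix e
  assume "e \<in> height_edges raised"
  then obtain F where "e \<in> weighted_edges" "F \<in> e" "raised F < p F"
    by (auto simp: height_edges_def)
  moreover from this have "g F < p F"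
    by (simp add: raised_def split: if_splits)
  ultimately show "e \<in> height_edges g"
    by (auto simp: height_edges_def)
qed

lemma ind_height_edges:
  assumes "A \<subseteq> height_edges g" "g F = p F" "g F' = p F'"
  shows "ind A F F' = 0"
  using assms by (auto simp: ind_def height_edges_def)

text \<open>
  When the face \<open>(i, j)\<close> reaches the cone, its edges to other faces on the cone leave the graph.
  No configuration uses them: they end in a corner pointing away from the apex, where the
  diagonal is forced.
\<close>

lemma inner_forced:
  assumes A: "A \<subseteq> height_edges g" "valid_config raised A" and top: "raised (i, j) = p (i, j)"
    and s: "s \<in> {1, -1}" "t \<in> {1, -1}"
    and out: "p (i + s, j) = p (i, j) - 1" "p (i, j + t) = p (i, j) - 1"
      "p (i + s, j + t) = p (i, j) - 2"
  shows "ind A (i, j) (i + s, j) = 0" "ind A (i, j) (i, j + t) = 0"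
proof -
  have c: "g (i, j) = p (i, j) - 2"
    using top by simp
  have x: "g (i + s, j) = p (i + s, j)" "g (i, j + t) = p (i, j + t)"
    using neighbour_horizontal[OF s(1)] neighbour_vertical[OF s(2)] out c by auto
  have d: "g (i + s, j + t) = p (i + s, j + t)" "g (i + s, j + t) = g (i, j)"
    using corner_dichotomy[OF s] g_bounds(2)[of "(i + s, j + t)"] out c by auto
  \<comment> \<open>The outer edges join faces on the cone, so \<open>A\<close> does not contain
    them. The block of \<open>g\<close> is a cross, which demands one edge of the square before the
    move and hence none after it.\<close>
  have "outer A s t = 0"
    unfolding outer_def using ind_height_edges[OF A(1)] x d(1) by simp
  then have "needed A s t = 1"
    using d(2) by (simp add: needed_def)
  moreover have "ind A (i, j) (i + s, j) + ind A (i, j) (i, j + t) = 1 - needed A s t"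
    using A(2) s unfolding valid_config_raised_iff by blast
  ultimately show "ind A (i, j) (i + s, j) = 0" "ind A (i, j) (i, j + t) = 0"
    using ind_nonneg[of A "(i, j)" "(i + s, j)"] ind_nonneg[of A "(i, j)" "(i, j + t)"] by linarith+
qed

text \<open>\<open>config_sum\<close> for \<open>raised\<close> ranges over a possibly smaller edge
  set than for \<open>g\<close>; this shows that no valid configuration is lost.\<close>

lemma valid_raised_edges:
  assumes A: "A \<subseteq> height_edges g" "valid_config raised A"
  shows "A \<subseteq> height_edges raised"
proof
  fix e
  assume e: "e \<in> A"
  show "e \<in> height_edges raised"
  proof (rule ccontr)
    assume no: "e \<notin> height_edges raised"
    obtain F F' where F: "e = {F, F'}" "lattice_adjacent F F'" "g F < p F \<or> g F' < p F'"
      using e A by (auto simp: height_edges_def weighted_edges_def)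
    have all: "raised G \<ge> p G" if "G \<in> e" for G
      using no that e A by (auto simp: height_edges_def)
    \<comment> \<open>An edge can be lost only through the one face whose height changed.\<close>
    then have "(i, j) \<in> e"
      using F by (metis insertCI not_less raised_other)
    moreover have "lattice_adjacent F' F"
      using F(2) by (simp add: lattice_adjacent_def abs_minus_commute)
    ultimately obtain X where X: "e = {(i, j), X}" "lattice_adjacent (i, j) X"
      using F by (metis insertE insert_commute singletonD)
    have top: "raised (i, j) = p (i, j)"
      using all X below_two by force
    have "X \<noteq> (i, j)"
      using X(2) by (auto simp: lattice_adjacent_def)
    \<comment> \<open>The lost edge leads away from the apex: \<open>X\<close> has height
      \<open>p (i, j) - 1\<close> and is not below the cone.\<close>
    then have pX: "p X \<le> p (i, j) - 1"
      using all[of X] X top E W N S unfolding lattice_adjacent_iff by auto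
    \<comment> \<open>Directions pointing away from the apex; on an axis either sign would
      do.\<close>
    define s t :: int where "s = (if i \<ge> i0 then 1 else - 1)" and "t = (if j \<ge> j0 then 1 else - 1)"
    have st: "s \<in> {1, -1}" "t \<in> {1, -1}"
      by (auto simp: s_def t_def)
    note forced = inner_forced[OF A top]
    have "ind A (i, j) X = 0"
    proof (cases "snd X = j")
      case True
      then have "X = (i + 1, j) \<or> X = (i - 1, j)"
        using X(2) unfolding lattice_adjacent_iff by (cases X) auto
      then obtain a where a: "X = (i + a, j)" "a \<in> {1, -1}"
        using that[of 1] that[of "-1"] by auto
      have "\<bar>i + a - i0\<bar> \<ge> \<bar>i - i0\<bar> + 1"
        using pX unfolding a(1) p_def by simp
      moreover have "\<bar>i + a - i0\<bar> \<le> \<bar>i - i0\<bar> + 1"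
        using a(2) by auto
      ultimately have "\<bar>i + a - i0\<bar> = \<bar>i - i0\<bar> + 1" "\<bar>j + t - j0\<bar> = \<bar>j - j0\<bar> + 1"
        by (simp_all add: t_def)
      then have "p (i + a, j) = p (i, j) - 1" "p (i, j + t) = p (i, j) - 1"
        "p (i + a, j + t) = p (i, j) - 2"
        by (simp_all add: p_def)
      then show ?thesis
        using forced(1)[OF a(2) st(2)] a(1) by blast
    next
      case False
      then have "X = (i, j + 1) \<or> X = (i, j - 1)"
        using X(2) unfolding lattice_adjacent_iff by (cases X) auto
      then obtain a where a: "X = (i, j + a)" "a \<in> {1, -1}"
        using that[of 1] that[of "-1"] by auto
      have "\<bar>j + a - j0\<bar> \<ge> \<bar>j - j0\<bar> + 1"
        using pX unfolding a(1) p_def by simp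
      moreover have "\<bar>j + a - j0\<bar> \<le> \<bar>j - j0\<bar> + 1"
        using a(2) by auto
      ultimately have "\<bar>i + s - i0\<bar> = \<bar>i - i0\<bar> + 1" "\<bar>j + a - j0\<bar> = \<bar>j - j0\<bar> + 1"
        by (simp_all add: s_def)
      then have "p (i + s, j) = p (i, j) - 1" "p (i, j + a) = p (i, j) - 1"
        "p (i + s, j + a) = p (i, j) - 2"
        by (simp_all add: p_def)
      then show ?thesis
        using forced(2)[OF st(1) a(2)] a(1) by blast
    qed
    then show False
      using e X(1) by (simp add: ind_def)
  qed
qed

lemma config_sum_raised: "config_sum raised = config_sum g"
proof -
  have star: "{east_edge, west_edge, north_edge, south_edge} \<subseteq> height_edges g"
    using below by (simp add: height_edges_def doubleton_weighted_edges lattice_adjacent_iff)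
  have mem: "(i, j) \<in> nearby" "(i + 1, j) \<in> nearby" "(i - 1, j) \<in> nearby"
    "(i, j + 1) \<in> nearby" "(i, j - 1) \<in> nearby"
    using nearbyI[OF admissible_closed(2)[OF adm below], of 0 0]
      nearbyI[OF admissible_closed(2)[OF adm below], of 1 0]
      nearbyI[OF admissible_closed(2)[OF adm below], of "-1" 0]
      nearbyI[OF admissible_closed(2)[OF adm below], of 0 1]
      nearbyI[OF admissible_closed(2)[OF adm below], of 0 "-1"] by auto
  have "even (g (i, j) - i - j)"
    using adm by (auto simp: admissible_def)
  then have "even (g (i, j) + 2 - (i + j))"
    by presburger
  \<comment> \<open>The recurrence is applied at height \<open>g (i, j) + 2\<close>, which exceeds
    \<open>h (i, j)\<close> because \<open>h\<close> is at most \<open>g\<close> wherever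
    \<open>g\<close> is below the cone.\<close>
  then have "(g (i, j) + 2, i, j) \<in> upper_points h"
    using admissible_closed(1)[OF adm below]
    by (simp add: upper_points_def lattice_def cong_iff_dvd_diff)
  from octahedron_recurrence[OF height this]
  have rec: "val (i, j) (g (i, j) + 2) * val (i, j) (g (i, j)) =
      avar (i + g (i, j) + 1) j * cvar (i - g (i, j) - 1) j *
        val (i, j + 1) (g (i, j) + 1) * val (i, j - 1) (g (i, j) + 1) +
      bvar i (j + g (i, j) + 1) * dvar i (j - g (i, j) - 1) *
        val (i + 1, j) (g (i, j) + 1) * val (i - 1, j) (g (i, j) + 1)"
    by (simp add: algebra_simps)
  have "config_sum g =
    (\<Sum>A\<in>Pow (height_edges g). if valid_config raised A then config_weight val raised nearby A else 0)"
    unfolding config_sum_def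
    by (rule sum_config_weight_raised[OF finite_height_edges[OF adm] _ star finite_nearby _ octahedron_nonzero rec])
      (use mem in \<open>auto simp: height_edges_def\<close>)
  also have "\<dots> = config_sum raised"
    unfolding config_sum_def
    by (rule sum.mono_neutral_right)
      (use height_edges_raised valid_raised_edges finite_height_edges[OF adm] in auto)
  finally show ?thesis ..
qed

end

context cone
begin

text \<open>Induction on the total distance to the cone. Summing over the closed faces suffices,
  since an admissible function can be below the cone only there.\<close>

lemma config_sum_admissible:
  assumes "admissible g"
  shows "config_sum g = octahedron h n0 i0 j0"
  using assms
proof (induction "\<Sum>F\<in>closed_faces h (n0, i0, j0). nat (p F - g F)" arbitrary: g rule: less_induct)
  case less
  show ?case
  proof (cases "g = p")
    case True
    then show ?thesis
      by (simp add: config_sum_p)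
  next
    case False
    from admissible_local_min[OF less.prems False]
    obtain i j where ij: "g (i, j) < p (i, j)" "urban_renewal g i j"
      by blast
    interpret urban_renewal g i j
      by fact
    interpret cone_renewal h n0 i0 j0 g i j
      by unfold_locales (use less.prems ij in auto)
    have "(\<Sum>F\<in>closed_faces h (n0, i0, j0). nat (p F - raised F)) <
      (\<Sum>F\<in>closed_faces h (n0, i0, j0). nat (p F - g F))"
    proof (rule sum_strict_mono_ex1)
      show "finite (closed_faces h (n0, i0, j0))"
        by (rule finite_closed_faces[OF height])
      show "\<forall>F\<in>closed_faces h (n0, i0, j0). nat (p F - raised F) \<le> nat (p F - g F)"
        by (auto simp: raised_def)
      show "\<exists>F\<in>closed_faces h (n0, i0, j0). nat (p F - raised F) < nat (p F - g F)"
        by (rule bexI[of _ "(i, j)"])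
          (use ij(1) admissible_closed(2)[OF adm below] in \<open>auto simp: closed_faces_iff\<close>)
    qed
    from less.hyps[OF this admissible_raised] show ?thesis
      by (simp add: config_sum_raised)
  qed
qed

lemma admissible_cut: "admissible cut"
  unfolding admissible_def using step_cut even_cut by (auto simp: cut_def)

end

section \<open>Perfect matchings and configurations\<close>

lemma even_of_abs_diff_eq_1: "\<bar>a - b\<bar> = 1 \<Longrightarrow> even (a - b - 1)" for a b :: int
proof -
  assume "\<bar>a - b\<bar> = 1"
  then have "a = b + 1 \<or> a = b - 1"
    by linarith
  then show ?thesis
    by auto
qed

lemma block_cond_zero: "\<not> (a = d \<and> b = c) \<Longrightarrow> block_cond a b c d 0 0 0 0"
  by (auto simp: block_cond_def)

text \<open>The indices 1 to 4 stand for SW, SE, NW, NE. One closed face makes all four heights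
  survive the cut: it is at least 2 below the cone, to an adjacent face both functions change by 1,
  and to the opposite face \<open>h\<close> does not change and the cone drops by at most 2. Without
  a closed face all edges are absent and the cone has a wrench.\<close>

lemma cross_block:
  fixes h1 h2 h3 h4 p1 p2 p3 p4 b l r t :: int
  assumes h: "h1 = h4" "h2 = h3" "\<bar>h1 - h2\<bar> = 1"
    and p: "\<bar>p1 - p2\<bar> = 1" "\<bar>p1 - p3\<bar> = 1" "\<bar>p2 - p4\<bar> = 1" "\<bar>p3 - p4\<bar> = 1"
    and even: "even (h1 - p1)" and wrench: "\<not> (p1 = p4 \<and> p2 = p3)"
    and e: "b = 0 \<or> (b = 1 \<and> (h1 < p1 \<or> h2 < p2))" "l = 0 \<or> (l = 1 \<and> (h1 < p1 \<or> h3 < p3))"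
     "r = 0 \<or> (r = 1 \<and> (h2 < p2 \<or> h4 < p4))" "t = 0 \<or> (t = 1 \<and> (h3 < p3 \<or> h4 < p4))"
  shows "(h1 < p1 \<or> h2 < p2 \<or> h3 < p3 \<or> h4 < p4 \<longrightarrow> b + l + r + t = 1) \<longleftrightarrow>
    block_cond (min h1 p1) (min h2 p2) (min h3 p3) (min h4 p4) b l r t"
proof (cases "h1 < p1 \<or> h2 < p2 \<or> h3 < p3 \<or> h4 < p4")
  case True
  have parity: "even (p1 - p2 - 1)" "even (p1 - p3 - 1)" "even (p2 - p4 - 1)" "even (h1 - h2 - 1)"
    by (intro even_of_abs_diff_eq_1 h p)+
  have "h1 < p1 \<longrightarrow> h1 \<le> p1 - 2" "h2 < p2 \<longrightarrow> h2 \<le> p2 - 2" "h3 < p3 \<longrightarrow> h3 \<le> p3 - 2"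
    "h4 < p4 \<longrightarrow> h4 \<le> p4 - 2"
    using even parity h(1,2) by presburger+
  moreover have bounds: "p1 \<le> p2 + 1" "p2 \<le> p1 + 1" "p1 \<le> p3 + 1" "p3 \<le> p1 + 1" "p2 \<le> p4 + 1" "p4 \<le> p2 + 1"
    "p3 \<le> p4 + 1" "p4 \<le> p3 + 1" "h1 \<le> h2 + 1" "h2 \<le> h1 + 1"
    using abs_le_D1[OF eq_refl[OF p(1)]] abs_le_D2[OF eq_refl[OF p(1)]]
      abs_le_D1[OF eq_refl[OF p(2)]] abs_le_D2[OF eq_refl[OF p(2)]]
      abs_le_D1[OF eq_refl[OF p(3)]] abs_le_D2[OF eq_refl[OF p(3)]]
      abs_le_D1[OF eq_refl[OF p(4)]] abs_le_D2[OF eq_refl[OF p(4)]]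
      abs_le_D1[OF eq_refl[OF h(3)]] abs_le_D2[OF eq_refl[OF h(3)]]
    by linarith+
  ultimately have "h1 \<le> p1" "h2 \<le> p2" "h3 \<le> p3" "h4 \<le> p4"
    using True h(1,2) by (elim disjE; linarith)+
  then show ?thesis
    using True h by (simp add: block_cond_def)
next
  case False
  then have "b = 0" "l = 0" "r = 0" "t = 0" "min h1 p1 = p1" "min h2 p2 = p2" "min h3 p3 = p3" "min h4 p4 = p4"
    using e by auto
  then show ?thesis
    using False block_cond_zero[of p1 p4 p2 p3] wrench by simp
qed

text \<open>If a face of the level pair is closed, all heights survive the cut, and the vertex
  conditions say that the weighted edges balance and the diagonal is used iff none of them is. If no
  face is closed, all edges are absent. What remains is a closed tip with the level pair
  open.\<close>

lemma wrench_block: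
  fixes h1 h2 h3 h4 p1 p2 p3 p4 b l r t d :: int
  assumes h: "h1 = h4" "h2 \<noteq> h3" "\<bar>h1 - h2\<bar> = 1" "\<bar>h1 - h3\<bar> = 1"
    and p: "\<bar>p1 - p2\<bar> = 1" "\<bar>p1 - p3\<bar> = 1" "\<bar>p2 - p4\<bar> = 1" "\<bar>p3 - p4\<bar> = 1"
    and even: "even (h1 - p1)" and wrench: "\<not> (p1 = p4 \<and> p2 = p3)"
    and e: "b = 0 \<or> (b = 1 \<and> (h1 < p1 \<or> h2 < p2))" "l = 0 \<or> (l = 1 \<and> (h1 < p1 \<or> h3 < p3))"
     "r = 0 \<or> (r = 1 \<and> (h2 < p2 \<or> h4 < p4))" "t = 0 \<or> (t = 1 \<and> (h3 < p3 \<or> h4 < p4))"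
     "d = 0 \<or> (d = 1 \<and> (h1 < p1 \<or> h4 < p4))"
  shows "(h1 < p1 \<or> h2 < p2 \<or> h4 < p4 \<longrightarrow> d + b + r = 1) \<and>
      (h1 < p1 \<or> h3 < p3 \<or> h4 < p4 \<longrightarrow> d + l + t = 1) \<longleftrightarrow>
    block_cond (min h1 p1) (min h2 p2) (min h3 p3) (min h4 p4) b l r t \<and>
    (h1 < p1 \<or> h4 < p4 \<longrightarrow> (d = 1 \<longleftrightarrow> b + l + (r + t) = 0))"
proof -
  have parity: "even (p1 - p2 - 1)" "even (p1 - p3 - 1)" "even (p2 - p4 - 1)" "even (h1 - h2 - 1)"
    "even (h1 - h3 - 1)"
    by (intro even_of_abs_diff_eq_1 h p)+
  have two: "h1 < p1 \<longrightarrow> h1 \<le> p1 - 2" "h2 < p2 \<longrightarrow> h2 \<le> p2 - 2" "h3 < p3 \<longrightarrow> h3 \<le> p3 - 2"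
    "h4 < p4 \<longrightarrow> h4 \<le> p4 - 2"
    using even parity h(1) by presburger+
  have bounds: "p1 \<le> p2 + 1" "p2 \<le> p1 + 1" "p1 \<le> p3 + 1" "p3 \<le> p1 + 1" "p2 \<le> p4 + 1" "p4 \<le> p2 + 1"
    "p3 \<le> p4 + 1" "p4 \<le> p3 + 1" "h1 \<le> h2 + 1" "h2 \<le> h1 + 1" "h1 \<le> h3 + 1" "h3 \<le> h1 + 1"
    using abs_le_D1[OF eq_refl[OF p(1)]] abs_le_D2[OF eq_refl[OF p(1)]]
      abs_le_D1[OF eq_refl[OF p(2)]] abs_le_D2[OF eq_refl[OF p(2)]]
      abs_le_D1[OF eq_refl[OF p(3)]] abs_le_D2[OF eq_refl[OF p(3)]]
      abs_le_D1[OF eq_refl[OF p(4)]] abs_le_D2[OF eq_refl[OF p(4)]]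
      abs_le_D1[OF eq_refl[OF h(3)]] abs_le_D2[OF eq_refl[OF h(3)]] abs_le_D1[OF eq_refl[OF h(4)]] abs_le_D2[OF eq_refl[OF h(4)]]
    by linarith+
  have bits: "b \<in> {0, 1}" "l \<in> {0, 1}" "r \<in> {0, 1}" "t \<in> {0, 1}" "d \<in> {0, 1}"
    using e by auto
  consider "h1 < p1 \<or> h4 < p4" | "h1 \<ge> p1" "h4 \<ge> p4" "h2 < p2" | "h1 \<ge> p1" "h4 \<ge> p4" "h3 < p3"
    | "h1 \<ge> p1" "h4 \<ge> p4" "h2 \<ge> p2" "h3 \<ge> p3"
    by linarith
  then show ?thesis
  proof cases
    case 1
    then have "h1 \<le> p1" "h2 \<le> p2" "h3 \<le> p3" "h4 \<le> p4"
      using two(1,4) bounds h(1) by (elim disjE; linarith)+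
    then have "block_cond (min h1 p1) (min h2 p2) (min h3 p3) (min h4 p4) b l r t \<longleftrightarrow>
        b + r = l + t \<and> b + r \<le> 1"
      using h by (simp add: block_cond_def)
    moreover have "(d + b + r = 1 \<and> d + l + t = 1) \<longleftrightarrow>
        (b + r = l + t \<and> b + r \<le> 1) \<and> (d = 1 \<longleftrightarrow> b + l + (r + t) = 0)"
      using bits by auto
    ultimately show ?thesis
      using 1 by blast
  next
    case 2
    \<comment> \<open>The heights are forced: the cut lowers face 3 from \<open>h1 + 1\<close> to
      \<open>h1 - 1\<close>, so the wrench becomes a cross. Since \<open>l\<close>, \<open>t\<close>
      and \<open>d\<close> vanish, its condition is that of the single vertex still present.\<close>
    then have eqs: "h1 = p1" "h4 = p4" "p2 = h1 + 1" "h2 = h1 - 1"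
      using two(2) bounds h(1) by linarith+
    moreover have "h3 = h1 + 1" "p3 = h1 - 1"
      using eqs h p wrench by auto
    ultimately have "min h1 p1 = h1" "min h2 p2 = h1 - 1" "min h3 p3 = h1 - 1" "min h4 p4 = h1"
      "l = 0" "t = 0" "d = 0" "\<not> h3 < p3" "\<not> h1 < p1" "\<not> h4 < p4"
      using h(1) e by auto
    then show ?thesis
      using 2 by (simp add: block_cond_def)
  next
    case 3
    then have eqs: "h1 = p1" "h4 = p4" "p3 = h1 + 1" "h3 = h1 - 1"
      using two(3) bounds h(1) by linarith+
    moreover have "h2 = h1 + 1" "p2 = h1 - 1"
      using eqs h p wrench by auto
    ultimately have "min h1 p1 = h1" "min h2 p2 = h1 - 1" "min h3 p3 = h1 - 1" "min h4 p4 = h1"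
      "b = 0" "r = 0" "d = 0" "\<not> h2 < p2" "\<not> h1 < p1" "\<not> h4 < p4"
      using h(1) e by auto
    then show ?thesis
      using 3 by (simp add: block_cond_def)
  next
    case 4
    then have "b = 0" "l = 0" "r = 0" "t = 0" "d = 0" "min h1 p1 = p1" "min h2 p2 = p2" "min h3 p3 = p3" "min h4 p4 = p4"
      using e by auto
    then show ?thesis
      using 4 block_cond_zero[of p1 p4 p2 p3] wrench by simp
  qed
qed

abbreviation diag1 :: "int \<Rightarrow> int \<Rightarrow> edge" where
  "diag1 i j \<equiv> {(i, j), (i + 1, j + 1)}"

abbreviation diag2 :: "int \<Rightarrow> int \<Rightarrow> edge" where
  "diag2 i j \<equiv> {(i + 1, j), (i, j + 1)}"

definition block_total :: "edge set \<Rightarrow> int \<Rightarrow> int \<Rightarrow> int \<Rightarrow> int \<Rightarrow> int" where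
  "block_total A i j s t = ind A (i, j) (i + s, j) + ind A (i, j) (i, j + t) +
     (ind A (i + s, j) (i + s, j + t) + ind A (i, j + t) (i + s, j + t))"

lemma diag1_graph_edges:
  "diag1 i j \<in> graph_edges h \<longleftrightarrow> h (i, j) = h (i + 1, j + 1) \<and> h (i + 1, j) \<noteq> h (i, j + 1)"
proof -
  have "diag1 i j \<notin> weighted_edges"
    by (simp add: doubleton_weighted_edges lattice_adjacent_def)
  then show ?thesis
    unfolding graph_edges_def unweighted_edges_def by (auto simp: doubleton_eq_iff)
qed

lemma diag2_graph_edges:
  "diag2 i j \<in> graph_edges h \<longleftrightarrow> h (i + 1, j) = h (i, j + 1) \<and> h (i, j) \<noteq> h (i + 1, j + 1)"
proof -
  have "diag2 i j \<notin> weighted_edges"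
    by (simp add: doubleton_weighted_edges lattice_adjacent_def)
  then show ?thesis
    unfolding graph_edges_def unweighted_edges_def by (auto simp: doubleton_eq_iff)
qed

lemma graph_edge_cases:
  assumes "e \<in> graph_edges h"
  obtains k l where "e = {(k, l), (k + 1, l)}" | k l where "e = {(k, l), (k, l + 1)}"
    | k l where "e = diag1 k l" | k l where "e = diag2 k l"
  using assms unfolding graph_edges_def
proof (elim UnE)
  assume "e \<in> weighted_edges"
  then show thesis
    by (cases rule: weighted_edge_cases) (use that in blast)+
next
  assume "e \<in> unweighted_edges h"
  then show thesis
    unfolding unweighted_edges_def using that by blast
qed

lemma graph_edge_in_block:
  assumes "e \<in> graph_edges h" "e \<subseteq> {(i, j), (i + 1, j), (i, j + 1), (i + 1, j + 1)}"
  shows "e \<in> {{(i, j), (i + 1, j)}, {(i, j), (i, j + 1)}, {(i + 1, j), (i + 1, j + 1)},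
    {(i, j + 1), (i + 1, j + 1)}, diag1 i j, diag2 i j}"
  using assms(1)
proof (cases rule: graph_edge_cases)
  case (1 k l)
  then have kl: "k = i" "l = j \<or> l = j + 1"
    using assms(2) by auto
  from kl(2) show ?thesis
    by (elim disjE) (simp_all only: 1 kl(1) insert_iff simp_thms)
next
  case (2 k l)
  then have kl: "l = j" "k = i \<or> k = i + 1"
    using assms(2) by auto
  from kl(2) show ?thesis
    by (elim disjE) (simp_all only: 2 kl(1) insert_iff simp_thms)
next
  case (3 k l)
  then have kl: "l = j" "k = i"
    using assms(2) by auto
  show ?thesis
    by (simp only: 3 kl insert_iff simp_thms)
next
  case (4 k l)
  then have kl: "l = j" "k = i"
    using assms(2) by auto
  show ?thesis
    by (simp only: 4 kl insert_iff simp_thms)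
qed

lemma ex1_three:
  assumes "a \<noteq> b" "a \<noteq> c" "b \<noteq> c"
  shows "(\<exists>!e. e \<in> M \<and> e \<in> {a, b, c}) \<longleftrightarrow>
    of_bool (a \<in> M) + of_bool (b \<in> M) + of_bool (c \<in> M) = (1 :: int)"
  using assms by (cases "a \<in> M"; cases "b \<in> M"; cases "c \<in> M") auto

lemma ex1_four:
  assumes "a \<noteq> b" "a \<noteq> c" "b \<noteq> c" "a \<noteq> d" "b \<noteq> d" "c \<noteq> d"
  shows "(\<exists>!e. e \<in> M \<and> e \<in> {a, b, c, d}) \<longleftrightarrow>
    of_bool (a \<in> M) + of_bool (b \<in> M) + of_bool (c \<in> M) + of_bool (d \<in> M) = (1 :: int)"
  using assms by (cases "a \<in> M"; cases "b \<in> M"; cases "c \<in> M"; cases "d \<in> M") auto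

context cone
begin

abbreviation "G_edges \<equiv> sub_edges h (n0, i0, j0)"
abbreviation "G_vertices \<equiv> sub_vertices h (n0, i0, j0)"

lemma G_edges_iff: "e \<in> G_edges \<longleftrightarrow> e \<in> graph_edges h \<and> (\<exists>F\<in>e. h F < p F)"
  by (auto simp: sub_edges_def boundary_edges_def closed_faces_iff)

lemma height_edges_cut: "height_edges cut = G_edges \<inter> weighted_edges"
  by (auto simp: height_edges_def G_edges_iff graph_edges_def cut_closed)

lemma G_vertices_iff: "v \<in> G_vertices \<longleftrightarrow> v \<in> graph_vertices h \<and> (\<exists>e\<in>G_edges. e \<subseteq> v)"
  by (auto simp: sub_vertices_def endpoints_def)

text \<open>Every vertex arises from a block, and it belongs to the finite graph iff some edge in
  \<open>G_edges\<close> ends in it; so a perfect matching can be tested block by block.\<close>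

definition matched_block :: "edge set \<Rightarrow> int \<Rightarrow> int \<Rightarrow> bool" where
  "matched_block M i j \<longleftrightarrow>
     (\<forall>v\<in>block_vertices h i j. (\<exists>e\<in>G_edges. e \<subseteq> v) \<longrightarrow> (\<exists>!e. e \<in> M \<and> e \<subseteq> v))"

lemma perfect_matching_iff:
  "perfect_matching h (n0, i0, j0) M \<longleftrightarrow> M \<subseteq> G_edges \<and> (\<forall>i j. matched_block M i j)"
proof -
  have "(\<forall>v\<in>G_vertices. \<exists>!e. e \<in> M \<and> v \<in> endpoints h e) \<longleftrightarrow>
    (\<forall>v\<in>graph_vertices h. (\<exists>e\<in>G_edges. e \<subseteq> v) \<longrightarrow> (\<exists>!e. e \<in> M \<and> e \<subseteq> v))"
    unfolding Ball_def G_vertices_iff endpoints_def mem_Collect_eq by (simp add: imp_conjL)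
  moreover have "(\<forall>v\<in>graph_vertices h. Q v) \<longleftrightarrow> (\<forall>i j. \<forall>v\<in>block_vertices h i j. Q v)" for Q
    unfolding graph_vertices_def by blast
  ultimately show ?thesis
    unfolding perfect_matching_def matched_block_def by simp
qed

definition diagonals_ok :: "edge set \<Rightarrow> int \<Rightarrow> int \<Rightarrow> bool" where
  "diagonals_ok M i j \<longleftrightarrow>
     (\<forall>e\<in>{diag1 i j, diag2 i j}. e \<in> G_edges \<longrightarrow> (e \<in> M \<longleftrightarrow> block_total M i j 1 1 = 0))"

lemma p_block:
  "\<bar>p (i, j) - p (i + 1, j)\<bar> = 1" "\<bar>p (i, j) - p (i, j + 1)\<bar> = 1"
  "\<bar>p (i + 1, j) - p (i + 1, j + 1)\<bar> = 1" "\<bar>p (i, j + 1) - p (i + 1, j + 1)\<bar> = 1"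
  "\<not> (p (i, j) = p (i + 1, j + 1) \<and> p (i + 1, j) = p (i, j + 1))"
proof -
  show "\<not> (p (i, j) = p (i + 1, j + 1) \<and> p (i + 1, j) = p (i, j + 1))"
    unfolding p_def by simp arith
qed (rule step_functionD[OF step_p], simp add: lattice_adjacent_def)+

lemma h_block:
  "\<bar>h (i, j) - h (i + 1, j)\<bar> = 1" "\<bar>h (i, j) - h (i, j + 1)\<bar> = 1"
  "\<bar>h (i + 1, j) - h (i + 1, j + 1)\<bar> = 1" "\<bar>h (i, j + 1) - h (i + 1, j + 1)\<bar> = 1"
  by (rule step_functionD[OF step_h], simp add: lattice_adjacent_def)+

lemma even_h_p: "even (h F - p F)"
proof -
  have "even (h F - fst F - snd F)" "even (p F - fst F - snd F)"
    using even_h[of "fst F" "snd F"] even_p[of "fst F" "snd F"] by simp_all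
  then show ?thesis
    by presburger
qed

text \<open>In each block the vertex conditions separate into a condition on the weighted edges,
  which is the block condition of \<open>cut\<close>, and a rule that determines the diagonal. The
  arithmetic is in \<open>cross_block\<close> and \<open>wrench_block\<close>; here incidence is
  translated into their sums.\<close>

lemma matched_block_iff:
  assumes M: "M \<subseteq> G_edges"
  shows "matched_block M i j \<longleftrightarrow> corner_ok cut M i j 1 1 \<and> diagonals_ok M i j"
proof -
  define b l r t :: edge where "b = {(i, j), (i + 1, j)}" and "l = {(i, j), (i, j + 1)}"
    and "r = {(i + 1, j), (i + 1, j + 1)}" and "t = {(i, j + 1), (i + 1, j + 1)}"
  define d1 d2 where "d1 = diag1 i j" and "d2 = diag2 i j"
  note defs = b_def l_def r_def t_def d1_def d2_def
  define cl where "cl F \<longleftrightarrow> h F < p F" for F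
  have dist: "b \<noteq> l" "b \<noteq> r" "b \<noteq> t" "b \<noteq> d1" "b \<noteq> d2" "l \<noteq> r" "l \<noteq> t" "l \<noteq> d1" "l \<noteq> d2"
    "r \<noteq> t" "r \<noteq> d1" "r \<noteq> d2" "t \<noteq> d1" "t \<noteq> d2" "d1 \<noteq> d2"
    unfolding defs by (auto simp: doubleton_eq_iff)
  have adj: "{b, l, r, t} \<subseteq> graph_edges h"
    unfolding graph_edges_def defs by (auto simp: doubleton_weighted_edges lattice_adjacent_def)
  have G: "b \<in> G_edges \<longleftrightarrow> cl (i, j) \<or> cl (i + 1, j)" "l \<in> G_edges \<longleftrightarrow> cl (i, j) \<or> cl (i, j + 1)"
    "r \<in> G_edges \<longleftrightarrow> cl (i + 1, j) \<or> cl (i + 1, j + 1)" "t \<in> G_edges \<longleftrightarrow> cl (i, j + 1) \<or> cl (i + 1, j + 1)"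
    "d1 \<in> G_edges \<longleftrightarrow> d1 \<in> graph_edges h \<and> (cl (i, j) \<or> cl (i + 1, j + 1))"
    "d2 \<in> G_edges \<longleftrightarrow> d2 \<in> graph_edges h \<and> (cl (i + 1, j) \<or> cl (i, j + 1))"
    using adj unfolding G_edges_iff cl_def defs by auto
  have six: "e \<in> {b, l, r, t, d1, d2}"
    if "e \<in> graph_edges h" "e \<subseteq> v" "v \<subseteq> {(i, j), (i + 1, j), (i, j + 1), (i + 1, j + 1)}" for e v
    unfolding defs by (rule graph_edge_in_block) (use that in auto)
  have inc: "\<And>v. b \<subseteq> v \<longleftrightarrow> (i, j) \<in> v \<and> (i + 1, j) \<in> v" "\<And>v. l \<subseteq> v \<longleftrightarrow> (i, j) \<in> v \<and> (i, j + 1) \<in> v"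
    "\<And>v. r \<subseteq> v \<longleftrightarrow> (i + 1, j) \<in> v \<and> (i + 1, j + 1) \<in> v"
    "\<And>v. t \<subseteq> v \<longleftrightarrow> (i, j + 1) \<in> v \<and> (i + 1, j + 1) \<in> v"
    "\<And>v. d1 \<subseteq> v \<longleftrightarrow> (i, j) \<in> v \<and> (i + 1, j + 1) \<in> v" "\<And>v. d2 \<subseteq> v \<longleftrightarrow> (i + 1, j) \<in> v \<and> (i, j + 1) \<in> v"
    unfolding defs by auto
  have inds: "ind M (i, j) (i + 1, j) = of_bool (b \<in> M)" "ind M (i, j) (i, j + 1) = of_bool (l \<in> M)"
    "ind M (i + 1, j) (i + 1, j + 1) = of_bool (r \<in> M)" "ind M (i, j + 1) (i + 1, j + 1) = of_bool (t \<in> M)"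
    unfolding ind_def defs by simp_all
  have Mgraph: "e \<in> graph_edges h" if "e \<in> M \<or> e \<in> G_edges" for e
    using that M G_edges_iff by blast
  have bits: "of_bool (b \<in> M) = (0::int) \<or> of_bool (b \<in> M) = (1::int) \<and> (cl (i, j) \<or> cl (i + 1, j))"
    "of_bool (l \<in> M) = (0::int) \<or> of_bool (l \<in> M) = (1::int) \<and> (cl (i, j) \<or> cl (i, j + 1))"
    "of_bool (r \<in> M) = (0::int) \<or> of_bool (r \<in> M) = (1::int) \<and> (cl (i + 1, j) \<or> cl (i + 1, j + 1))"
    "of_bool (t \<in> M) = (0::int) \<or> of_bool (t \<in> M) = (1::int) \<and> (cl (i, j + 1) \<or> cl (i + 1, j + 1))"
    "of_bool (d1 \<in> M) = (0::int) \<or> of_bool (d1 \<in> M) = (1::int) \<and> (cl (i, j) \<or> cl (i + 1, j + 1))"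
    "of_bool (d2 \<in> M) = (0::int) \<or> of_bool (d2 \<in> M) = (1::int) \<and> (cl (i + 1, j) \<or> cl (i, j + 1))"
    "of_bool (b \<in> M) = (0::int) \<or> of_bool (b \<in> M) = (1::int) \<and> (cl (i + 1, j) \<or> cl (i, j))"
    "of_bool (t \<in> M) = (0::int) \<or> of_bool (t \<in> M) = (1::int) \<and> (cl (i + 1, j + 1) \<or> cl (i, j + 1))"
    using M G by auto
  note bits' = bits[unfolded cl_def]
  have exG: "(\<exists>e\<in>G_edges. e \<subseteq> v) \<longleftrightarrow> (\<exists>e\<in>X. e \<in> G_edges)"
    if "\<And>e. e \<in> graph_edges h \<Longrightarrow> e \<subseteq> v \<longleftrightarrow> e \<in> X" for v X
    using that Mgraph by blast
  have ex1M: "(\<exists>!e. e \<in> M \<and> e \<subseteq> v) \<longleftrightarrow> (\<exists>!e. e \<in> M \<and> e \<in> X)"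
    if "\<And>e. e \<in> graph_edges h \<Longrightarrow> e \<subseteq> v \<longleftrightarrow> e \<in> X" for v X
  proof -
    have "e \<in> M \<and> e \<subseteq> v \<longleftrightarrow> e \<in> M \<and> e \<in> X" for e
      using that Mgraph by blast
    then show ?thesis
      by simp
  qed
  note ok = corner_ok_def cut_def inds
  have diags: "diagonals_ok M i j \<longleftrightarrow>
     (d1 \<in> G_edges \<longrightarrow> (d1 \<in> M \<longleftrightarrow> block_total M i j 1 1 = 0)) \<and>
     (d2 \<in> G_edges \<longrightarrow> (d2 \<in> M \<longleftrightarrow> block_total M i j 1 1 = 0))"
    unfolding diagonals_ok_def d1_def d2_def by simp
  consider (cross) "h (i, j) = h (i + 1, j + 1)" "h (i + 1, j) = h (i, j + 1)"
    | (wrench1) "h (i, j) = h (i + 1, j + 1)" "h (i + 1, j) \<noteq> h (i, j + 1)"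
    | (wrench2) "h (i, j) \<noteq> h (i + 1, j + 1)" "h (i + 1, j) = h (i, j + 1)"
    using step_function_diagonal[OF step_h, of i j] by blast
  then show ?thesis
  proof cases
    case cross
    define v where "v = {(i, j), (i + 1, j), (i, j + 1), (i + 1, j + 1)}"
    have bv: "block_vertices h i j = {v}"
      using cross by (simp add: block_vertices_def v_def Let_def)
    have no: "d1 \<notin> graph_edges h" "d2 \<notin> graph_edges h"
      using cross unfolding d1_def d2_def diag1_graph_edges diag2_graph_edges by auto
    have "v \<subseteq> {(i, j), (i + 1, j), (i, j + 1), (i + 1, j + 1)}" "b \<subseteq> v" "l \<subseteq> v" "r \<subseteq> v" "t \<subseteq> v"
      by (simp_all add: inc v_def)
    then have vs: "e \<subseteq> v \<longleftrightarrow> e \<in> {b, l, r, t}" if "e \<in> graph_edges h" for e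
      using six[OF that, of v] no that by blast
    have exv: "(\<exists>e\<in>G_edges. e \<subseteq> v) \<longleftrightarrow> (\<exists>e\<in>{b, l, r, t}. e \<in> G_edges)"
      by (rule exG) (rule vs)
    have "(\<exists>e\<in>G_edges. e \<subseteq> v) \<longleftrightarrow> cl (i, j) \<or> cl (i + 1, j) \<or> cl (i, j + 1) \<or> cl (i + 1, j + 1)"
      unfolding exv by (simp add: G) blast
    moreover have "(\<exists>!e. e \<in> M \<and> e \<subseteq> v) \<longleftrightarrow> (\<exists>!e. e \<in> M \<and> e \<in> {b, l, r, t})"
      by (rule ex1M) (rule vs)
    ultimately have "matched_block M i j \<longleftrightarrow>
      (cl (i, j) \<or> cl (i + 1, j) \<or> cl (i, j + 1) \<or> cl (i + 1, j + 1) \<longrightarrow>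
       of_bool (b \<in> M) + of_bool (l \<in> M) + of_bool (r \<in> M) + of_bool (t \<in> M) = (1::int))"
      unfolding matched_block_def bv ex1_four[OF dist(1,2,6,3,7,10)]
      by (simp only: ball_simps simp_thms)
    also have "\<dots> \<longleftrightarrow> corner_ok cut M i j 1 1"
      unfolding ok cl_def
      by (rule cross_block[OF cross h_block(1) p_block(1-4) even_h_p p_block(5) bits'(1-4)])
    finally show ?thesis
      using no G diags by blast
  next
    case wrench1
    define v w where "v = {(i, j), (i + 1, j + 1), (i + 1, j)}" and "w = {(i, j), (i + 1, j + 1), (i, j + 1)}"
    have bv: "block_vertices h i j = {v, w}"
      using wrench1 by (simp add: block_vertices_def v_def w_def Let_def)
    have no: "d2 \<notin> graph_edges h" "d1 \<in> graph_edges h"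
      using wrench1 unfolding d1_def d2_def diag1_graph_edges diag2_graph_edges by auto
    have "v \<subseteq> {(i, j), (i + 1, j), (i, j + 1), (i + 1, j + 1)}" "d1 \<subseteq> v" "b \<subseteq> v" "r \<subseteq> v"
      "\<not> l \<subseteq> v" "\<not> t \<subseteq> v"
      by (simp_all add: inc v_def)
    then have vs: "e \<subseteq> v \<longleftrightarrow> e \<in> {d1, b, r}" if "e \<in> graph_edges h" for e
      using six[OF that, of v] no that by blast
    have "w \<subseteq> {(i, j), (i + 1, j), (i, j + 1), (i + 1, j + 1)}" "d1 \<subseteq> w" "l \<subseteq> w" "t \<subseteq> w"
      "\<not> b \<subseteq> w" "\<not> r \<subseteq> w"
      by (simp_all add: inc w_def)
    then have ws: "e \<subseteq> w \<longleftrightarrow> e \<in> {d1, l, t}" if "e \<in> graph_edges h" for e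
      using six[OF that, of w] no that by blast
    have exv: "(\<exists>e\<in>G_edges. e \<subseteq> v) \<longleftrightarrow> (\<exists>e\<in>{d1, b, r}. e \<in> G_edges)"
      by (rule exG) (rule vs)
    have exw: "(\<exists>e\<in>G_edges. e \<subseteq> w) \<longleftrightarrow> (\<exists>e\<in>{d1, l, t}. e \<in> G_edges)"
      by (rule exG) (rule ws)
    have "(\<exists>e\<in>G_edges. e \<subseteq> v) \<longleftrightarrow> cl (i, j) \<or> cl (i + 1, j) \<or> cl (i + 1, j + 1)"
      "(\<exists>e\<in>G_edges. e \<subseteq> w) \<longleftrightarrow> cl (i, j) \<or> cl (i, j + 1) \<or> cl (i + 1, j + 1)"
      unfolding exv exw by (simp_all add: G no) blast+
    moreover have "(\<exists>!e. e \<in> M \<and> e \<subseteq> v) \<longleftrightarrow> (\<exists>!e. e \<in> M \<and> e \<in> {d1, b, r})"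
      "(\<exists>!e. e \<in> M \<and> e \<subseteq> w) \<longleftrightarrow> (\<exists>!e. e \<in> M \<and> e \<in> {d1, l, t})"
      by (rule ex1M, erule vs, rule ex1M, erule ws)
    ultimately have "matched_block M i j \<longleftrightarrow>
      (cl (i, j) \<or> cl (i + 1, j) \<or> cl (i + 1, j + 1) \<longrightarrow>
       of_bool (d1 \<in> M) + of_bool (b \<in> M) + of_bool (r \<in> M) = (1::int)) \<and>
      (cl (i, j) \<or> cl (i, j + 1) \<or> cl (i + 1, j + 1) \<longrightarrow>
       of_bool (d1 \<in> M) + of_bool (l \<in> M) + of_bool (t \<in> M) = (1::int))"
      unfolding matched_block_def bv ex1_three[OF dist(4)[symmetric] dist(11)[symmetric] dist(2)]
        ex1_three[OF dist(8)[symmetric] dist(13)[symmetric] dist(7)]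
      by (simp only: ball_simps simp_thms)
    also have "\<dots> \<longleftrightarrow> corner_ok cut M i j 1 1 \<and> (cl (i, j) \<or> cl (i + 1, j + 1) \<longrightarrow>
        (of_bool (d1 \<in> M) = (1::int) \<longleftrightarrow>
         of_bool (b \<in> M) + of_bool (l \<in> M) + (of_bool (r \<in> M) + of_bool (t \<in> M)) = (0::int)))"
      unfolding ok cl_def
      by (rule wrench_block[OF wrench1 h_block(1,2) p_block(1-4) even_h_p p_block(5) bits'(1-5)])
    also have "\<dots> \<longleftrightarrow> corner_ok cut M i j 1 1 \<and> diagonals_ok M i j"
      unfolding diags block_total_def inds using no G by auto
    finally show ?thesis .
  next
    case wrench2
    define v w where "v = {(i + 1, j), (i, j + 1), (i, j)}" and "w = {(i + 1, j), (i, j + 1), (i + 1, j + 1)}"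
    have h_swap: "\<bar>h (i + 1, j) - h (i, j)\<bar> = 1" "\<bar>h (i + 1, j) - h (i + 1, j + 1)\<bar> = 1"
      and p_swap: "\<bar>p (i + 1, j) - p (i, j)\<bar> = 1" "\<bar>p (i + 1, j) - p (i + 1, j + 1)\<bar> = 1"
        "\<bar>p (i, j) - p (i, j + 1)\<bar> = 1" "\<bar>p (i + 1, j + 1) - p (i, j + 1)\<bar> = 1"
      using h_block[of i j] p_block[of i j] by (simp_all only: abs_minus_commute)
    have bv: "block_vertices h i j = {v, w}"
      using wrench2 by (simp add: block_vertices_def v_def w_def Let_def)
    have no: "d1 \<notin> graph_edges h" "d2 \<in> graph_edges h"
      using wrench2 unfolding d1_def d2_def diag1_graph_edges diag2_graph_edges by auto
    have "v \<subseteq> {(i, j), (i + 1, j), (i, j + 1), (i + 1, j + 1)}" "d2 \<subseteq> v" "b \<subseteq> v" "l \<subseteq> v"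
      "\<not> r \<subseteq> v" "\<not> t \<subseteq> v"
      by (simp_all add: inc v_def)
    then have vs: "e \<subseteq> v \<longleftrightarrow> e \<in> {d2, b, l}" if "e \<in> graph_edges h" for e
      using six[OF that, of v] no that by blast
    have "w \<subseteq> {(i, j), (i + 1, j), (i, j + 1), (i + 1, j + 1)}" "d2 \<subseteq> w" "r \<subseteq> w" "t \<subseteq> w"
      "\<not> b \<subseteq> w" "\<not> l \<subseteq> w"
      by (simp_all add: inc w_def)
    then have ws: "e \<subseteq> w \<longleftrightarrow> e \<in> {d2, r, t}" if "e \<in> graph_edges h" for e
      using six[OF that, of w] no that by blast
    have exv: "(\<exists>e\<in>G_edges. e \<subseteq> v) \<longleftrightarrow> (\<exists>e\<in>{d2, b, l}. e \<in> G_edges)"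
      by (rule exG) (rule vs)
    have exw: "(\<exists>e\<in>G_edges. e \<subseteq> w) \<longleftrightarrow> (\<exists>e\<in>{d2, r, t}. e \<in> G_edges)"
      by (rule exG) (rule ws)
    have "(\<exists>e\<in>G_edges. e \<subseteq> v) \<longleftrightarrow> cl (i + 1, j) \<or> cl (i, j) \<or> cl (i, j + 1)"
      "(\<exists>e\<in>G_edges. e \<subseteq> w) \<longleftrightarrow> cl (i + 1, j) \<or> cl (i + 1, j + 1) \<or> cl (i, j + 1)"
      unfolding exv exw by (simp_all add: G no) blast+
    moreover have "(\<exists>!e. e \<in> M \<and> e \<subseteq> v) \<longleftrightarrow> (\<exists>!e. e \<in> M \<and> e \<in> {d2, b, l})"
      "(\<exists>!e. e \<in> M \<and> e \<subseteq> w) \<longleftrightarrow> (\<exists>!e. e \<in> M \<and> e \<in> {d2, r, t})"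
      by (rule ex1M, erule vs, rule ex1M, erule ws)
    ultimately have "matched_block M i j \<longleftrightarrow>
      (cl (i + 1, j) \<or> cl (i, j) \<or> cl (i, j + 1) \<longrightarrow>
       of_bool (d2 \<in> M) + of_bool (b \<in> M) + of_bool (l \<in> M) = (1::int)) \<and>
      (cl (i + 1, j) \<or> cl (i + 1, j + 1) \<or> cl (i, j + 1) \<longrightarrow>
       of_bool (d2 \<in> M) + of_bool (r \<in> M) + of_bool (t \<in> M) = (1::int))"
      unfolding matched_block_def bv ex1_three[OF dist(5)[symmetric] dist(9)[symmetric] dist(1)]
        ex1_three[OF dist(12)[symmetric] dist(14)[symmetric] dist(10)]
      by (simp only: ball_simps simp_thms)
    \<comment> \<open>\<open>wrench_block\<close> is applied to the block mirrored left to right, so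
      that the level pair takes the places of \<open>h1\<close> and \<open>h4\<close>; the mirroring
      is undone in the next step.\<close>
    also have "\<dots> \<longleftrightarrow> block_cond (cut (i + 1, j)) (cut (i, j)) (cut (i + 1, j + 1)) (cut (i, j + 1))
        (of_bool (b \<in> M)) (of_bool (r \<in> M)) (of_bool (l \<in> M)) (of_bool (t \<in> M)) \<and>
        (cl (i + 1, j) \<or> cl (i, j + 1) \<longrightarrow>
        (of_bool (d2 \<in> M) = (1::int) \<longleftrightarrow>
         of_bool (b \<in> M) + of_bool (r \<in> M) + (of_bool (l \<in> M) + of_bool (t \<in> M)) = (0::int)))"
      unfolding cut_def cl_def
      by (rule wrench_block[OF wrench2(2,1) h_swap p_swap even_h_p _ bits'(7,3,2,8,6)])
        (use p_block(5)[of i j] in blast)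
    also have "block_cond (cut (i + 1, j)) (cut (i, j)) (cut (i + 1, j + 1)) (cut (i, j + 1))
        (of_bool (b \<in> M)) (of_bool (r \<in> M)) (of_bool (l \<in> M)) (of_bool (t \<in> M)) \<longleftrightarrow> corner_ok cut M i j 1 1"
      unfolding corner_ok_def inds
      by (rule block_cond_flip(1)) (rule step_function_diagonal[OF step_cut])
    also have "corner_ok cut M i j 1 1 \<and> (cl (i + 1, j) \<or> cl (i, j + 1) \<longrightarrow>
        (of_bool (d2 \<in> M) = (1::int) \<longleftrightarrow>
         of_bool (b \<in> M) + of_bool (r \<in> M) + (of_bool (l \<in> M) + of_bool (t \<in> M)) = (0::int))) \<longleftrightarrow>
      corner_ok cut M i j 1 1 \<and> diagonals_ok M i j"
      unfolding diags block_total_def inds using no G by auto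
    finally show ?thesis .
  qed
qed

end

section \<open>Forgetting and restoring the diagonals\<close>

definition same_weighted :: "edge set \<Rightarrow> edge set \<Rightarrow> bool" where
  "same_weighted A B \<longleftrightarrow> A \<inter> weighted_edges = B \<inter> weighted_edges"

lemma same_weighted_ind:
  assumes "same_weighted A B" "lattice_adjacent F F'"
  shows "ind A F F' = ind B F F'"
  using assms unfolding same_weighted_def ind_def doubleton_weighted_edges[symmetric] by auto

lemma same_weighted_horizontal:
  assumes "same_weighted A B" "s \<in> {1, -1}"
  shows "ind A (i, j) (i + s, j) = ind B (i, j) (i + s, j)"
  by (rule same_weighted_ind[OF assms(1)]) (use assms(2) in \<open>auto simp: lattice_adjacent_def\<close>)

lemma same_weighted_vertical:
  assumes "same_weighted A B" "t \<in> {1, -1}"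
  shows "ind A (i, j) (i, j + t) = ind B (i, j) (i, j + t)"
  by (rule same_weighted_ind[OF assms(1)]) (use assms(2) in \<open>auto simp: lattice_adjacent_def\<close>)

lemma same_weighted_corner:
  assumes "same_weighted A B" "s \<in> {1, -1}" "t \<in> {1, -1}"
  shows "corner_ok g A i j s t = corner_ok g B i j s t"
    and "block_total A i j s t = block_total B i j s t"
    and "corner_exp g A i j s t = corner_exp g B i j s t"
  unfolding corner_ok_def block_total_def corner_exp_def
    same_weighted_horizontal[OF assms(1,2)] same_weighted_vertical[OF assms(1,3)] by (rule refl)+

lemma same_weighted_valid:
  assumes "same_weighted A B"
  shows "valid_config g A = valid_config g B"
  unfolding valid_config_def by (simp add: same_weighted_corner(1)[OF assms])

lemma same_weighted_exp:
  assumes "same_weighted A B"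
  shows "config_exp g A F = config_exp g B F"
proof -
  have "ind A (i, j) (i - 1, j) = ind B (i, j) (i - 1, j)"
    "ind A (i, j) (i, j - 1) = ind B (i, j) (i, j - 1)" for i j
    using same_weighted_horizontal[OF assms, of "-1" i j] same_weighted_vertical[OF assms, of "-1" i j]
    by simp_all
  then show ?thesis
    unfolding config_exp_def double_exp_def
    by (simp add: same_weighted_corner(3)[OF assms] same_weighted_horizontal[OF assms]
        same_weighted_vertical[OF assms] split: prod.split)
qed

lemma diagonal_block_unique:
  assumes "e \<in> {diag1 i j, diag2 i j}" "e \<in> {diag1 k l, diag2 k l}"
  shows "k = i \<and> l = j"
  using assms by (auto simp: doubleton_eq_iff)

lemma unweighted_diagonal:
  assumes "e \<in> graph_edges h" "e \<notin> weighted_edges"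
  obtains i j where "e \<in> {diag1 i j, diag2 i j}"
  using assms that unfolding graph_edges_def unweighted_edges_def by blast

lemma diagonal_unweighted: "e \<in> {diag1 i j, diag2 i j} \<Longrightarrow> e \<notin> weighted_edges"
  by (auto simp: doubleton_weighted_edges lattice_adjacent_def)

context cone
begin

lemma perfect_matching_config:
  "perfect_matching h (n0, i0, j0) M \<longleftrightarrow>
     M \<subseteq> G_edges \<and> valid_config cut M \<and> (\<forall>i j. diagonals_ok M i j)"
  using matched_block_iff unfolding perfect_matching_iff valid_config_def by blast

text \<open>Inverse, on valid configurations, of forgetting the diagonals of a perfect
  matching.\<close>

definition restore :: "edge set \<Rightarrow> edge set" where
  "restore A = A \<union> {e \<in> G_edges. \<exists>i j. e \<in> {diag1 i j, diag2 i j} \<and> block_total A i j 1 1 = 0}"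

lemma restore_weighted:
  assumes "A \<subseteq> height_edges cut"
  shows "restore A \<inter> weighted_edges = A"
  using assms diagonal_unweighted unfolding restore_def height_edges_def by blast

lemma restore_perfect:
  assumes "A \<subseteq> height_edges cut" "valid_config cut A"
  shows "perfect_matching h (n0, i0, j0) (restore A)"
  unfolding perfect_matching_config
proof (intro conjI allI)
  have same: "same_weighted (restore A) A"
    using restore_weighted[OF assms(1)] assms(1) by (auto simp: same_weighted_def height_edges_def)
  show "restore A \<subseteq> G_edges"
    using assms(1) by (auto simp: restore_def height_edges_cut)
  show "valid_config cut (restore A)"
    using same_weighted_valid[OF same] assms(2) by blast
  fix i j
  have "e \<in> restore A \<longleftrightarrow> block_total A i j 1 1 = 0"
    if e: "e \<in> {diag1 i j, diag2 i j}" "e \<in> G_edges" for e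
  proof -
    have "e \<notin> A"
      using diagonal_unweighted[OF e(1)] assms(1) by (auto simp: height_edges_def)
    moreover have "(\<exists>k l. e \<in> {diag1 k l, diag2 k l} \<and> block_total A k l 1 1 = 0) \<longleftrightarrow>
        block_total A i j 1 1 = 0"
      using diagonal_block_unique[OF e(1)] e(1) by metis
    ultimately show ?thesis
      unfolding restore_def using e(2) by simp
  qed
  then show "diagonals_ok (restore A) i j"
    unfolding diagonals_ok_def using same_weighted_corner(2)[OF same] by simp
qed

lemma restore_matching:
  assumes "perfect_matching h (n0, i0, j0) M"
  shows "restore (M \<inter> weighted_edges) = M"
proof -
  have M: "M \<subseteq> G_edges" and d: "diagonals_ok M i j" for i j
    using assms by (auto simp: perfect_matching_config)
  have bt: "block_total (M \<inter> weighted_edges) i j 1 1 = block_total M i j 1 1" for i j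
    by (rule same_weighted_corner(2)) (auto simp: same_weighted_def)
  have *: "e \<in> M \<longleftrightarrow> block_total M i j 1 1 = 0" if "e \<in> {diag1 i j, diag2 i j}" "e \<in> G_edges" for e i j
    using d[of i j] that unfolding diagonals_ok_def by blast
  have "e \<in> M" if "e \<in> restore (M \<inter> weighted_edges)" for e
    using that * unfolding restore_def bt by blast
  moreover have "e \<in> restore (M \<inter> weighted_edges)" if "e \<in> M" for e
  proof (cases "e \<in> weighted_edges")
    case True
    then show ?thesis
      using that by (simp add: restore_def)
  next
    case False
    have "e \<in> graph_edges h"
      using that M by (auto simp: G_edges_iff)
    from unweighted_diagonal[OF this False] obtain i j where ij: "e \<in> {diag1 i j, diag2 i j}" .
    then have "block_total M i j 1 1 = 0"
      using * that M by blast
    then show ?thesis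
      unfolding restore_def bt using ij that M by blast
  qed
  ultimately show ?thesis
    by blast
qed

lemma sum_configs:
  "(\<Sum>A | A \<in> Pow (height_edges cut) \<and> valid_config cut A. f A) =
   (\<Sum>M | perfect_matching h (n0, i0, j0) M. f (M \<inter> weighted_edges))"
proof (rule sum.reindex_bij_witness[of _ "\<lambda>M. M \<inter> weighted_edges" restore])
  fix A
  assume "A \<in> {A. A \<in> Pow (height_edges cut) \<and> valid_config cut A}"
  then show "restore A \<inter> weighted_edges = A" "restore A \<in> {M. perfect_matching h (n0, i0, j0) M}"
    "f (restore A \<inter> weighted_edges) = f A"
    using restore_weighted restore_perfect by auto
next
  fix M
  assume M: "M \<in> {M. perfect_matching h (n0, i0, j0) M}"
  then show "restore (M \<inter> weighted_edges) = M"
    using restore_matching by blast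
  have "same_weighted (M \<inter> weighted_edges) M"
    by (auto simp: same_weighted_def)
  then show "M \<inter> weighted_edges \<in> {A. A \<in> Pow (height_edges cut) \<and> valid_config cut A}"
    using M same_weighted_valid unfolding perfect_matching_config height_edges_cut by blast
qed

section \<open>Boundary edges and exponents of faces\<close>

lemma block_total_reorient:
  "block_total A i j (- 1) 1 = block_total A (i - 1) j 1 1"
  "block_total A i j 1 (- 1) = block_total A i (j - 1) 1 1"
  "block_total A i j (- 1) (- 1) = block_total A (i - 1) (j - 1) 1 1"
  unfolding block_total_def
  by (simp_all add: ind_commute[of A "(i, _)" "(i - 1, _)"] ind_commute[of A "(_, j)" "(_, j - 1)"])

lemma diagonal_matched:
  assumes "perfect_matching h (n0, i0, j0) M" "s \<in> {1, -1}" "t \<in> {1, -1}"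
    and "{(i, j), (i + s, j + t)} \<in> G_edges"
  shows "{(i, j), (i + s, j + t)} \<in> M \<longleftrightarrow> block_total M i j s t = 0"
proof -
  have d: "e \<in> M \<longleftrightarrow> block_total M k l 1 1 = 0" if "e \<in> {diag1 k l, diag2 k l}" "e \<in> G_edges" for e k l
    using assms(1) that unfolding perfect_matching_config diagonals_ok_def by blast
  have "\<exists>k l. {(i, j), (i + s, j + t)} \<in> {diag1 k l, diag2 k l} \<and>
      block_total M i j s t = block_total M k l 1 1"
  proof -
    consider "s = 1" "t = 1" | "s = -1" "t = 1" | "s = 1" "t = -1" | "s = -1" "t = -1"
      using assms(2,3) by blast
    then show ?thesis
    proof cases
      case 1
      show ?thesis
        by (rule exI[of _ i], rule exI[of _ j]) (simp add: 1)
    next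
      case 2
      show ?thesis
        by (rule exI[of _ "i - 1"], rule exI[of _ j]) (simp add: 2 block_total_reorient)
    next
      case 3
      show ?thesis
        by (rule exI[of _ i], rule exI[of _ "j - 1"])
          (simp add: 3 block_total_reorient doubleton_eq_iff)
    next
      case 4
      show ?thesis
        by (rule exI[of _ "i - 1"], rule exI[of _ "j - 1"])
          (simp add: 4 block_total_reorient doubleton_eq_iff)
    qed
  qed
  with d assms(4) show ?thesis
    by metis
qed

text \<open>A diagonal edge also requires its own two faces to be level; by
  \<open>step_function_diagonal\<close> this follows once the other two differ.\<close>

lemma corner_graph_edge:
  assumes "s \<in> {1, -1}" "t \<in> {1, -1}"
  shows "{(i, j), (i + s, j + t)} \<in> graph_edges h \<longleftrightarrow> h (i + s, j) \<noteq> h (i, j + t)"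
proof -
  note d = step_function_diagonal[OF step_h]
  have "diag1 i j \<in> graph_edges h \<longleftrightarrow> h (i + 1, j) \<noteq> h (i, j + 1)"
    "diag2 (i - 1) j \<in> graph_edges h \<longleftrightarrow> h (i - 1, j) \<noteq> h (i, j + 1)"
    "diag2 i (j - 1) \<in> graph_edges h \<longleftrightarrow> h (i + 1, j) \<noteq> h (i, j - 1)"
    "diag1 (i - 1) (j - 1) \<in> graph_edges h \<longleftrightarrow> h (i - 1, j) \<noteq> h (i, j - 1)"
    unfolding diag1_graph_edges diag2_graph_edges
    using d[of i j] d[of "i - 1" j] d[of i "j - 1"] d[of "i - 1" "j - 1"] by auto
  then show ?thesis
    using assms by (auto simp: insert_commute)
qed

abbreviation directions :: "(int \<times> int) set" where
  "directions \<equiv> {(1, 0), (- 1, 0), (0, 1), (0, - 1), (1, 1), (- 1, 1), (- 1, - 1), (1, - 1)}"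

lemma boundary_edges_iff:
  "e \<in> boundary_edges h (i, j) \<longleftrightarrow>
     (\<exists>d\<in>directions. e = {(i, j), (i + fst d, j + snd d)}) \<and> e \<in> graph_edges h"
proof
  assume "e \<in> boundary_edges h (i, j)"
  then have e: "e \<in> graph_edges h" "(i, j) \<in> e"
    by (auto simp: boundary_edges_def)
  from e(1) have "\<exists>d\<in>directions. e = {(i, j), (i + fst d, j + snd d)}"
  proof (cases rule: graph_edge_cases)
    case (1 k l)
    then have "(k, l) = (i, j) \<or> (k, l) = (i - 1, j)"
      using e(2) by auto
    then show ?thesis
    proof
      assume "(k, l) = (i, j)"
      then show ?thesis
        by (intro bexI[of _ "(1, 0)"]) (simp_all add: 1 doubleton_eq_iff)
    next
      assume "(k, l) = (i - 1, j)"
      then show ?thesis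
        by (intro bexI[of _ "(- 1, 0)"]) (simp_all add: 1 doubleton_eq_iff)
    qed
  next
    case (2 k l)
    then have "(k, l) = (i, j) \<or> (k, l) = (i, j - 1)"
      using e(2) by auto
    then show ?thesis
    proof
      assume "(k, l) = (i, j)"
      then show ?thesis
        by (intro bexI[of _ "(0, 1)"]) (simp_all add: 2 doubleton_eq_iff)
    next
      assume "(k, l) = (i, j - 1)"
      then show ?thesis
        by (intro bexI[of _ "(0, - 1)"]) (simp_all add: 2 doubleton_eq_iff)
    qed
  next
    case (3 k l)
    then have "(k, l) = (i, j) \<or> (k, l) = (i - 1, j - 1)"
      using e(2) by auto
    then show ?thesis
    proof
      assume "(k, l) = (i, j)"
      then show ?thesis
        by (intro bexI[of _ "(1, 1)"]) (simp_all add: 3 doubleton_eq_iff)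
    next
      assume "(k, l) = (i - 1, j - 1)"
      then show ?thesis
        by (intro bexI[of _ "(- 1, - 1)"]) (simp_all add: 3 doubleton_eq_iff)
    qed
  next
    case (4 k l)
    then have "(k, l) = (i - 1, j) \<or> (k, l) = (i, j - 1)"
      using e(2) by auto
    then show ?thesis
    proof
      assume "(k, l) = (i - 1, j)"
      then show ?thesis
        by (intro bexI[of _ "(- 1, 1)"]) (simp_all add: 4 doubleton_eq_iff)
    next
      assume "(k, l) = (i, j - 1)"
      then show ?thesis
        by (intro bexI[of _ "(1, - 1)"]) (simp_all add: 4 doubleton_eq_iff)
    qed
  qed
  then show "(\<exists>d\<in>directions. e = {(i, j), (i + fst d, j + snd d)}) \<and> e \<in> graph_edges h"
    using e(1) by blast
qed (auto simp: boundary_edges_def)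

lemma card_boundary_edges:
  assumes "X \<subseteq> graph_edges h"
  shows "int (card (boundary_edges h (i, j) \<inter> X)) =
    ind X (i, j) (i + 1, j) + ind X (i, j) (i - 1, j) + ind X (i, j) (i, j + 1) + ind X (i, j) (i, j - 1) +
    ind X (i, j) (i + 1, j + 1) + ind X (i, j) (i - 1, j + 1) + ind X (i, j) (i - 1, j - 1) +
    ind X (i, j) (i + 1, j - 1)"
proof -
  define f where "f d = {(i, j), (i + fst d, j + snd d)}" for d :: "int \<times> int"
  have "inj_on f directions"
    by (auto simp: inj_on_def f_def doubleton_eq_iff)
  then have inj: "inj_on f (directions \<inter> {d. f d \<in> X})"
    by (rule inj_on_subset) auto
  define D where "D = directions"
  have "e \<in> boundary_edges h (i, j) \<longleftrightarrow> (\<exists>d\<in>D. e = f d)" if "e \<in> X" for e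
    unfolding boundary_edges_iff D_def f_def using that assms by blast
  then have "boundary_edges h (i, j) \<inter> X = f ` (D \<inter> {d. f d \<in> X})"
    by blast
  then have "boundary_edges h (i, j) \<inter> X = f ` (directions \<inter> {d. f d \<in> X})"
    unfolding D_def .
  then have "int (card (boundary_edges h (i, j) \<inter> X)) = int (card (directions \<inter> {d. f d \<in> X}))"
    using card_image[OF inj] by simp
  also have "\<dots> = (\<Sum>d\<in>directions. of_bool (f d \<in> X))"
    by (intro sum_of_bool_eq[symmetric] finite.intros)
  also have "\<dots> = ind X (i, j) (i + 1, j) + ind X (i, j) (i - 1, j) + ind X (i, j) (i, j + 1) +
    ind X (i, j) (i, j - 1) + ind X (i, j) (i + 1, j + 1) + ind X (i, j) (i - 1, j + 1) +
    ind X (i, j) (i - 1, j - 1) + ind X (i, j) (i + 1, j - 1)"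
    by (simp add: f_def ind_def)
  finally show ?thesis .
qed

end

lemma lattice_adjacent_commute: "lattice_adjacent F F' \<longleftrightarrow> lattice_adjacent F' F"
  by (simp add: lattice_adjacent_def abs_minus_commute)

lemma ceiling_half: "\<lceil>(real a - real b) / 2\<rceil> = (int a - int b + 1) div 2"
proof -
  have "\<lceil>(real a - real b) / 2\<rceil> = \<lceil>real_of_int (int a - int b) / real_of_int 2\<rceil>"
    by simp
  also have "\<dots> = - (- (int a - int b) div 2)"
    by (rule ceiling_divide_eq_div)
  also have "\<dots> = (int a - int b + 1) div 2"
    by presburger
  finally show ?thesis .
qed

context cone
begin

lemma closed_below: "h F < p F \<Longrightarrow> h F \<le> p F - 2"
  using even_h_p[of F] by presburger

text \<open>A closed face is at least 2 below the cone, and one step changes \<open>p - h\<close> by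
  at most 2.\<close>

lemma cut_next_to_closed:
  assumes "h K < p K" "lattice_adjacent K X"
  shows "cut X = h X"
  using closed_below[OF assms(1)] step_functionD[OF step_h assms(2)] step_functionD[OF step_p assms(2)]
  unfolding cut_def by linarith

lemma corner_adjacent:
  assumes "s \<in> {1, -1}" "t \<in> {1, -1}"
  shows "lattice_adjacent (i, j) (i + s, j)" "lattice_adjacent (i, j) (i, j + t)"
    "lattice_adjacent (i + s, j + t) (i + s, j)" "lattice_adjacent (i + s, j + t) (i, j + t)"
  using assms by (auto simp: lattice_adjacent_def)

lemma diagonal_G_edges:
  assumes "s \<in> {1, -1}" "t \<in> {1, -1}"
  shows "{(i, j), (i + s, j + t)} \<in> G_edges \<longleftrightarrow>
    h (i + s, j) \<noteq> h (i, j + t) \<and> (h (i, j) < p (i, j) \<or> h (i + s, j + t) < p (i + s, j + t))"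
  using corner_graph_edge[OF assms] by (simp add: G_edges_iff)

lemma adjacent_G_edges:
  assumes "lattice_adjacent F F'"
  shows "{F, F'} \<in> G_edges \<longleftrightarrow> h F < p F \<or> h F' < p F'"
  using assms by (simp add: G_edges_iff graph_edges_def doubleton_weighted_edges)

lemma matching_ind:
  assumes "perfect_matching h (n0, i0, j0) M" "s \<in> {1, -1}" "t \<in> {1, -1}"
  shows "ind M (i, j) (i + s, j + t) =
    (if {(i, j), (i + s, j + t)} \<in> G_edges \<and> block_total M i j s t = 0 then 1 else 0)"
  using diagonal_matched[OF assms, of i j] assms(1) unfolding perfect_matching_config ind_def by auto

lemma corner_exp_cut:
  "corner_exp cut M i j s t =
    (if cut (i + s, j) = cut (i, j + t) then 0 else if block_total M i j s t = 0 then - 1 else 1)"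
  by (simp add: corner_exp_def block_total_def)

lemma corner_exp_closed:
  assumes M: "perfect_matching h (n0, i0, j0) M" and st: "s \<in> {1, -1}" "t \<in> {1, -1}"
    and closed: "h (i, j) < p (i, j)"
  shows "ind G_edges (i, j) (i + s, j + t) - 2 * ind M (i, j) (i + s, j + t) = corner_exp cut M i j s t"
proof -
  have "cut (i + s, j) = h (i + s, j)" "cut (i, j + t) = h (i, j + t)"
    using cut_next_to_closed[OF closed] corner_adjacent(1,2)[OF st] by blast+
  then show ?thesis
    unfolding corner_exp_cut matching_ind[OF M st] diagonal_G_edges[OF st] using closed
    by (simp add: ind_def diagonal_G_edges[OF st])
qed

text \<open>A corner of an open face may carry a diagonal of \<open>cut\<close> that is not in the
  finite graph. All four faces of its block are then open, so the block has no weighted edges and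
  the diagonal counts as matched, contributing -1 to \<open>corner_exp\<close> and 0 to the finite
  graph. The right-hand side counts these corners.\<close>

lemma corner_exp_open:
  assumes M: "perfect_matching h (n0, i0, j0) M" and st: "s \<in> {1, -1}" "t \<in> {1, -1}"
    and op: "\<not> h (i, j) < p (i, j)"
  shows "ind G_edges (i, j) (i + s, j + t) - 2 * ind M (i, j) (i + s, j + t) - corner_exp cut M i j s t =
    of_bool (p (i + s, j) \<noteq> p (i, j + t) \<and> \<not> h (i + s, j) < p (i + s, j) \<and> \<not> h (i, j + t) < p (i, j + t))"
proof -
  define X Y D where "X = (i + s, j)" and "Y = (i, j + t)" and "D = (i + s, j + t)"
  note defs = X_def Y_def D_def
  have adj: "lattice_adjacent (i, j) X" "lattice_adjacent (i, j) Y" "lattice_adjacent D X" "lattice_adjacent D Y"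
    using corner_adjacent[OF st] by (simp_all add: defs)
  have cut: "\<bar>cut (i, j) - cut X\<bar> = 1" "\<bar>cut (i, j) - cut Y\<bar> = 1" "\<bar>cut D - cut X\<bar> = 1" "\<bar>cut D - cut Y\<bar> = 1"
    using step_functionD[OF step_cut] adj by blast+
  have p: "\<bar>p (i, j) - p X\<bar> = 1" "\<bar>p (i, j) - p Y\<bar> = 1" "\<bar>p D - p X\<bar> = 1" "\<bar>p D - p Y\<bar> = 1"
    using step_functionD[OF step_p] adj by blast+
  have le: "cut F \<le> p F" "h F < p F \<longleftrightarrow> cut F < p F" for F
    by (auto simp: cut_def)
  have C: "cut (i, j) = p (i, j)"
    using op by (simp add: cut_def)
  have wrench: "p (i, j) \<noteq> p D \<or> p X \<noteq> p Y"
    using p_block(5)[of i j] p_block(5)[of "i - 1" j] p_block(5)[of i "j - 1"] p_block(5)[of "i - 1" "j - 1"] st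
    by (auto simp: defs)
  have G: "{(i, j), D} \<in> G_edges \<longleftrightarrow> h X \<noteq> h Y \<and> h D < p D"
    using diagonal_G_edges[OF st] op by (simp add: defs)
  have hcut: "cut X = h X" "cut Y = h Y" if "h D < p D"
    using cut_next_to_closed[OF that] adj by blast+
  have lhs: "ind G_edges (i, j) D - 2 * ind M (i, j) D - corner_exp cut M i j s t =
    (if {(i, j), D} \<in> G_edges then 1 - 2 * of_bool (block_total M i j s t = 0) else 0) -
    (if cut X = cut Y then 0 else if block_total M i j s t = 0 then - 1 else 1)"
    using matching_ind[OF M st, of i j] corner_exp_cut[of M i j s t] by (simp add: defs ind_def)
  have "ind G_edges (i, j) D - 2 * ind M (i, j) D - corner_exp cut M i j s t =
    of_bool (p X \<noteq> p Y \<and> \<not> h X < p X \<and> \<not> h Y < p Y)"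
  proof (cases "cut X = cut Y")
    case True
    then have "{(i, j), D} \<notin> G_edges"
      using G hcut by auto
    moreover have "\<not> (p X \<noteq> p Y \<and> \<not> h X < p X \<and> \<not> h Y < p Y)"
      using True le(1)[of X] le(1)[of Y] unfolding le(2) by linarith
    ultimately show ?thesis
      unfolding lhs using True by simp
  next
    case False
    show ?thesis
    proof (cases "h D < p D")
      case True
      then have "{(i, j), D} \<in> G_edges"
        using G hcut False by simp
      moreover have "\<not> (p X \<noteq> p Y \<and> \<not> h X < p X \<and> \<not> h Y < p Y)"
        using True cut p le(1)[of X] le(1)[of Y] C unfolding le(2) by linarith
      ultimately show ?thesis
        unfolding lhs using False by simp
    next
      case D: False
      then have D': "cut D = p D"
        using le[of D] by auto
      have eq: "p D = p (i, j)"
        using cut False C D' by linarith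
      then have "p X \<noteq> p Y"
        using wrench by auto
      then have op': "\<not> h X < p X \<and> \<not> h Y < p Y"
      proof -
        have "cut X = p (i, j) + 1 \<or> cut X = p (i, j) - 1" "cut Y = p (i, j) + 1 \<or> cut Y = p (i, j) - 1"
          "p X = p (i, j) + 1 \<or> p X = p (i, j) - 1" "p Y = p (i, j) + 1 \<or> p Y = p (i, j) - 1"
          using cut(1,2) p(1,2) C by linarith+
        then show ?thesis
          using le(1)[of X] le(1)[of Y] False \<open>p X \<noteq> p Y\<close> unfolding le(2) by auto
      qed
      have "e \<notin> M" if "e \<in> {{(i, j), X}, {(i, j), Y}, {X, D}, {Y, D}}" for e
      proof -
        have "M \<subseteq> G_edges"
          using M by (simp add: perfect_matching_config)
        moreover have "e \<notin> G_edges"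
          using that op op' D by (auto simp: G_edges_iff)
        ultimately show ?thesis
          by blast
      qed
      then have "block_total M i j s t = 0"
        by (simp add: block_total_def ind_def defs)
      then show ?thesis
        unfolding lhs using G D False \<open>p X \<noteq> p Y\<close> op' by simp
    qed
  qed
  then show ?thesis
    by (simp add: defs)
qed

text \<open>For a matching this is \<beta> - \<alpha>, as \<beta> excludes the matched
  edges.\<close>

definition edge_balance :: "edge set \<Rightarrow> face \<Rightarrow> int" where
  "edge_balance M F = int (card (boundary_edges h F \<inter> G_edges)) - 2 * int (card (boundary_edges h F \<inter> M))"

lemma edge_balance_sum:
  assumes "M \<subseteq> G_edges"
  shows "edge_balance M (i, j) =
    (ind G_edges (i, j) (i + 1, j) + ind G_edges (i, j) (i - 1, j) +
     ind G_edges (i, j) (i, j + 1) + ind G_edges (i, j) (i, j - 1)) -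
    2 * (ind M (i, j) (i + 1, j) + ind M (i, j) (i - 1, j) + ind M (i, j) (i, j + 1) + ind M (i, j) (i, j - 1)) +
    (ind G_edges (i, j) (i + 1, j + 1) - 2 * ind M (i, j) (i + 1, j + 1)) +
    (ind G_edges (i, j) (i - 1, j + 1) - 2 * ind M (i, j) (i - 1, j + 1)) +
    (ind G_edges (i, j) (i - 1, j - 1) - 2 * ind M (i, j) (i - 1, j - 1)) +
    (ind G_edges (i, j) (i + 1, j - 1) - 2 * ind M (i, j) (i + 1, j - 1))"
proof -
  have "G_edges \<subseteq> graph_edges h" "M \<subseteq> graph_edges h"
    using assms by (auto simp: G_edges_iff)
  then show ?thesis
    unfolding edge_balance_def by (simp add: card_boundary_edges)
qed

lemma finite_boundary_edges: "finite (boundary_edges h F)"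
proof -
  have "boundary_edges h F \<subseteq> (\<lambda>d. {F, (fst F + fst d, snd F + snd d)}) ` directions"
    using boundary_edges_iff[of _ "fst F" "snd F"] unfolding prod.collapse by blast
  then show ?thesis
    by (rule finite_subset) simp
qed

lemma face_exponent_balance:
  assumes "M \<subseteq> G_edges"
  shows "face_exponent h (n0, i0, j0) M F = (edge_balance M F + 1) div 2 - of_bool (h F < p F)"
proof -
  have "boundary_edges h F \<inter> G_edges = (boundary_edges h F \<inter> G_edges - M) \<union> (boundary_edges h F \<inter> M)"
    using assms by blast
  then have "card (boundary_edges h F \<inter> G_edges) =
      card ((boundary_edges h F \<inter> G_edges - M) \<union> (boundary_edges h F \<inter> M))"
    by simp
  also have "\<dots> = card (boundary_edges h F \<inter> G_edges - M) + card (boundary_edges h F \<inter> M)"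
    using finite_boundary_edges by (intro card_Un_disjoint) auto
  finally have "int (card (boundary_edges h F \<inter> G_edges - M)) - int (card (boundary_edges h F \<inter> M)) =
      edge_balance M F"
    by (simp add: edge_balance_def)
  then show ?thesis
    unfolding face_exponent_def Let_def ceiling_half closed_faces_iff by simp
qed

text \<open>For a closed face the balance is the doubled exponent plus 2, and the -1 in the
  definition matches. For other faces it is the doubled exponent or 1 less; the doubled exponent is
  even, so rounding up gives the same half in both cases.\<close>

lemma config_exp_balance:
  assumes M: "perfect_matching h (n0, i0, j0) M"
  shows "config_exp cut M F = (edge_balance M F + 1) div 2 - of_bool (h F < p F)"
proof -
  obtain i j where F: "F = (i, j)"
    by fastforce
  have sub: "M \<subseteq> G_edges"
    using M by (simp add: perfect_matching_config)
  have adj: "ind G_edges (i, j) F' = of_bool (h (i, j) < p (i, j) \<or> h F' < p F')"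
    if "F' \<in> {(i + 1, j), (i - 1, j), (i, j + 1), (i, j - 1)}" for F'
    using adjacent_G_edges[of "(i, j)" F'] that unfolding lattice_adjacent_iff ind_def by simp
  have even: "even (double_exp cut M (i, j))"
    by (rule even_double_exp[OF step_cut])
  show ?thesis
  proof (cases "h (i, j) < p (i, j)")
    case True
    note c = corner_exp_closed[OF M _ _ True]
    have "edge_balance M (i, j) = double_exp cut M (i, j) + 2"
      unfolding edge_balance_sum[OF sub] double_exp_def prod.case
      using c[of 1 1] c[of "-1" 1] c[of "-1" "-1"] c[of 1 "-1"] adj True by simp
    then show ?thesis
      using even True unfolding config_exp_def F by auto
  next
    case False
    note c = corner_exp_open[OF M _ _ False]
    define cl where "cl F \<longleftrightarrow> h F < p F" for F
    \<comment> \<open>The number of weighted boundary edges in the finite graph plus the number of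
      corners with a diagonal of \<open>cut\<close> outside it.\<close>
    define Q :: int where "Q = of_bool (cl (i + 1, j)) + of_bool (cl (i - 1, j)) +
      of_bool (cl (i, j + 1)) + of_bool (cl (i, j - 1)) +
      of_bool (p (i + 1, j) \<noteq> p (i, j + 1) \<and> \<not> cl (i + 1, j) \<and> \<not> cl (i, j + 1)) +
      of_bool (p (i - 1, j) \<noteq> p (i, j + 1) \<and> \<not> cl (i - 1, j) \<and> \<not> cl (i, j + 1)) +
      of_bool (p (i - 1, j) \<noteq> p (i, j - 1) \<and> \<not> cl (i - 1, j) \<and> \<not> cl (i, j - 1)) +
      of_bool (p (i + 1, j) \<noteq> p (i, j - 1) \<and> \<not> cl (i + 1, j) \<and> \<not> cl (i, j - 1))"
    have "edge_balance M (i, j) + 2 - double_exp cut M (i, j) = Q"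
      unfolding edge_balance_sum[OF sub] double_exp_def prod.case Q_def cl_def
      using c[of 1 1] c[of "-1" 1] c[of "-1" "-1"] c[of 1 "-1"] adj False by simp
    moreover have "Q = 1 \<or> Q = 2"
    proof -
      have "h (i0, j0) < p (i0, j0)"
        using apex by (auto simp: upper_points_def p_def)
      then have ne: "i \<noteq> i0 \<or> j \<noteq> j0"
        using False by auto
      have up: "p F' = p (i, j) + 1" if "cl F'" "lattice_adjacent (i, j) F'" for F'
      proof -
        have "h F' \<le> p F' - 2"
          using that(1) closed_below by (simp add: cl_def)
        then show ?thesis
          using step_functionD[OF step_h that(2)] step_functionD[OF step_p that(2)] False by linarith
      qed
      have shift: "p (i + 1, j) = p (i, j) + (if i < i0 then 1 else - 1)"
        "p (i - 1, j) = p (i, j) + (if i > i0 then 1 else - 1)"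
        "p (i, j + 1) = p (i, j) + (if j < j0 then 1 else - 1)"
        "p (i, j - 1) = p (i, j) + (if j > j0 then 1 else - 1)"
        by (auto simp: p_def)
      \<comment> \<open>Only neighbours towards the apex can be closed. Off the axes there are two
        such directions, each giving 1 to \<open>Q\<close> either as an edge or as a corner
        diagonal. On an axis the single one gives 1 if closed and 2 if open. The apex itself is
        closed and therefore excluded.\<close>
      have "cl (i + 1, j) \<longrightarrow> i < i0" "cl (i - 1, j) \<longrightarrow> i > i0" "cl (i, j + 1) \<longrightarrow> j < j0" "cl (i, j - 1) \<longrightarrow> j > j0"
        using up[of "(i + 1, j)"] up[of "(i - 1, j)"] up[of "(i, j + 1)"] up[of "(i, j - 1)"]
        unfolding lattice_adjacent_iff shift by (auto split: if_splits)
      then show ?thesis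
        using ne unfolding Q_def shift
        by (cases i i0 rule: linorder_cases; cases j j0 rule: linorder_cases) auto
    qed
    ultimately have "edge_balance M (i, j) = double_exp cut M (i, j) - 1 \<or>
        edge_balance M (i, j) = double_exp cut M (i, j)"
      by linarith
    then have "(edge_balance M (i, j) + 1) div 2 = double_exp cut M (i, j) div 2"
      using even by auto
    then show ?thesis
      using False by (simp add: config_exp_def F)
  qed
qed

lemma face_exponent_config_exp:
  assumes "perfect_matching h (n0, i0, j0) M"
  shows "face_exponent h (n0, i0, j0) M F = config_exp cut M F"
  using assms face_exponent_balance config_exp_balance by (simp add: perfect_matching_config)

lemma config_exp_outside:
  assumes "perfect_matching h (n0, i0, j0) M" "F \<notin> sub_faces h (n0, i0, j0)"
  shows "config_exp cut M F = 0"
proof -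
  have F: "\<not> h F < p F" "boundary_edges h F \<inter> G_edges = {}"
    using assms(2) by (auto simp: sub_faces_def open_faces_def closed_faces_iff)
  have "M \<subseteq> G_edges"
    using assms(1) by (simp add: perfect_matching_config)
  then have "boundary_edges h F \<inter> M = {}"
    using F(2) by blast
  then have "edge_balance M F = 0"
    unfolding edge_balance_def F(2) by simp
  then show ?thesis
    using config_exp_balance[OF assms(1)] F(1) by simp
qed

lemma sub_face_closed_neighbour:
  assumes "F \<in> sub_faces h (n0, i0, j0)" "\<not> h F < p F"
  obtains K where "h K < p K" "{F, K} \<in> graph_edges h"
proof -
  obtain e where e: "e \<in> graph_edges h" "F \<in> e" "e \<in> G_edges"
    using assms by (auto simp: sub_faces_def open_faces_def boundary_edges_def closed_faces_iff)
  then obtain K where K: "K \<in> e" "h K < p K"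
    by (auto simp: G_edges_iff)
  have "e = {F, K}"
    using e(1)
    by (cases rule: graph_edge_cases) (use K e(2) assms(2) in auto)
  then show thesis
    using that K e by blast
qed

lemma graph_edge_near:
  assumes "{F, K} \<in> graph_edges h" "F \<noteq> K"
  shows "\<bar>fst F - fst K\<bar> \<le> 1" "\<bar>snd F - snd K\<bar> \<le> 1" "lattice_adjacent F K \<or> h F = h K"
    "p K - 2 \<le> p F"
proof -
  have "lattice_adjacent F K \<or> h F = h K \<and> \<bar>fst F - fst K\<bar> = 1 \<and> \<bar>snd F - snd K\<bar> = 1"
    using assms(1) unfolding graph_edges_def
  proof (elim UnE)
    assume "{F, K} \<in> weighted_edges"
    then show ?thesis
      by (simp add: doubleton_weighted_edges)
  next
    assume "{F, K} \<in> unweighted_edges h"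
    then show ?thesis
      unfolding unweighted_edges_def by (auto simp: doubleton_eq_iff)
  qed
  then show "\<bar>fst F - fst K\<bar> \<le> 1" "\<bar>snd F - snd K\<bar> \<le> 1" "lattice_adjacent F K \<or> h F = h K"
    by (auto simp: lattice_adjacent_def)
  then show "p K - 2 \<le> p F"
    unfolding p_def by arith
qed

lemma sub_face_properties:
  assumes "F \<in> sub_faces h (n0, i0, j0)"
  shows "cut F = h F" "F \<in> nearby"
proof -
  have "cut F = h F \<and> F \<in> nearby"
  proof (cases "h F < p F")
    case True
    then show ?thesis
      using nearbyI[of "fst F" "snd F" 0 0] by (simp add: cut_def)
  next
    case False
    from sub_face_closed_neighbour[OF assms this] obtain K where K: "h K < p K" "{F, K} \<in> graph_edges h" .
    then have "F \<noteq> K"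
      using False by auto
    note near = graph_edge_near[OF K(2) this]
    have "cut F = h F"
      using near(3)
    proof
      assume "lattice_adjacent F K"
      then show ?thesis
        using cut_next_to_closed[OF K(1)] lattice_adjacent_commute by blast
    next
      assume "h F = h K"
      then show ?thesis
        \<comment> \<open>Across a diagonal the height is unchanged and the cone drops by at most 2,
          which the gap at \<open>K\<close> allows.\<close>
        using near(4) closed_below[OF K(1)] by (simp add: cut_def)
    qed
    moreover have "F \<in> nearby"
      using nearbyI[of "fst K" "snd K" "fst F - fst K" "snd F - snd K"] K(1) near(1,2)
      by (simp add: abs_le_iff)
    ultimately show ?thesis ..
  qed
  then show "cut F = h F" "F \<in> nearby"
    by auto
qed

lemma edge_label_cut:
  assumes "e \<in> height_edges cut"
  shows "edge_label cut e = edge_label h e"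
proof (rule edge_label_cong)
  show "e \<in> weighted_edges"
    using assms by (simp add: height_edges_def)
  obtain F F' where F: "e = {F, F'}" "lattice_adjacent F F'" "h F < p F \<or> h F' < p F'"
    using assms by (auto simp: height_edges_def weighted_edges_def cut_closed)
  then have "cut F = h F" "cut F' = h F'"
    using cut_next_to_closed lattice_adjacent_commute by (metis cut_def min.strict_order_iff min_def order_less_imp_le)+
  then show "cut G = h G" if "G \<in> e" for G
    using that F(1) by auto
qed

text \<open>On the faces of the finite graph \<open>cut\<close> is \<open>h\<close>, so the
  recurrence gives variables there; all other faces in \<open>nearby\<close> have exponent
  0.\<close>

lemma config_weight_matching:
  assumes M: "perfect_matching h (n0, i0, j0) M"
  shows "config_weight val cut nearby (M \<inter> weighted_edges) =
    (\<Prod>e\<in>M \<inter> weighted_edges. edge_label h e) *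
    (\<Prod>F\<in>sub_faces h (n0, i0, j0). xvar F powi face_exponent h (n0, i0, j0) M F)"
proof -
  have same: "same_weighted (M \<inter> weighted_edges) M"
    by (auto simp: same_weighted_def)
  have "M \<inter> weighted_edges \<subseteq> height_edges cut"
    using M unfolding perfect_matching_config height_edges_cut by blast
  then have "(\<Prod>e\<in>M \<inter> weighted_edges. edge_label cut e) = (\<Prod>e\<in>M \<inter> weighted_edges. edge_label h e)"
    using edge_label_cut by (intro prod.cong) auto
  moreover have "(\<Prod>F\<in>nearby. val F (cut F) powi config_exp cut (M \<inter> weighted_edges) F) =
    (\<Prod>F\<in>sub_faces h (n0, i0, j0). val F (cut F) powi config_exp cut (M \<inter> weighted_edges) F)"
    using sub_face_properties(2) config_exp_outside[OF M] finite_nearby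
    by (intro prod.mono_neutral_right) (auto simp: same_weighted_exp[OF same])
  moreover have "val F (cut F) powi config_exp cut (M \<inter> weighted_edges) F =
      xvar F powi face_exponent h (n0, i0, j0) M F"
    if "F \<in> sub_faces h (n0, i0, j0)" for F
  proof -
    have "(h F, fst F, snd F) \<in> initial_points h"
      using even_h[of "fst F" "snd F"]
      by (cases F) (simp add: initial_points_def lattice_def cong_iff_dvd_diff diff_diff_eq)
    then show ?thesis
      using octahedron_initial sub_face_properties(1)[OF that]
      by (simp add: same_weighted_exp[OF same] face_exponent_config_exp[OF M])
  qed
  ultimately show ?thesis
    unfolding config_weight_def by simp
qed

lemma octahedron_matching_sum:
  "octahedron h n0 i0 j0 =
     (\<Sum>M | perfect_matching h (n0, i0, j0) M.
        (\<Prod>e\<in>M \<inter> weighted_edges. edge_label h e) *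
        (\<Prod>F\<in>sub_faces h (n0, i0, j0). xvar F powi face_exponent h (n0, i0, j0) M F))"
proof -
  have "octahedron h n0 i0 j0 = config_sum cut"
    using config_sum_admissible[OF admissible_cut] ..
  also have "\<dots> = (\<Sum>A | A \<in> Pow (height_edges cut) \<and> valid_config cut A. config_weight val cut nearby A)"
    unfolding config_sum_def
    by (rule sum.inter_filter[symmetric]) (simp add: finite_height_edges[OF admissible_cut])
  also have "\<dots> = (\<Sum>M | perfect_matching h (n0, i0, j0) M.
      config_weight val cut nearby (M \<inter> weighted_edges))"
    by (rule sum_configs)
  also have "\<dots> = (\<Sum>M | perfect_matching h (n0, i0, j0) M.
        (\<Prod>e\<in>M \<inter> weighted_edges. edge_label h e) *
        (\<Prod>F\<in>sub_faces h (n0, i0, j0). xvar F powi face_exponent h (n0, i0, j0) M F))"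
    by (rule sum.cong) (simp_all add: config_weight_matching)
  finally show ?thesis .
qed

end

text \<open>By the triangle inequality the smaller cone lies below the larger one, so closed faces
  stay closed. An open face becomes closed or still has an edge of the larger graph on its
  boundary.\<close>

lemma subgraph_mono:
  assumes "n' \<le> n - \<bar>i' - i\<bar> - \<bar>j' - j\<bar>"
  shows "sub_vertices h (n', i', j') \<subseteq> sub_vertices h (n, i, j)"
    and "sub_edges h (n', i', j') \<subseteq> sub_edges h (n, i, j)"
    and "sub_faces h (n', i', j') \<subseteq> sub_faces h (n, i, j)"
proof -
  have closed: "closed_faces h (n', i', j') \<subseteq> closed_faces h (n, i, j)"
    using assms by (auto simp: closed_faces_def)
  then show edges: "sub_edges h (n', i', j') \<subseteq> sub_edges h (n, i, j)"
    by (auto simp: sub_edges_def)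
  then show "sub_vertices h (n', i', j') \<subseteq> sub_vertices h (n, i, j)"
    by (auto simp: sub_vertices_def)
  show "sub_faces h (n', i', j') \<subseteq> sub_faces h (n, i, j)"
    using closed edges by (auto simp: sub_faces_def open_faces_def)
qed

theorem mainTheorem2:
  fixes h :: "int \<times> int \<Rightarrow> int"
  assumes "height_function h"
  shows
    "(\<forall>n i j. (n, i, j) \<in> upper_points h \<longrightarrow>
        octahedron h n i j =
          (\<Sum>M | perfect_matching h (n, i, j) M.
             (\<Prod>e\<in>M \<inter> weighted_edges. edge_label h e) *
             (\<Prod>F\<in>sub_faces h (n, i, j). xvar F powi face_exponent h (n, i, j) M F))) \<and>
     (\<forall>n i j n' i' j'. (n, i, j) \<in> upper_points h \<longrightarrow> (n', i', j') \<in> upper_points h \<longrightarrow>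
        n' \<le> n - \<bar>i' - i\<bar> - \<bar>j' - j\<bar> \<longrightarrow>
        sub_vertices h (n', i', j') \<subseteq> sub_vertices h (n, i, j) \<and>
        sub_edges h (n', i', j') \<subseteq> sub_edges h (n, i, j) \<and>
        sub_faces h (n', i', j') \<subseteq> sub_faces h (n, i, j))"
proof (intro conjI allI impI)
  fix n i j
  assume "(n, i, j) \<in> upper_points h"
  then interpret cone h n i j
    by unfold_locales (rule assms)
  show "octahedron h n i j =
          (\<Sum>M | perfect_matching h (n, i, j) M.
             (\<Prod>e\<in>M \<inter> weighted_edges. edge_label h e) *
             (\<Prod>F\<in>sub_faces h (n, i, j). xvar F powi face_exponent h (n, i, j) M F))"
    by (rule octahedron_matching_sum)
qed (rule subgraph_mono; assumption)+

end
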